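(* Let $(R,\mathfrak m)$ be a one-dimensional, Cohen-Macaulay, analytically unramified (Noetherian) local ring with embedding dimension $\nu$, such that the residue field $\Bbbk=R/\mathfrak m$ is infinite. Let $\overline R$ be the integral closure of $R$ in its total ring of fractions and assume that the conductor $\mathfrak c=R:\overline R$ is $\mathfrak m$-primary. Then $$e(\mathfrak c)\le (\nu-1)\,\ell(R/\mathfrak c)^2+\ell(R/\mathfrak c).$$ In particular, $e(\mathfrak c)\le \nu\cdot \ell(R/\mathfrak c)^2$. Moreover, equality holds in both inequalities if and only if $\ell(R/\mathfrak c)=1$.
   Context: Analytically unramified means that the $\mathfrak m$-adic completion $\hat R$ is reduced; in the present setting this is equivalent to $\overline R$ being a finite $R$-module. $Q(R)$ denotes the total ring of fractions of $R$, and $\mathfrak c = R:\overline R=\{z\in Q(R) : z\overline R\subseteq R\}$ is the conductor. The assumption that $\mathfrak c$ is $\mathfrak m$-primary (in particular a proper ideal) excludes the case where $R$ is a DVR, in which $\mathfrak c=R$. $\ell$ denotes length as an $R$-module, $e(\mathfrak c)$ is the Hilbert-Samuel multiplicity of the $\mathfrak m$-primary ideal $\mathfrak c$ (on $R$), and $\nu=\dim_{\Bbbk}\mathfrak m/\mathfrak m^2$ is the embedding dimension. *)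

theory Defs
  imports Complex_Main
    "HOL-Library.Extended_Nat"
    "HOL-Algebra.Algebra"
    "Jordan_Normal_Form.Missing_VectorSpace"
begin

section \<open>Local rings, dimension, depth\<close>

locale local_ring = cring R + maximalideal \<mm> R for R (structure) and \<mm> +
  assumes unique_maximal: "maximalideal J R \<Longrightarrow> J = \<mm>"

text \<open>Supremum of the lengths \<open>n\<close> of chains \<open>P 0 \<subset> \<dots> \<subset> P n\<close> of prime ideals.\<close>

definition krull_dim :: "('a, 'b) ring_scheme \<Rightarrow> enat" where
  "krull_dim R = Sup {enat n | n. \<exists>P :: nat \<Rightarrow> 'a set.
     (\<forall>i\<le>n. primeideal (P i) R) \<and> (\<forall>i<n. P i \<subset> P (Suc i))}"

definition nonzerodivisors :: "('a, 'b) ring_scheme \<Rightarrow> 'a set" where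
  "nonzerodivisors R =
     {s \<in> carrier R. \<forall>a \<in> carrier R. s \<otimes>\<^bsub>R\<^esub> a = \<zero>\<^bsub>R\<^esub> \<longrightarrow> a = \<zero>\<^bsub>R\<^esub>}"

definition regular_sequence :: "('a, 'b) ring_scheme \<Rightarrow> 'a list \<Rightarrow> bool" where
  "regular_sequence R xs \<longleftrightarrow>
     set xs \<subseteq> carrier R \<and> Idl\<^bsub>R\<^esub> (set xs) \<noteq> carrier R \<and>
     (\<forall>i < length xs. let J = Idl\<^bsub>R\<^esub> (set (take i xs)) in
        J +>\<^bsub>R\<^esub> (xs ! i) \<in> nonzerodivisors (R Quot J))"

definition depth :: "('a, 'b) ring_scheme \<Rightarrow> 'a set \<Rightarrow> enat" where
  "depth R \<mm> = Sup {enat (length xs) | xs. set xs \<subseteq> \<mm> \<and> regular_sequence R xs}"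

definition cohen_macaulay :: "('a, 'b) ring_scheme \<Rightarrow> 'a set \<Rightarrow> bool" where
  "cohen_macaulay R \<mm> \<longleftrightarrow> noetherian_ring R \<and> local_ring R \<mm> \<and> depth R \<mm> = krull_dim R"


section \<open>Powers of ideals, completion\<close>

abbreviation ideal_pow :: "('a, 'b) ring_scheme \<Rightarrow> 'a set \<Rightarrow> nat \<Rightarrow> 'a set" where
  "ideal_pow R I n \<equiv> I [^]\<^bsub>ideals_set R\<^esub> n"

text \<open>The inverse limit of the rings \<open>R / I\<^sup>n\<close>.  The transition map sends a coset of
  \<open>I\<^sup>n\<^sup>+\<^sup>1\<close> to the unique coset of \<open>I\<^sup>n\<close> that contains it.\<close>

definition adic_completion :: "('a, 'b) ring_scheme \<Rightarrow> 'a set \<Rightarrow> (nat \<Rightarrow> 'a set) ring" where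
  "adic_completion R I =
     \<lparr> carrier = {f. (\<forall>n. f n \<in> carrier (R Quot ideal_pow R I n)) \<and> (\<forall>n. f (Suc n) \<subseteq> f n)},
       monoid.mult = (\<lambda>f g n. f n \<otimes>\<^bsub>R Quot ideal_pow R I n\<^esub> g n),
       one = (\<lambda>n. \<one>\<^bsub>R Quot ideal_pow R I n\<^esub>),
       ring.zero = (\<lambda>n. \<zero>\<^bsub>R Quot ideal_pow R I n\<^esub>),
       add = (\<lambda>f g n. f n \<oplus>\<^bsub>R Quot ideal_pow R I n\<^esub> g n) \<rparr>"

definition reduced_ring :: "('a, 'b) ring_scheme \<Rightarrow> bool" where
  "reduced_ring A \<longleftrightarrow> (\<forall>x \<in> carrier A. \<forall>n :: nat. x [^]\<^bsub>A\<^esub> n = \<zero>\<^bsub>A\<^esub> \<longrightarrow> x = \<zero>\<^bsub>A\<^esub>)"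

definition analytically_unramified :: "('a, 'b) ring_scheme \<Rightarrow> 'a set \<Rightarrow> bool" where
  "analytically_unramified R \<mm> \<longleftrightarrow> reduced_ring (adic_completion R \<mm>)"


section \<open>Total ring of fractions, integral closure, conductor\<close>

text \<open>The class of \<open>a / s\<close>; as denominators are nonzerodivisors, no extra factor is needed
  in the equivalence of fractions.\<close>

definition fraction :: "('a, 'b) ring_scheme \<Rightarrow> 'a \<Rightarrow> 'a \<Rightarrow> ('a \<times> 'a) set" where
  "fraction R a s = {(b, t). b \<in> carrier R \<and> t \<in> nonzerodivisors R \<and> a \<otimes>\<^bsub>R\<^esub> t = b \<otimes>\<^bsub>R\<^esub> s}"

definition total_frac_ring :: "('a, 'b) ring_scheme \<Rightarrow> ('a \<times> 'a) set ring" where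
  "total_frac_ring R =
     \<lparr> carrier = {fraction R a s | a s. a \<in> carrier R \<and> s \<in> nonzerodivisors R},
       monoid.mult = (\<lambda>U V. \<Union>(a, s) \<in> U. \<Union>(b, t) \<in> V. fraction R (a \<otimes>\<^bsub>R\<^esub> b) (s \<otimes>\<^bsub>R\<^esub> t)),
       one = fraction R \<one>\<^bsub>R\<^esub> \<one>\<^bsub>R\<^esub>,
       ring.zero = fraction R \<zero>\<^bsub>R\<^esub> \<one>\<^bsub>R\<^esub>,
       add = (\<lambda>U V. \<Union>(a, s) \<in> U. \<Union>(b, t) \<in> V.
                fraction R (a \<otimes>\<^bsub>R\<^esub> t \<oplus>\<^bsub>R\<^esub> b \<otimes>\<^bsub>R\<^esub> s) (s \<otimes>\<^bsub>R\<^esub> t)) \<rparr>"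

definition frac_embed :: "('a, 'b) ring_scheme \<Rightarrow> 'a \<Rightarrow> ('a \<times> 'a) set" where
  "frac_embed R a = fraction R a \<one>\<^bsub>R\<^esub>"

text \<open>Library polynomials are coefficient lists with the leading coefficient first.\<close>

definition integral_closure_in :: "('a, 'b) ring_scheme \<Rightarrow> 'a set \<Rightarrow> 'a set" where
  "integral_closure_in A K = {z \<in> carrier A. \<exists>p. polynomial\<^bsub>A\<^esub> K p \<and> p \<noteq> [] \<and>
     hd p = \<one>\<^bsub>A\<^esub> \<and> ring.eval A p z = \<zero>\<^bsub>A\<^esub>}"

definition integral_closure :: "('a, 'b) ring_scheme \<Rightarrow> ('a \<times> 'a) set set" where
  "integral_closure R = integral_closure_in (total_frac_ring R) (frac_embed R ` carrier R)"

definition conductor :: "('a, 'b) ring_scheme \<Rightarrow> ('a \<times> 'a) set set" where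
  "conductor R = {z \<in> carrier (total_frac_ring R).
     \<forall>w \<in> integral_closure R. z \<otimes>\<^bsub>total_frac_ring R\<^esub> w \<in> frac_embed R ` carrier R}"

text \<open>The conductor lies in the image of \<open>R\<close>, since \<open>1\<close> is integral; this is the same ideal
  as a subset of \<open>R\<close> itself.\<close>

definition conductor_ideal :: "('a, 'b) ring_scheme \<Rightarrow> 'a set" where
  "conductor_ideal R = {r \<in> carrier R. frac_embed R r \<in> conductor R}"


section \<open>Primary ideals\<close>

definition radical :: "('a, 'b) ring_scheme \<Rightarrow> 'a set \<Rightarrow> 'a set" where
  "radical R I = {x \<in> carrier R. \<exists>n :: nat. x [^]\<^bsub>R\<^esub> n \<in> I}"

definition primary_ideal :: "('a, 'b) ring_scheme \<Rightarrow> 'a set \<Rightarrow> bool" where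
  "primary_ideal R I \<longleftrightarrow> ideal I R \<and> I \<noteq> carrier R \<and>
     (\<forall>a \<in> carrier R. \<forall>b \<in> carrier R. a \<otimes>\<^bsub>R\<^esub> b \<in> I \<longrightarrow> a \<in> I \<or> b \<in> radical R I)"

definition primary_to :: "('a, 'b) ring_scheme \<Rightarrow> 'a set \<Rightarrow> 'a set \<Rightarrow> bool" where
  "primary_to R P I \<longleftrightarrow> primary_ideal R I \<and> radical R I = P"


section \<open>Length, embedding dimension, multiplicity\<close>

text \<open>Supremum of the lengths of strict chains of submodules; it is infinite if the module has no
  composition series.\<close>

definition module_length :: "('r, 'b) ring_scheme \<Rightarrow> ('r, 'a, 'c) module_scheme \<Rightarrow> enat" where
  "module_length R M = Sup {enat n | n. \<exists>N :: nat \<Rightarrow> 'a set.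
     (\<forall>i\<le>n. Module.submodule (N i) R M) \<and> (\<forall>i<n. N i \<subset> N (Suc i))}"

text \<open>\<open>R / I\<close> as an \<open>R\<close>-module.\<close>

definition quot_module :: "('a, 'b) ring_scheme \<Rightarrow> 'a set \<Rightarrow> ('a, 'a set) module" where
  "quot_module R I =
     ring.extend (R Quot I) \<lparr> smult = (\<lambda>r U. (I +>\<^bsub>R\<^esub> r) \<otimes>\<^bsub>R Quot I\<^esub> U) \<rparr>"

text \<open>\<open>\<mm> / \<mm>\<^sup>2\<close> over \<open>R / \<mm>\<close>.  For \<open>x \<in> \<mm>\<close> the elementwise product of the cosets
  \<open>\<mm> + r\<close> and \<open>\<mm>\<^sup>2 + x\<close> modulo \<open>\<mm>\<^sup>2\<close> is the single coset \<open>\<mm>\<^sup>2 + r x\<close>, so the library's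
  \<^const>\<open>rcoset_mult\<close> is the scalar multiplication.  The fields \<open>mult\<close> and \<open>one\<close> of the
  record play no role.\<close>

definition cotangent_space :: "('a, 'b) ring_scheme \<Rightarrow> 'a set \<Rightarrow> ('a set, 'a set) module" where
  "cotangent_space R \<mm> =
     (let J = ideal_pow R \<mm> 2
      in ring.extend ((R Quot J)\<lparr>carrier := {J +>\<^bsub>R\<^esub> x | x. x \<in> \<mm>}\<rparr>)
           \<lparr> smult = rcoset_mult R J \<rparr>)"

definition embedding_dim :: "('a, 'b) ring_scheme \<Rightarrow> 'a set \<Rightarrow> nat" where
  "embedding_dim R \<mm> = vectorspace.dim (R Quot \<mm>) (cotangent_space R \<mm>)"

text \<open>With \<open>d = dim R\<close>, the limit of \<open>d! \<ell>(R / I\<^sup>n) / n\<^sup>d\<close>.\<close>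

definition hs_multiplicity :: "('a, 'b) ring_scheme \<Rightarrow> 'a set \<Rightarrow> real" where
  "hs_multiplicity R I =
     (let d = the_enat (krull_dim R)
      in lim (\<lambda>n :: nat. fact d *
           real (the_enat (module_length R (quot_module R (ideal_pow R I n)))) / real n ^ d))"


section \<open>The constructions are a ring, a module and a vector space\<close>

context cring begin

lemma nzd_closed: "s \<in> nonzerodivisors R \<Longrightarrow> s \<in> carrier R" by (auto simp: nonzerodivisors_def)

lemma nzd_cancel: assumes "s \<in> nonzerodivisors R" "a \<in> carrier R" "b \<in> carrier R" "s \<otimes> a = s \<otimes> b"
  shows "a = b"
proof -
  have s: "s \<in> carrier R" using assms nzd_closed by auto
  have "s \<otimes> (a \<ominus> b) = s \<otimes> a \<ominus> s \<otimes> b" using s assms(2,3) by algebra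
  also have "\<dots> = \<zero>" unfolding assms(4) using s assms(3) by (simp add: r_neg minus_eq)
  finally have "a \<ominus> b = \<zero>" using assms(1-3) by (auto simp: nonzerodivisors_def)
  then show ?thesis using assms(2,3) by simp
qed

lemma nzd_mult: assumes "s \<in> nonzerodivisors R" "t \<in> nonzerodivisors R" shows "s \<otimes> t \<in> nonzerodivisors R"
proof -
  have c: "s \<in> carrier R" "t \<in> carrier R" using assms nzd_closed by blast+
  have "a = \<zero>" if a: "a \<in> carrier R" "s \<otimes> t \<otimes> a = \<zero>" for a
  proof -
    have "s \<otimes> (t \<otimes> a) = \<zero>" using a c m_assoc by metis
    then have "t \<otimes> a = \<zero>" using assms(1) a c m_closed unfolding nonzerodivisors_def by blast
    then show ?thesis using assms(2) a unfolding nonzerodivisors_def by blast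
  qed
  then show ?thesis using c m_closed unfolding nonzerodivisors_def by blast
qed

lemma nzd_one: "\<one> \<in> nonzerodivisors R" by (auto simp: nonzerodivisors_def)

lemma fraction_mem: "a \<in> carrier R \<Longrightarrow> s \<in> nonzerodivisors R \<Longrightarrow> (a,s) \<in> fraction R a s"
  by (auto simp: fraction_def)

lemma fraction_eqI: assumes "a \<in> carrier R" "s \<in> nonzerodivisors R" "b \<in> carrier R" "t \<in> nonzerodivisors R"
  "a \<otimes> t = b \<otimes> s" shows "fraction R a s = fraction R b t"
proof -
  have *: "fraction R a s \<subseteq> fraction R b t" if asm: "a \<in> carrier R" "s \<in> nonzerodivisors R" "b \<in> carrier R" "t \<in> nonzerodivisors R" "a \<otimes> t = b \<otimes> s" for a s b t
  proof (clarsimp simp: fraction_def)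
    fix c u assume c: "c \<in> carrier R" "u \<in> nonzerodivisors R" "a \<otimes> u = c \<otimes> s"
    have k: "s \<in> carrier R" "t \<in> carrier R" "u \<in> carrier R" using asm c nzd_closed by auto
    have "s \<otimes> (b \<otimes> u) = (b \<otimes> s) \<otimes> u" using asm(1,3) c(1) k by (simp add: m_ac)
    also have "\<dots> = (a \<otimes> t) \<otimes> u" using asm by simp
    also have "\<dots> = (a \<otimes> u) \<otimes> t" using asm(1,3) c(1) k by (simp add: m_ac)
    also have "\<dots> = s \<otimes> (c \<otimes> t)" unfolding c(3) using c(1) k by (simp add: m_ac)
    finally show "b \<otimes> u = c \<otimes> t" using nzd_cancel asm c by (meson m_closed nzd_closed)
  qed
  show ?thesis using *[of a s b t] *[of b t a s] assms by auto
qed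

lemma fraction_eqD: assumes "a \<in> carrier R" "s \<in> nonzerodivisors R" "b \<in> carrier R" "t \<in> nonzerodivisors R"
 "fraction R a s = fraction R b t" shows "a \<otimes> t = b \<otimes> s"
  using fraction_mem[of b t] assms by (auto simp: fraction_def)

lemma mult_frac: assumes a: "a \<in> carrier R" "s \<in> nonzerodivisors R" "b \<in> carrier R" "t \<in> nonzerodivisors R"
  shows "fraction R a s \<otimes>\<^bsub>total_frac_ring R\<^esub> fraction R b t = fraction R (a \<otimes> b) (s \<otimes> t)"
proof -
  have "fraction R (a' \<otimes> b') (s' \<otimes> t') = fraction R (a \<otimes> b) (s \<otimes> t)"
    if "(a',s') \<in> fraction R a s" "(b',t') \<in> fraction R b t" for a' s' b' t'
  proof -
    have h: "a' \<in> carrier R" "b' \<in> carrier R" "s' \<in> nonzerodivisors R" "t' \<in> nonzerodivisors R" "a \<otimes> s' = a' \<otimes> s" "b \<otimes> t' = b' \<otimes> t"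
      using that by (auto simp: fraction_def)
    have k: "s \<in> carrier R" "t \<in> carrier R" "s' \<in> carrier R" "t' \<in> carrier R" using assms h nzd_closed by auto
    have "a' \<otimes> b' \<otimes> (s \<otimes> t) = (a' \<otimes> s) \<otimes> (b' \<otimes> t)" using h(1-2) k a(1,3) by (simp add: m_ac)
    also have "\<dots> = (a \<otimes> s') \<otimes> (b \<otimes> t')" using h by simp
    also have "\<dots> = a \<otimes> b \<otimes> (s' \<otimes> t')" using h(1-2) k a(1,3) by (simp add: m_ac)
    finally show ?thesis using a h k by (intro fraction_eqI) (auto intro: nzd_mult)
  qed
  then have "(\<Union>(a', s') \<in> fraction R a s. \<Union>(b', t') \<in> fraction R b t. fraction R (a' \<otimes> b') (s' \<otimes> t'))
      = (\<Union>_ \<in> fraction R a s. \<Union>_ \<in> fraction R b t. fraction R (a \<otimes> b) (s \<otimes> t))"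
    by (intro SUP_cong refl) (auto intro!: SUP_cong)
  also have "\<dots> = fraction R (a \<otimes> b) (s \<otimes> t)"
    using fraction_mem[OF a(1,2)] fraction_mem[OF a(3,4)] by auto
  finally show ?thesis by (simp add: total_frac_ring_def)
qed

lemma add_frac: assumes a: "a \<in> carrier R" "s \<in> nonzerodivisors R" "b \<in> carrier R" "t \<in> nonzerodivisors R"
  shows "fraction R a s \<oplus>\<^bsub>total_frac_ring R\<^esub> fraction R b t = fraction R (a \<otimes> t \<oplus> b \<otimes> s) (s \<otimes> t)"
proof -
  have "fraction R (a' \<otimes> t' \<oplus> b' \<otimes> s') (s' \<otimes> t') = fraction R (a \<otimes> t \<oplus> b \<otimes> s) (s \<otimes> t)"
    if "(a',s') \<in> fraction R a s" "(b',t') \<in> fraction R b t" for a' s' b' t'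
  proof -
    have h: "a' \<in> carrier R" "b' \<in> carrier R" "s' \<in> nonzerodivisors R" "t' \<in> nonzerodivisors R" "a \<otimes> s' = a' \<otimes> s" "b \<otimes> t' = b' \<otimes> t"
      using that by (auto simp: fraction_def)
    have k: "s \<in> carrier R" "t \<in> carrier R" "s' \<in> carrier R" "t' \<in> carrier R" using assms h nzd_closed by auto
    have "(a' \<otimes> t' \<oplus> b' \<otimes> s') \<otimes> (s \<otimes> t) = (a' \<otimes> s) \<otimes> (t' \<otimes> t) \<oplus> (b' \<otimes> t) \<otimes> (s' \<otimes> s)" using h(1-2) k a(1,3) by (simp add: m_ac l_distr r_distr)
    also have "\<dots> = (a \<otimes> s') \<otimes> (t' \<otimes> t) \<oplus> (b \<otimes> t') \<otimes> (s' \<otimes> s)" using h by simp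
    also have "\<dots> = (a \<otimes> t \<oplus> b \<otimes> s) \<otimes> (s' \<otimes> t')" using h(1-2) k a(1,3) by (simp add: m_ac l_distr r_distr)
    finally show ?thesis using a h k by (intro fraction_eqI) (auto intro: nzd_mult)
  qed
  then have "(\<Union>(a', s') \<in> fraction R a s. \<Union>(b', t') \<in> fraction R b t. fraction R (a' \<otimes> t' \<oplus> b' \<otimes> s') (s' \<otimes> t'))
      = (\<Union>_ \<in> fraction R a s. \<Union>_ \<in> fraction R b t. fraction R (a \<otimes> t \<oplus> b \<otimes> s) (s \<otimes> t))"
    by (intro SUP_cong refl) (auto intro!: SUP_cong)
  also have "\<dots> = fraction R (a \<otimes> t \<oplus> b \<otimes> s) (s \<otimes> t)"
    using fraction_mem[OF a(1,2)] fraction_mem[OF a(3,4)] by auto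
  finally show ?thesis by (simp add: total_frac_ring_def)
qed

lemma frac_cases: assumes "x \<in> carrier (total_frac_ring R)"
  obtains a s where "a \<in> carrier R" "s \<in> nonzerodivisors R" "x = fraction R a s"
  using assms by (auto simp: total_frac_ring_def)
lemma frac_in: "a \<in> carrier R \<Longrightarrow> s \<in> nonzerodivisors R \<Longrightarrow> fraction R a s \<in> carrier (total_frac_ring R)"
  by (auto simp: total_frac_ring_def)
lemma frac_one: "\<one>\<^bsub>total_frac_ring R\<^esub> = fraction R \<one> \<one>" by (simp add: total_frac_ring_def)
lemma frac_zero: "\<zero>\<^bsub>total_frac_ring R\<^esub> = fraction R \<zero> \<one>" by (simp add: total_frac_ring_def)

lemmas frac_simps = mult_frac add_frac frac_in frac_one frac_zero nzd_mult nzd_one nzd_closed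

lemma total_frac_ring_cring: "cring (total_frac_ring R)"
proof (intro cringI abelian_groupI comm_monoidI)
  fix x y z assume "x \<in> carrier (total_frac_ring R)" "y \<in> carrier (total_frac_ring R)" "z \<in> carrier (total_frac_ring R)"
  then obtain a b c s t u where h: "a \<in> carrier R" "b \<in> carrier R" "c \<in> carrier R" "s \<in> nonzerodivisors R" "t \<in> nonzerodivisors R" "u \<in> nonzerodivisors R"
    "x = fraction R a s" "y = fraction R b t" "z = fraction R c u" by (metis frac_cases)
  have k: "s \<in> carrier R" "t \<in> carrier R" "u \<in> carrier R" using h nzd_closed by auto
  show "x \<oplus>\<^bsub>total_frac_ring R\<^esub> y \<oplus>\<^bsub>total_frac_ring R\<^esub> z = x \<oplus>\<^bsub>total_frac_ring R\<^esub> (y \<oplus>\<^bsub>total_frac_ring R\<^esub> z)"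
    using h k apply (simp add: frac_simps) apply (rule fraction_eqI) apply (simp_all add: frac_simps)
    by (simp add: k l_distr r_distr m_ac a_ac)
  show "(x \<oplus>\<^bsub>total_frac_ring R\<^esub> y) \<otimes>\<^bsub>total_frac_ring R\<^esub> z = x \<otimes>\<^bsub>total_frac_ring R\<^esub> z \<oplus>\<^bsub>total_frac_ring R\<^esub> y \<otimes>\<^bsub>total_frac_ring R\<^esub> z"
    using h k apply (simp add: frac_simps) apply (rule fraction_eqI) apply (simp_all add: frac_simps)
    by (simp add: k l_distr r_distr m_ac)
  show "x \<otimes>\<^bsub>total_frac_ring R\<^esub> y \<otimes>\<^bsub>total_frac_ring R\<^esub> z = x \<otimes>\<^bsub>total_frac_ring R\<^esub> (y \<otimes>\<^bsub>total_frac_ring R\<^esub> z)"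
    using h k by (simp add: frac_simps m_assoc)
next
  fix x y assume "x \<in> carrier (total_frac_ring R)" "y \<in> carrier (total_frac_ring R)"
  then obtain a b s t where h: "a \<in> carrier R" "b \<in> carrier R" "s \<in> nonzerodivisors R" "t \<in> nonzerodivisors R" 
    "x = fraction R a s" "y = fraction R b t"  by (metis frac_cases)
  have k: "s \<in> carrier R" "t \<in> carrier R" using h nzd_closed by auto
  show "x \<oplus>\<^bsub>total_frac_ring R\<^esub> y \<in> carrier (total_frac_ring R)" using h k by (simp add: frac_simps)
  show "x \<otimes>\<^bsub>total_frac_ring R\<^esub> y \<in> carrier (total_frac_ring R)" using h k by (simp add: frac_simps)
  show "x \<oplus>\<^bsub>total_frac_ring R\<^esub> y = y \<oplus>\<^bsub>total_frac_ring R\<^esub> x" using h k by (simp add: frac_simps a_comm m_comm)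
  show "x \<otimes>\<^bsub>total_frac_ring R\<^esub> y = y \<otimes>\<^bsub>total_frac_ring R\<^esub> x" using h k by (simp add: frac_simps m_comm)
next
  fix x assume "x \<in> carrier (total_frac_ring R)"
  then obtain a s where h: "a \<in> carrier R" "s \<in> nonzerodivisors R" "x = fraction R a s" by (metis frac_cases)
  have k: "s \<in> carrier R" using h nzd_closed by auto
  show "\<zero>\<^bsub>total_frac_ring R\<^esub> \<oplus>\<^bsub>total_frac_ring R\<^esub> x = x" using h k by (simp add: frac_simps)
  show "\<one>\<^bsub>total_frac_ring R\<^esub> \<otimes>\<^bsub>total_frac_ring R\<^esub> x = x" using h k by (simp add: frac_simps)
  have "fraction R (\<ominus> a) s \<oplus>\<^bsub>total_frac_ring R\<^esub> x = \<zero>\<^bsub>total_frac_ring R\<^esub>"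
    using h k apply (simp add: frac_simps) apply (rule fraction_eqI) apply (simp_all add: frac_simps l_minus l_neg) done
  then show "\<exists>y\<in>carrier (total_frac_ring R). y \<oplus>\<^bsub>total_frac_ring R\<^esub> x = \<zero>\<^bsub>total_frac_ring R\<^esub>"
    using h frac_in by blast
qed (simp_all add: frac_simps)

lemma frac_embed_hom: "frac_embed R \<in> ring_hom R (total_frac_ring R)" "inj_on (frac_embed R) (carrier R)"
proof -
  show "frac_embed R \<in> ring_hom R (total_frac_ring R)"
    unfolding frac_embed_def by (rule ring_hom_memI) (simp_all add: frac_simps)
  show "inj_on (frac_embed R) (carrier R)"
  proof (rule inj_onI)
    fix a b assume ab: "a \<in> carrier R" "b \<in> carrier R" "frac_embed R a = frac_embed R b"
    then have "a \<otimes> \<one> = b \<otimes> \<one>" unfolding frac_embed_def by (intro fraction_eqD nzd_one)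
    then show "a = b" using ab(1,2) by simp
  qed
qed

lemma nzd_unit: assumes "s \<in> nonzerodivisors R" shows "frac_embed R s \<in> Units (total_frac_ring R)"
    "a \<in> carrier R \<Longrightarrow> fraction R a s \<otimes>\<^bsub>total_frac_ring R\<^esub> frac_embed R s = frac_embed R a"
proof -
  interpret Q: cring "total_frac_ring R" by (rule total_frac_ring_cring)
  have s: "s \<in> carrier R" using assms nzd_closed by auto
  have "fraction R \<one> s \<otimes>\<^bsub>total_frac_ring R\<^esub> frac_embed R s = \<one>\<^bsub>total_frac_ring R\<^esub>"
    using assms s apply (simp add: frac_embed_def frac_simps) by (rule fraction_eqI) (simp_all add: nzd_one nzd_closed)
  then show "frac_embed R s \<in> Units (total_frac_ring R)"
    using assms s by (metis Q.unit_factor Q.m_comm Q.Units_one_closed frac_embed_def frac_in nzd_one one_closed)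
  show "a \<in> carrier R \<Longrightarrow> fraction R a s \<otimes>\<^bsub>total_frac_ring R\<^esub> frac_embed R s = frac_embed R a"
    using assms s apply (simp add: frac_embed_def frac_simps) by (rule fraction_eqI) (simp_all add: nzd_one nzd_closed)
qed

lemma ideals_pow: "ideal I R \<Longrightarrow> ideal (ideal_pow R I n) R"
  by (induct n) (auto simp: ideals_set_def oneideal ideal_prod_is_ideal nat_pow_def)

lemma quot_module_module: assumes "ideal I R" shows "module R (quot_module R I)"
proof -
  interpret I: ideal I R by fact
  interpret Q: cring "R Quot I" by (rule I.quotient_is_cring[OF is_cring])
  interpret h: ring_hom_cring R "R Quot I" "(+>) I"
    by (rule I.rcos_ring_hom_cring) (rule is_cring)
  define V where "V = quot_module R I"
  have Vc: "carrier V = carrier (R Quot I)" and Va: "\<And>u v. u \<oplus>\<^bsub>V\<^esub> v = u \<oplus>\<^bsub>R Quot I\<^esub> v"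
    and Vz: "\<zero>\<^bsub>V\<^esub> = \<zero>\<^bsub>R Quot I\<^esub>" and Vs: "\<And>r v. r \<odot>\<^bsub>V\<^esub> v = (I +> r) \<otimes>\<^bsub>R Quot I\<^esub> v"
    unfolding V_def quot_module_def by (simp_all add: ring.defs)
  have "abelian_group V"
  proof (rule abelian_groupI)
    show "\<exists>y\<in>carrier V. y \<oplus>\<^bsub>V\<^esub> x = \<zero>\<^bsub>V\<^esub>" if "x \<in> carrier V" for x
      using that Q.l_neg Q.a_inv_closed unfolding Vc Va Vz by blast
  qed (simp_all add: Vc Va Vz Q.a_ac)
  then have "module R V"
    by (intro moduleI is_cring) (simp_all add: Vc Va Vs Q.l_distr Q.r_distr Q.m_assoc)
  then show ?thesis by (simp add: V_def)
qed

lemma cotangent_vectorspace: assumes "maximalideal \<mm> R" shows "vectorspace (R Quot \<mm>) (cotangent_space R \<mm>)"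
proof -
  define J where "J = ideal_pow R \<mm> 2"
  interpret M: maximalideal \<mm> R by fact
  interpret F: field "R Quot \<mm>" by (rule M.quotient_is_field[OF is_cring])
  interpret J: ideal J R unfolding J_def by (rule ideals_pow) (rule M.ideal_axioms)
  interpret Q: cring "R Quot J" by (rule J.quotient_is_cring[OF is_cring])
  have J2: "J = \<mm> \<cdot> \<mm>"
  proof -
    have "(carrier R \<cdot> \<mm>) = \<mm>" using ideal_prod_one[OF M.ideal_axioms] ideal_prod_commute M.ideal_axioms oneideal by metis
    then show ?thesis unfolding J_def by (simp add: ideals_set_def numeral_2_eq_2 nat_pow_def)
  qed
  have JM: "a \<in> \<mm> \<Longrightarrow> b \<in> \<mm> \<Longrightarrow> a \<otimes> b \<in> J" for a b unfolding J2 by (rule ideal_prod.prod)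
  have sub: "J \<subseteq> \<mm>" unfolding J2 using ideal_prod_inter[OF M.ideal_axioms M.ideal_axioms] by simp
  have sm: "rcoset_mult R J (\<mm> +> r) (J +> x) = J +> (r \<otimes> x)" if r: "r \<in> carrier R" and x: "x \<in> \<mm>" for r x
  proof -
    have xc: "x \<in> carrier R" using x M.a_Hcarr by auto
    have "J +> (a \<otimes> b) = J +> (r \<otimes> x)" if ab: "a \<in> \<mm> +> r" "b \<in> J +> x" for a b
    proof -
      obtain u v where uv: "u \<in> \<mm>" "v \<in> J" "a = u \<oplus> r" "b = v \<oplus> x" using ab by (auto simp: a_r_coset_def r_coset_def)
      have vm: "v \<in> \<mm>" using sub uv by auto
      have uc: "u \<in> carrier R" "v \<in> carrier R" using uv vm M.a_Hcarr by auto
      have "a \<otimes> b = (u \<otimes> v \<oplus> u \<otimes> x \<oplus> r \<otimes> v) \<oplus> r \<otimes> x" using uv uc r xc by algebra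
      moreover have "u \<otimes> v \<oplus> u \<otimes> x \<oplus> r \<otimes> v \<in> J"
        using uv vm x r JM J.I_l_closed by (intro J.a_closed) auto
      ultimately have "a \<otimes> b \<in> J +> (r \<otimes> x)" by (auto simp: a_r_coset_def r_coset_def)
      then show ?thesis using abelian_subgroup.a_repr_independence'[OF J.abelian_subgroup_axioms] r xc by (metis m_closed)
    qed
    moreover have "r \<in> \<mm> +> r" "x \<in> J +> x" using M.a_rcos_self r J.a_rcos_self xc by auto
    ultimately show ?thesis unfolding rcoset_mult_def by blast
  qed
  have cq: "carrier (R Quot \<mm>) = {\<mm> +> r | r. r \<in> carrier R}" by (auto simp: FactRing_def A_RCOSETS_def')
  have mc: "x \<in> \<mm> \<Longrightarrow> x \<in> carrier R" for x using M.a_Hcarr by auto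
  have add: "x \<in> carrier R \<Longrightarrow> y \<in> carrier R \<Longrightarrow> (J +> x) \<oplus>\<^bsub>R Quot J\<^esub> (J +> y) = J +> (x \<oplus> y)" for x y
    by (simp add: FactRing_def J.a_rcos_sum)
  have addm: "x \<in> carrier R \<Longrightarrow> y \<in> carrier R \<Longrightarrow> (\<mm> +> x) \<oplus>\<^bsub>R Quot \<mm>\<^esub> (\<mm> +> y) = \<mm> +> (x \<oplus> y)" for x y
    by (simp add: FactRing_def M.a_rcos_sum)
  have mulm: "x \<in> carrier R \<Longrightarrow> y \<in> carrier R \<Longrightarrow> (\<mm> +> x) \<otimes>\<^bsub>R Quot \<mm>\<^esub> (\<mm> +> y) = \<mm> +> (x \<otimes> y)" for x y
    by (simp add: FactRing_def M.rcoset_mult_add)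
  have onem: "\<one>\<^bsub>R Quot \<mm>\<^esub> = \<mm> +> \<one>" by (simp add: FactRing_def)
  have zero: "\<zero>\<^bsub>R Quot J\<^esub> = J +> \<zero>" by (simp add: FactRing_def J.a_rcos_const J.additive_subgroup_axioms additive_subgroup.zero_closed)
  have m0: "\<zero> \<in> \<mm>" by (simp add: M.zero_closed)
  define V where "V = cotangent_space R \<mm>"
  have Vc: "carrier V = {J +> x | x. x \<in> \<mm>}" and Va: "\<And>u v. u \<oplus>\<^bsub>V\<^esub> v = u \<oplus>\<^bsub>R Quot J\<^esub> v"
    and Vz: "\<zero>\<^bsub>V\<^esub> = J +> \<zero>" and Vs: "\<And>u v. u \<odot>\<^bsub>V\<^esub> v = rcoset_mult R J u v"
    unfolding V_def cotangent_space_def Let_def J_def[symmetric] by (simp_all add: ring.defs zero)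
  have Vin: "x \<in> \<mm> \<Longrightarrow> J +> x \<in> carrier V" for x unfolding Vc by blast
  have "abelian_group V"
  proof (rule abelian_groupI)
    fix x y z assume "x \<in> carrier V" "y \<in> carrier V" "z \<in> carrier V"
    then obtain a b c where h: "a \<in> \<mm>" "b \<in> \<mm>" "c \<in> \<mm>" "x = J +> a" "y = J +> b" "z = J +> c"
      unfolding Vc by blast
    show "x \<oplus>\<^bsub>V\<^esub> y \<oplus>\<^bsub>V\<^esub> z = x \<oplus>\<^bsub>V\<^esub> (y \<oplus>\<^bsub>V\<^esub> z)" using h(1-3) unfolding h(4-6) by (simp add: Va add mc a_assoc)
  next
    fix x y assume "x \<in> carrier V" "y \<in> carrier V"
    then obtain a b where h: "a \<in> \<mm>" "b \<in> \<mm>" "x = J +> a" "y = J +> b" unfolding Vc by blast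
    show "x \<oplus>\<^bsub>V\<^esub> y \<in> carrier V" using h(1-2) unfolding h(3-4) by (simp add: Va add mc Vin M.a_closed)
    show "x \<oplus>\<^bsub>V\<^esub> y = y \<oplus>\<^bsub>V\<^esub> x" using h(1-2) unfolding h(3-4) by (simp add: Va add mc a_comm)
  next
    fix x assume "x \<in> carrier V"
    then obtain a where h: "a \<in> \<mm>" "x = J +> a" unfolding Vc by blast
    show "\<zero>\<^bsub>V\<^esub> \<oplus>\<^bsub>V\<^esub> x = x" using h(1) unfolding h(2) by (simp add: Va Vz add mc)
    have "(J +> (\<ominus> a)) \<oplus>\<^bsub>V\<^esub> x = \<zero>\<^bsub>V\<^esub>" using h(1) unfolding h(2) by (simp add: Va Vz add mc l_neg)
    moreover have "J +> (\<ominus> a) \<in> carrier V" using h(1) by (intro Vin) simp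
    ultimately show "\<exists>y\<in>carrier V. y \<oplus>\<^bsub>V\<^esub> x = \<zero>\<^bsub>V\<^esub>" by blast
  qed (simp add: Vz Vin m0)
  have "module (R Quot \<mm>) V"
  proof (rule moduleI)
    show "cring (R Quot \<mm>)" by (rule F.is_cring)
    show "abelian_group V" by fact
  next
    fix A B x y assume "A \<in> carrier (R Quot \<mm>)" "B \<in> carrier (R Quot \<mm>)" "x \<in> carrier V" "y \<in> carrier V"
    then obtain r q a b where h: "r \<in> carrier R" "q \<in> carrier R" "a \<in> \<mm>" "b \<in> \<mm>"
        "A = \<mm> +> r" "B = \<mm> +> q" "x = J +> a" "y = J +> b"
      unfolding Vc cq by blast
    show "(A \<oplus>\<^bsub>R Quot \<mm>\<^esub> B) \<odot>\<^bsub>V\<^esub> x = A \<odot>\<^bsub>V\<^esub> x \<oplus>\<^bsub>V\<^esub> B \<odot>\<^bsub>V\<^esub> x"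
      using h(1-4) unfolding h(5-8) by (simp add: Va Vs addm sm add mc l_distr)
    show "A \<odot>\<^bsub>V\<^esub> (x \<oplus>\<^bsub>V\<^esub> y) = A \<odot>\<^bsub>V\<^esub> x \<oplus>\<^bsub>V\<^esub> A \<odot>\<^bsub>V\<^esub> y"
      using h(1-4) unfolding h(5-8) by (simp add: Va Vs sm add mc r_distr M.a_closed)
    show "(A \<otimes>\<^bsub>R Quot \<mm>\<^esub> B) \<odot>\<^bsub>V\<^esub> x = A \<odot>\<^bsub>V\<^esub> (B \<odot>\<^bsub>V\<^esub> x)"
      using h(1-4) unfolding h(5-8) by (simp add: Vs mulm sm mc m_assoc M.I_l_closed)
  next
    fix A x assume "A \<in> carrier (R Quot \<mm>)" "x \<in> carrier V"
    then obtain r a where h: "r \<in> carrier R" "a \<in> \<mm>" "A = \<mm> +> r" "x = J +> a" unfolding Vc cq by blast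
    show "A \<odot>\<^bsub>V\<^esub> x \<in> carrier V" using h(1-2) unfolding h(3-4) by (simp add: Vs sm Vin M.I_l_closed)
  next
    fix x assume "x \<in> carrier V"
    then obtain a where h: "a \<in> \<mm>" "x = J +> a" unfolding Vc by blast
    show "\<one>\<^bsub>R Quot \<mm>\<^esub> \<odot>\<^bsub>V\<^esub> x = x" using h(1) unfolding h(2) by (simp add: Vs onem sm mc)
  qed
  then show ?thesis using F.field_axioms by (simp add: vectorspace_def V_def)
qed

end

end

(* Write l for the length of R/c. The conductor is the set of r such that x divides r b whenever b/x
   is almost integral over R (in the Noetherian case: integral). Since the residue field is infinite,
   an ideal (x, b) with x a nonzerodivisor has a principal reduction x - r b; by induction on
   generators there is a nonzerodivisor x in c such that a/x is integral for every a in c. As c is an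
   ideal of the integral closure, this gives c c = x c. Multiplication by x preserves lengths, so
   l(R/c^(n+1)) = l + n l(R/xR) and e(c) = l(R/xR) = l + l(c/xR).

   The module c/xR is annihilated by c and generated by mu(c) - 1 elements, so its length is at most
   (mu(c) - 1) l. Descending from m to c along a composition series, the number of generators is at most
   nu for the first ideal below m and grows by at most nu - 1 in every further step; hence
   mu(c) <= 1 + (l - 1)(nu - 1) for l >= 2. This yields e(c) <= l + (l - 1)(nu - 1) l, which is strictly
   below the asserted bound because c = xR would put 1 into c, so that e(c) > l, which forces nu >= 2. For l = 1 one has c = m and
   e(c) = l(m/xm) = l(m/m^2) = nu. *)

theory Submission
  imports Defs
begin

section \<open>Lengths of ideal quotients\<close>

text \<open>Every module in the argument has the form \<open>J / I\<close> for ideals of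
  \<open>R\<close>, so length is measured by chains of ideals, with values in \<open>enat\<close>;
  comparison and additivity then hold before any finiteness is known.

  Almost integrality is a condition on elements of \<open>R\<close> alone (a common denominator for
  all powers). Sums, products and transitivity follow by direct computation, and the Noetherian
  condition enters only when a monic equation has to be recovered.

  The equality clause rests on the first step below \<open>\<mm>\<close>. If all l - 1 steps from
  \<open>\<mm>\<close> to c raised the number of generators by nu - 1, the outcome would be mu(c) -
  1 \<le> l (nu - 1), which yields exactly the asserted bound and no strictness. The first step,
  however, does not raise the number at all, because the square of \<open>\<mm>\<close> is generated
  over \<open>\<mm>\<close> L by a single square. These saved nu - 1 generators make the bound
  strict for l \<ge> 2.\<close>

inductive ideal_chain :: "('a, 'b) ring_scheme \<Rightarrow> 'a set \<Rightarrow> 'a set \<Rightarrow> nat \<Rightarrow> bool" for R I where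
  base: "ideal I R \<Longrightarrow> ideal J R \<Longrightarrow> I \<subseteq> J \<Longrightarrow> ideal_chain R I J 0"
| step: "ideal_chain R I J n \<Longrightarrow> ideal K R \<Longrightarrow> J \<subset> K \<Longrightarrow> ideal_chain R I K (Suc n)"

definition ideal_length :: "('a, 'b) ring_scheme \<Rightarrow> 'a set \<Rightarrow> 'a set \<Rightarrow> enat" where
  "ideal_length R I J = Sup {enat n | n. ideal_chain R I J n}"

lemma ideal_chain_ideals:
  assumes "ideal_chain R I J n"
  shows "ideal I R" "ideal J R" "I \<subseteq> J"
  using assms by (induction) auto

text \<open>\<open>base\<close> asks only for \<open>I \<subseteq> J\<close>, so a chain may start
  strictly above \<open>I\<close> but ends in \<open>J\<close> itself. Enlarging the end point
  changes only the last inclusion.\<close>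

lemma ideal_chain_mono:
  assumes "ideal_chain R I J n" "ideal K R" "J \<subseteq> K"
  shows "ideal_chain R I K n"
  using assms
proof (cases rule: ideal_chain.cases)
  case base
  then show ?thesis using assms by (auto intro: ideal_chain.base)
next
  case (step J' n')
  then have "J' \<subset> K" using assms by blast
  then show ?thesis using step assms by (metis ideal_chain.step)
qed

lemma ideal_chain_trans:
  assumes "ideal_chain R J K m" "ideal_chain R I J n"
  shows "ideal_chain R I K (n + m)"
  using assms
proof (induction)
  case (base J')
  then show ?case by (simp add: ideal_chain_mono)
next
  case (step J' n' K')
  then show ?case by (auto intro: ideal_chain.step)
qed

lemma ideal_chain_less:
  assumes "ideal_chain R I J n" "m \<le> n"
  shows "ideal_chain R I J m"
proof -
  have *: "ideal_chain R I J k" if "ideal_chain R I J (Suc k)" for k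
    using that by (cases rule: ideal_chain.cases) (auto intro: ideal_chain_mono)
  show ?thesis
    using assms(2,1) by (induction rule: inc_induct) (auto intro: *)
qed

text \<open>The possible numbers of steps are closed downward, so a supremum of at least
  \<open>n\<close>, even an infinite one, comes with an actual chain of \<open>n\<close>
  steps.\<close>

lemma ideal_length_ge_iff:
  assumes "ideal I R" "ideal J R" "I \<subseteq> J"
  shows "enat n \<le> ideal_length R I J \<longleftrightarrow> ideal_chain R I J n"
proof
  assume "ideal_chain R I J n"
  then show "enat n \<le> ideal_length R I J"
    unfolding ideal_length_def by (auto intro: Sup_upper)
next
  assume n: "enat n \<le> ideal_length R I J"
  show "ideal_chain R I J n"
  proof (cases n)
    case 0
    then show ?thesis using assms by (auto intro: ideal_chain.base)
  next
    case (Suc k)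
    then have "enat k < ideal_length R I J"
      using n by (meson Suc_le_eq enat_ord_simps(2) order_less_le_trans lessI)
    then obtain m where "ideal_chain R I J m" "k < m"
      unfolding ideal_length_def less_Sup_iff by auto
    then show ?thesis using Suc ideal_chain_less by fastforce
  qed
qed

lemma enat_le_of_all_nat:
  fixes a b :: enat
  assumes "\<And>n. enat n \<le> a \<Longrightarrow> enat n \<le> b"
  shows "a \<le> b"
proof (cases a)
  case (enat n)
  then show ?thesis using assms by simp
next
  case infinity
  then have "enat n \<le> b" for n using assms by simp
  then show ?thesis
    by (metis Suc_ile_eq enat_ord_code(3) less_irrefl not_infinity_eq)
qed

lemma ideal_length_pos:
  assumes "ideal I R" "ideal J R" "I \<subset> J"
  shows "1 \<le> ideal_length R I J"
proof -
  have "ideal_chain R I J (Suc 0)" using assms by (meson base step order_refl)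
  then have "enat 1 \<le> ideal_length R I J" using ideal_length_ge_iff[of I R J 1] assms by auto
  then show ?thesis by (simp add: one_enat_def)
qed

lemma ideal_length_eq_0:
  assumes "ideal I R" "ideal J R" "I \<subseteq> J" "ideal_length R I J = 0"
  shows "I = J"
  using assms ideal_length_pos[of I R J] by fastforce

text \<open>A map \<open>f\<close> on ideals that preserves strict inclusions transports chains step
  by step. It is applied to preimages under multiplication by an element, to multiples
  \<open>x <# N\<close>, and to the identity. The conditions concern only ideals between
  \<open>I\<close> and \<open>J\<close> because preimages are strict only there.\<close>

lemma ideal_length_mono:
  assumes strict: "\<And>N N'. ideal N R \<Longrightarrow> ideal N' R \<Longrightarrow> I \<subseteq> N \<Longrightarrow> N \<subset> N' \<Longrightarrow> N' \<subseteq> J \<Longrightarrow> f N \<subset> f N'"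
    and ideals: "\<And>N. ideal N R \<Longrightarrow> I \<subseteq> N \<Longrightarrow> N \<subseteq> J \<Longrightarrow> ideal (f N) R"
    and I: "ideal I R" "ideal J R" "I \<subseteq> J" and I': "ideal I' R" "ideal J' R" "I' \<subseteq> f I" "f J \<subseteq> J'"
  shows "ideal_length R I J \<le> ideal_length R I' J'"
proof (rule enat_le_of_all_nat)
  have mono: "f N \<subseteq> f N'" if "ideal N R" "ideal N' R" "I \<subseteq> N" "N \<subseteq> N'" "N' \<subseteq> J" for N N'
    using strict[of N N'] that by (cases "N = N'") auto
  have IJ': "I' \<subseteq> J'" using mono[of I J] I I' by auto
  fix n assume "enat n \<le> ideal_length R I J"
  then have "ideal_chain R I J n" using I ideal_length_ge_iff by blast
  moreover have "ideal_chain R I' (f K) n" if "ideal_chain R I K n" "K \<subseteq> J" for K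
    using that
  proof (induction)
    case (base K)
    then have "f I \<subseteq> f K" "ideal (f K) R" using mono[of I K] ideals[of K] by auto
    then show ?case using I' by (blast intro: ideal_chain.base)
  next
    case (step K n L)
    note c = ideal_chain_ideals[OF step(1)]
    have "f K \<subset> f L" by (rule strict) (use c step in auto)
    moreover have "ideal (f L) R" by (rule ideals) (use c step in auto)
    moreover have "ideal_chain R I' (f K) n" using step by auto
    ultimately show ?case by (metis ideal_chain.step)
  qed
  ultimately have "ideal_chain R I' J' n" using I' by (blast intro: ideal_chain_mono)
  then show "enat n \<le> ideal_length R I' J'" using I' IJ' ideal_length_ge_iff by blast
qed

context cring begin

lemma set_add_mem_iff: "z \<in> I <+>\<^bsub>R\<^esub> J \<longleftrightarrow> (\<exists>i\<in>I. \<exists>j\<in>J. z = i \<oplus> j)"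
  by (auto simp: set_add_def')

lemma set_add_upper:
  assumes "ideal I R" "ideal J R"
  shows "I \<subseteq> I <+>\<^bsub>R\<^esub> J" "J \<subseteq> I <+>\<^bsub>R\<^esub> J"
proof -
  interpret I: ideal I R + J: ideal J R by fact+
  show "I \<subseteq> I <+>\<^bsub>R\<^esub> J" unfolding set_add_mem_iff subset_iff by (metis I.a_Hcarr J.zero_closed r_zero)
  show "J \<subseteq> I <+>\<^bsub>R\<^esub> J" unfolding set_add_mem_iff subset_iff by (metis J.a_Hcarr I.zero_closed l_zero)
qed

lemma set_add_least:
  assumes "ideal K R" "I \<subseteq> K" "J \<subseteq> K"
  shows "I <+>\<^bsub>R\<^esub> J \<subseteq> K"
proof -
  interpret K: ideal K R by fact
  show ?thesis using assms by (auto simp: set_add_mem_iff intro!: K.a_closed)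
qed

text \<open>A strict step \<open>L \<subset> K\<close> enlarges \<open>L \<inter> J\<close> or
  \<open>L + J\<close>; it is charged to one of the two, which gives a chain inside \<open>J\<close>
  and a chain above \<open>J\<close>.\<close>

lemma ideal_chain_split:
  assumes "ideal_chain R I L n" "ideal J R" "I \<subseteq> J"
  shows "\<exists>p q. n \<le> p + q \<and> ideal_chain R I (L \<inter> J) p \<and> ideal_chain R J (L <+>\<^bsub>R\<^esub> J) q"
  using assms
proof (induction)
  case (base L)
  then have "ideal_chain R I (L \<inter> J) 0" "ideal_chain R J (L <+>\<^bsub>R\<^esub> J) 0"
    using base set_add_upper[OF base(2,4)] i_intersect[OF base(2,4)] add_ideals[OF base(2,4)]
    by (simp_all add: ideal_chain.base)
  then show ?case by blast
next
  case (step L n K)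
  then obtain p q where pq: "n \<le> p + q" "ideal_chain R I (L \<inter> J) p" "ideal_chain R J (L <+>\<^bsub>R\<^esub> J) q"
    by blast
  have L: "ideal L R" using ideal_chain_ideals step by blast
  interpret K: ideal K R by fact
  interpret J: ideal J R by fact
  interpret L: ideal L R by fact
  have s: "L \<inter> J \<subseteq> K \<inter> J" "L <+>\<^bsub>R\<^esub> J \<subseteq> K <+>\<^bsub>R\<^esub> J"
    using step(3) unfolding set_add_mem_iff subset_iff by blast+
  note id = i_intersect[OF step(2,5)] add_ideals[OF step(2,5)]
  have "L \<inter> J \<noteq> K \<inter> J \<or> L <+>\<^bsub>R\<^esub> J \<noteq> K <+>\<^bsub>R\<^esub> J"
  proof (rule ccontr)
    assume "\<not> ?thesis"
    then have e: "L \<inter> J = K \<inter> J" "L <+>\<^bsub>R\<^esub> J = K <+>\<^bsub>R\<^esub> J" by auto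
    \<comment> \<open>The modular law: in \<open>k = a + b\<close> with \<open>a \<in> L\<close> and
      \<open>b \<in> J\<close>, the difference \<open>b = k - a\<close> lies in
      \<open>K \<inter> J = L \<inter> J\<close>.\<close>
    have "K \<subseteq> L"
    proof
      fix k assume k: "k \<in> K"
      then have "k \<in> L <+>\<^bsub>R\<^esub> J" using e set_add_upper[OF step(2,5)] by auto
      then obtain a b where ab: "a \<in> L" "b \<in> J" "k = a \<oplus> b" by (auto simp: set_add_mem_iff)
      have aK: "a \<in> K" using ab step(3) by auto
      have "b = k \<ominus> a" using ab L.a_Hcarr J.a_Hcarr k by algebra
      then have "b \<in> K" using k aK by (simp add: K.a_closed minus_eq)
      then have "b \<in> L" using e ab by blast
      then show "k \<in> L" using ab by auto
    qed
    then show False using step(3) by auto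
  qed
  then show ?case
  proof
    assume "L \<inter> J \<noteq> K \<inter> J"
    then have "ideal_chain R I (K \<inter> J) (Suc p)" "ideal_chain R J (K <+>\<^bsub>R\<^esub> J) q"
      using s pq id by (auto intro: ideal_chain.step ideal_chain_mono)
    then show ?thesis using pq(1) by (intro exI[of _ "Suc p"] exI[of _ q]) auto
  next
    assume "L <+>\<^bsub>R\<^esub> J \<noteq> K <+>\<^bsub>R\<^esub> J"
    then have "ideal_chain R I (K \<inter> J) p" "ideal_chain R J (K <+>\<^bsub>R\<^esub> J) (Suc q)"
      using s pq id by (auto intro: ideal_chain.step ideal_chain_mono)
    then show ?thesis using pq(1) by (intro exI[of _ p] exI[of _ "Suc q"]) auto
  qed
qed

text \<open>Splitting a chain at \<open>J\<close> gives one inequality, concatenating two chains the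
  other. This takes the place of the Jordan-Hoelder theorem and covers infinite lengths.\<close>

lemma ideal_length_add:
  assumes I: "ideal I R" "ideal J R" "ideal K R" "I \<subseteq> J" "J \<subseteq> K"
  shows "ideal_length R I K = ideal_length R I J + ideal_length R J K"
proof (rule antisym)
  have IK: "I \<subseteq> K" using I by auto
  show "ideal_length R I K \<le> ideal_length R I J + ideal_length R J K"
  proof (rule enat_le_of_all_nat)
    fix n assume "enat n \<le> ideal_length R I K"
    then have "ideal_chain R I K n" using I IK ideal_length_ge_iff by blast
    from ideal_chain_split[OF this I(2,4)] obtain p q where
      pq: "n \<le> p + q" "ideal_chain R I (K \<inter> J) p" "ideal_chain R J (K <+>\<^bsub>R\<^esub> J) q" by blast
    have "K \<inter> J = J" "K <+>\<^bsub>R\<^esub> J = K" using I set_add_upper[of K J] set_add_least[of K K J] by auto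
    then have "enat p \<le> ideal_length R I J" "enat q \<le> ideal_length R J K"
      using pq I ideal_length_ge_iff by metis+
    then show "enat n \<le> ideal_length R I J + ideal_length R J K"
      using pq(1) by (metis add_mono enat_ord_simps(1) order_trans plus_enat_simps(1))
  qed
  show "ideal_length R I J + ideal_length R J K \<le> ideal_length R I K"
  proof (rule enat_le_of_all_nat)
    fix n assume n: "enat n \<le> ideal_length R I J + ideal_length R J K"
    \<comment> \<open>An infinite summand supplies all \<open>n\<close> steps by itself.\<close>
    have "\<exists>p q. n \<le> p + q \<and> enat p \<le> ideal_length R I J \<and> enat q \<le> ideal_length R J K"
    proof -
      have ?thesis if "ideal_length R I J = enat a" "ideal_length R J K = enat b" for a b
        using n that by auto
      moreover have ?thesis if "ideal_length R J K = \<infinity>"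
        using that by (intro exI[of _ 0] exI[of _ n]) (auto simp: zero_enat_def[symmetric])
      moreover have ?thesis if "ideal_length R I J = \<infinity>"
        using that by (intro exI[of _ n] exI[of _ 0]) (auto simp: zero_enat_def[symmetric])
      ultimately show ?thesis by (meson not_infinity_eq)
    qed
    then obtain p q where pq: "n \<le> p + q" "ideal_chain R I J p" "ideal_chain R J K q"
      using I ideal_length_ge_iff by metis
    then show "enat n \<le> ideal_length R I K"
      using ideal_length_ge_iff[OF I(1,3) IK] ideal_chain_trans ideal_chain_less by blast
  qed
qed

lemma ideal_length_self: "ideal I R \<Longrightarrow> ideal_length R I I = 0"
proof -
  assume I: "ideal I R"
  have "ideal_length R I I \<le> 0"
  proof (rule enat_le_of_all_nat)
    fix n assume "enat n \<le> ideal_length R I I"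
    then have c: "ideal_chain R I I n" using I ideal_length_ge_iff by blast
    have "n = 0" using c by (cases rule: ideal_chain.cases) (auto dest: ideal_chain_ideals)
    then show "enat n \<le> 0" by (simp add: zero_enat_def)
  qed
  then show ?thesis by simp
qed

section \<open>Lengths under multiplication by an element\<close>

lemma cgenideal_mem: "z \<in> PIdl x \<longleftrightarrow> (\<exists>r\<in>carrier R. z = r \<otimes> x)"
  by (auto simp: cgenideal_def)

text \<open>If \<open>J = I + A z\<close> and \<open>K z \<subseteq> I\<close>, then \<open>a \<mapsto> a z\<close> maps \<open>A / K\<close> onto \<open>J / I\<close>.\<close>

lemma ideal_length_colon:
  assumes id: "ideal I R" "ideal J R" "ideal A R" "ideal K R" "K \<subseteq> A" "I \<subseteq> J"
    and z: "z \<in> carrier R" and J: "\<And>y. y \<in> J \<Longrightarrow> \<exists>i\<in>I. \<exists>a\<in>A. y = i \<oplus> a \<otimes> z"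
    and K: "\<And>k. k \<in> K \<Longrightarrow> k \<otimes> z \<in> I"
  shows "ideal_length R I J \<le> ideal_length R K A"
proof (rule ideal_length_mono[where f = "\<lambda>N. {a \<in> A. a \<otimes> z \<in> N}"])
  interpret I: ideal I R by fact
  interpret A: ideal A R by fact
  fix N assume N: "ideal N R" "I \<subseteq> N" "N \<subseteq> J"
  interpret N: ideal N R by fact
  show "ideal {a \<in> A. a \<otimes> z \<in> N} R"
  proof (rule idealI[OF ring_axioms])
    show "subgroup {a \<in> A. a \<otimes> z \<in> N} (add_monoid R)"
    proof (rule add.subgroupI)
      show "{a \<in> A. a \<otimes> z \<in> N} \<noteq> {}" using z A.zero_closed N.zero_closed l_null[OF z] by (metis (mono_tags, lifting) empty_iff mem_Collect_eq)
      show "\<ominus> a \<in> {a \<in> A. a \<otimes> z \<in> N}" if "a \<in> {a \<in> A. a \<otimes> z \<in> N}" for a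
        using that z by (auto simp: l_minus A.a_Hcarr)
      show "a \<oplus> b \<in> {a \<in> A. a \<otimes> z \<in> N}" if "a \<in> {a \<in> A. a \<otimes> z \<in> N}" "b \<in> {a \<in> A. a \<otimes> z \<in> N}" for a b
        using that z by (auto simp: l_distr A.a_Hcarr)
    qed (auto simp: A.a_Hcarr)
    fix a r assume a: "a \<in> {a \<in> A. a \<otimes> z \<in> N}" and r: "r \<in> carrier R"
    then have "r \<otimes> a \<otimes> z = r \<otimes> (a \<otimes> z)" "a \<otimes> r = r \<otimes> a"
      using z A.a_Hcarr by (auto simp: m_ac)
    then show "r \<otimes> a \<in> {a \<in> A. a \<otimes> z \<in> N}" "a \<otimes> r \<in> {a \<in> A. a \<otimes> z \<in> N}"
      using a r by (auto simp: A.I_l_closed N.I_l_closed)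
  qed
next
  fix N N' assume N: "ideal N R" "ideal N' R" "I \<subseteq> N" "N \<subset> N'" "N' \<subseteq> J"
  interpret N: ideal N R by fact
  interpret N': ideal N' R by fact
  interpret A: ideal A R by fact
  \<comment> \<open>Strictness comes from surjectivity: \<open>y\<close> differs from some
    \<open>a z\<close> by an element of \<open>I\<close>, which belongs to both \<open>N\<close> and
    \<open>N'\<close>.\<close>
  obtain y where y: "y \<in> N'" "y \<notin> N" using N by auto
  obtain i a where ia: "i \<in> I" "a \<in> A" "y = i \<oplus> a \<otimes> z" using J y N by blast
  have "i \<in> N" "i \<in> N'" using ia N by auto
  then have "a \<otimes> z \<notin> N" using y ia by auto
  moreover have "a \<otimes> z = y \<ominus> i" using ia \<open>i \<in> N\<close> N.a_Hcarr A.a_Hcarr z by algebra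
  then have "a \<otimes> z \<in> N'" using y \<open>i \<in> N'\<close> by (simp add: minus_eq)
  ultimately show "{a \<in> A. a \<otimes> z \<in> N} \<subset> {a \<in> A. a \<otimes> z \<in> N'}" using ia N by auto
qed (use id K in auto)

lemma l_coset_mem: "y \<in> x <# J \<longleftrightarrow> (\<exists>j\<in>J. y = x \<otimes> j)"
  by (auto simp: l_coset_def)

lemma l_coset_ideal:
  assumes "x \<in> carrier R" "ideal J R"
  shows "ideal (x <# J) R"
proof -
  interpret J: ideal J R by fact
  show ?thesis
  proof (rule idealI[OF ring_axioms])
    show "subgroup (x <# J) (add_monoid R)"
    proof (rule add.subgroupI)
      show "x <# J \<noteq> {}" using J.zero_closed unfolding l_coset_def by blast
      show "\<ominus> a \<in> x <# J" if "a \<in> x <# J" for a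
        using that assms(1) by (auto simp: l_coset_mem J.a_Hcarr intro!: bexI[of _ "\<ominus> _"] simp: r_minus)
      show "a \<oplus> b \<in> x <# J" if "a \<in> x <# J" "b \<in> x <# J" for a b
        using that assms(1) unfolding l_coset_mem by (metis J.a_Hcarr J.a_closed r_distr)
    qed (use assms(1) in \<open>auto simp: l_coset_mem J.a_Hcarr\<close>)
    fix a r assume a: "a \<in> x <# J" and r: "r \<in> carrier R"
    then obtain j where j: "j \<in> J" "a = x \<otimes> j" by (auto simp: l_coset_mem)
    then have "r \<otimes> a = x \<otimes> (r \<otimes> j)" "a \<otimes> r = x \<otimes> (r \<otimes> j)" "r \<otimes> j \<in> J"
      using r assms(1) J.a_Hcarr J.I_l_closed by (auto simp: m_ac)
    then show "r \<otimes> a \<in> x <# J" "a \<otimes> r \<in> x <# J" unfolding l_coset_mem by blast+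
  qed
qed

lemma l_coset_carrier: "x \<in> carrier R \<Longrightarrow> x <# carrier R = PIdl x"
  by (auto simp: l_coset_mem cgenideal_mem m_comm)

text \<open>Multiplication by \<open>x\<close> is an isomorphism of \<open>J / I\<close> with
  \<open>x J / x I\<close>. Its surjectivity gives one inequality; cancelling \<open>x\<close> shows
  that \<open>N \<mapsto> x N\<close> preserves strict inclusions, which gives the other.\<close>

lemma ideal_length_l_coset:
  assumes x: "x \<in> nonzerodivisors R" and id: "ideal I R" "ideal J R" "I \<subseteq> J"
  shows "ideal_length R (x <# I) (x <# J) = ideal_length R I J"
proof (rule antisym)
  have xc: "x \<in> carrier R" using x nzd_closed by auto
  interpret I: ideal I R by fact
  interpret J: ideal J R by fact
  have sub: "x <# I \<subseteq> x <# J" using id unfolding l_coset_mem subset_iff by blast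
  show "ideal_length R (x <# I) (x <# J) \<le> ideal_length R I J"
  proof (rule ideal_length_colon[OF _ _ id(2,1,3) sub xc])
    fix y assume "y \<in> x <# J"
    then obtain j where j: "j \<in> J" "y = x \<otimes> j" by (auto simp: l_coset_mem)
    then have "y = \<zero> \<oplus> j \<otimes> x" using xc J.a_Hcarr by (simp add: m_comm)
    moreover have "\<zero> \<in> x <# I" using I.zero_closed xc unfolding l_coset_mem by (metis r_null)
    ultimately show "\<exists>i\<in>x <# I. \<exists>a\<in>J. y = i \<oplus> a \<otimes> x" using j by blast
  next
    show "k \<otimes> x \<in> x <# I" if "k \<in> I" for k
      using that xc I.a_Hcarr by (auto simp: l_coset_mem m_comm)
  qed (use l_coset_ideal xc id in auto)
  show "ideal_length R I J \<le> ideal_length R (x <# I) (x <# J)"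
  proof (rule ideal_length_mono[where f = "\<lambda>N. x <# N"])
    fix N N' assume N: "ideal N R" "ideal N' R" "I \<subseteq> N" "N \<subset> N'" "N' \<subseteq> J"
    obtain y where y: "y \<in> N'" "y \<notin> N" using N by auto
    have "x \<otimes> y \<notin> x <# N"
      using y N nzd_cancel[OF x, of y] ideal.Icarr[OF N(1)] ideal.Icarr[OF N(2)]
      unfolding l_coset_mem by blast
    moreover have "x \<otimes> y \<in> x <# N'" using y by (auto simp: l_coset_mem)
    moreover have "x <# N \<subseteq> x <# N'" using N unfolding l_coset_mem subset_iff by blast
    ultimately show "x <# N \<subset> x <# N'" by auto
  qed (use l_coset_ideal xc id in auto)
qed

end

section \<open>Noetherian local rings\<close>

context cring begin

lemma set_add_cgenideal:
  assumes "ideal I R" "z \<in> carrier R"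
  shows "ideal (I <+>\<^bsub>R\<^esub> PIdl z) R" "I \<subseteq> I <+>\<^bsub>R\<^esub> PIdl z" "z \<in> I <+>\<^bsub>R\<^esub> PIdl z"
    "y \<in> I <+>\<^bsub>R\<^esub> PIdl z \<longleftrightarrow> (\<exists>i\<in>I. \<exists>r\<in>carrier R. y = i \<oplus> r \<otimes> z)"
    "ideal J R \<Longrightarrow> I \<subseteq> J \<Longrightarrow> z \<in> J \<Longrightarrow> I <+>\<^bsub>R\<^esub> PIdl z \<subseteq> J"
proof -
  note z = cgenideal_ideal[OF assms(2)]
  show "ideal (I <+>\<^bsub>R\<^esub> PIdl z) R" "I \<subseteq> I <+>\<^bsub>R\<^esub> PIdl z"
    using assms z by (auto intro!: add_ideals dest: set_add_upper)
  show "z \<in> I <+>\<^bsub>R\<^esub> PIdl z"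
    using set_add_upper(2)[OF assms(1) z] cgenideal_self[OF assms(2)] by auto
  show "y \<in> I <+>\<^bsub>R\<^esub> PIdl z \<longleftrightarrow> (\<exists>i\<in>I. \<exists>r\<in>carrier R. y = i \<oplus> r \<otimes> z)"
    by (simp add: set_add_mem_iff Bex_def cgenideal_mem) blast
  show "ideal J R \<Longrightarrow> I \<subseteq> J \<Longrightarrow> z \<in> J \<Longrightarrow> I <+>\<^bsub>R\<^esub> PIdl z \<subseteq> J"
    by (intro set_add_least cgenideal_minimal)
qed

lemma ideal_prod_least:
  assumes "ideal K R" "\<And>i j. i \<in> I \<Longrightarrow> j \<in> J \<Longrightarrow> i \<otimes> j \<in> K"
  shows "I \<cdot> J \<subseteq> K"
proof
  interpret K: ideal K R by fact
  fix z assume "z \<in> I \<cdot> J"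
  then show "z \<in> K" by (induction) (auto simp: assms K.a_closed)
qed

lemma ideal_prod_mem: "i \<in> I \<Longrightarrow> j \<in> J \<Longrightarrow> i \<otimes> j \<in> I \<cdot> J"
  by (rule ideal_prod.prod)

end

locale noetherian_local_ring = noetherian_ring R + local_ring R \<mm> for R (structure) and \<mm>
begin

text \<open>A nonempty chain of ideals in a Noetherian ring contains its own union, so Zorn's lemma
  applies to an arbitrary property \<open>P\<close> of ideals.\<close>

lemma exists_maximal_ideal:
  assumes "P K" "\<And>I. P I \<Longrightarrow> ideal I R"
  shows "\<exists>M. P M \<and> (\<forall>N. P N \<longrightarrow> M \<subseteq> N \<longrightarrow> N = M)"
proof -
  have "\<exists>M\<in>Collect P. \<forall>N\<in>Collect P. M \<subseteq> N \<longrightarrow> N = M"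
  proof (rule subset_Zorn)
    fix C assume C: "subset.chain (Collect P) C"
    show "\<exists>U\<in>Collect P. \<forall>N\<in>C. N \<subseteq> U"
    proof (cases "C = {}")
      case False
      have CS: "C \<subseteq> Collect P" using C by (auto simp: subset_chain_def)
      have "subset.chain {I. ideal I R} C" using C assms(2) by (auto simp: subset_chain_def)
      then have "\<Union>C \<in> C" using ideal_chain_is_trivial False by blast
      then show ?thesis using CS by blast
    next
      case True
      then show ?thesis using assms(1) by auto
    qed
  qed
  then show ?thesis by auto
qed

text \<open>Krull's argument: take \<open>Q\<close> maximal among the ideals disjoint from
  \<open>S\<close>. For \<open>a\<close> and \<open>b\<close> outside \<open>Q\<close> some
  \<open>i + r a\<close> and \<open>j + t b\<close> lie in \<open>S\<close>, and
  \<open>a b \<in> Q\<close> would put their product into both \<open>Q\<close> and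
  \<open>S\<close>.\<close>

lemma primeideal_disjoint_submonoid:
  assumes S: "submonoid S R" "\<zero> \<notin> S"
  shows "\<exists>Q. primeideal Q R \<and> Q \<inter> S = {}"
proof -
  interpret S: submonoid S R by fact
  have "\<exists>Q. (ideal Q R \<and> Q \<inter> S = {}) \<and> (\<forall>N. ideal N R \<and> N \<inter> S = {} \<longrightarrow> Q \<subseteq> N \<longrightarrow> N = Q)"
    by (intro exists_maximal_ideal[of "\<lambda>J. ideal J R \<and> J \<inter> S = {}" "{\<zero>}"]) (use S zeroideal in auto)
  then obtain Q where Q: "ideal Q R" "Q \<inter> S = {}"
    and max: "\<forall>N. ideal N R \<and> N \<inter> S = {} \<longrightarrow> Q \<subseteq> N \<longrightarrow> N = Q"
    by (elim exE conjE)
  interpret Q: ideal Q R by fact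
  have meet: "\<exists>i\<in>Q. \<exists>r\<in>carrier R. i \<oplus> r \<otimes> a \<in> S" if a: "a \<in> carrier R" "a \<notin> Q" for a
  proof -
    have "(Q <+>\<^bsub>R\<^esub> PIdl a) \<inter> S \<noteq> {}"
      using max[rule_format, of "Q <+>\<^bsub>R\<^esub> PIdl a"] set_add_cgenideal(1-3)[OF Q(1) a(1)] a(2) by auto
    then show ?thesis unfolding disjoint_iff set_add_cgenideal(4)[OF Q(1) a(1)] by blast
  qed
  have "primeideal Q R"
  proof (rule primeidealI[OF Q(1) is_cring])
    show "carrier R \<noteq> Q" using Q S.one_closed by auto
    fix a b assume ab: "a \<in> carrier R" "b \<in> carrier R" "a \<otimes> b \<in> Q"
    show "a \<in> Q \<or> b \<in> Q"
    proof (rule ccontr)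
      assume "\<not> ?thesis"
      then obtain i r j t where h: "i \<in> Q" "r \<in> carrier R" "i \<oplus> r \<otimes> a \<in> S"
        "j \<in> Q" "t \<in> carrier R" "j \<oplus> t \<otimes> b \<in> S" using meet ab by meson
      have c: "i \<in> carrier R" "j \<in> carrier R" using h Q.a_Hcarr by auto
      have "(i \<oplus> r \<otimes> a) \<otimes> (j \<oplus> t \<otimes> b) = i \<otimes> (j \<oplus> t \<otimes> b) \<oplus> ((r \<otimes> a) \<otimes> j \<oplus> (r \<otimes> t) \<otimes> (a \<otimes> b))"
        using c h ab by algebra
      also have "\<dots> \<in> Q" using h c ab by (intro Q.a_closed) (auto intro: Q.I_l_closed Q.I_r_closed)
      finally show False using S.m_closed[OF h(3,6)] Q(2) by blast
    qed
  qed
  then show ?thesis using Q by blast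
qed

lemma proper_ideal_le_maximal:
  assumes "ideal I R" "I \<noteq> carrier R"
  shows "I \<subseteq> \<mm>"
proof -
  have "\<exists>M. (ideal M R \<and> I \<subseteq> M \<and> M \<noteq> carrier R) \<and> (\<forall>N. ideal N R \<and> I \<subseteq> N \<and> N \<noteq> carrier R \<longrightarrow> M \<subseteq> N \<longrightarrow> N = M)"
    by (intro exists_maximal_ideal[of "\<lambda>J. ideal J R \<and> I \<subseteq> J \<and> J \<noteq> carrier R" I]) (use assms in auto)
  then obtain M where M: "ideal M R" "I \<subseteq> M" "M \<noteq> carrier R"
    and max: "\<forall>N. ideal N R \<and> I \<subseteq> N \<and> N \<noteq> carrier R \<longrightarrow> M \<subseteq> N \<longrightarrow> N = M"
    by (elim exE conjE)
  have "maximalideal M R" 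
  proof (rule maximalidealI)
    show "J = M \<or> J = carrier R" if "ideal J R" "M \<subseteq> J" for J
      using max[rule_format, of J] that M by auto
  qed (use M in auto)
  then show ?thesis using M unique_maximal by auto
qed

section \<open>Units, simple quotients and Nakayama's lemma\<close>

lemma not_mem_maximal_Units:
  assumes "r \<in> carrier R" "r \<notin> \<mm>"
  shows "r \<in> Units R"
proof -
  have "PIdl r = carrier R"
    using proper_ideal_le_maximal[OF cgenideal_ideal] assms cgenideal_self by blast
  then have "\<one> \<in> PIdl r" by simp
  then obtain t where "t \<in> carrier R" "\<one> = t \<otimes> r" by (auto simp: cgenideal_mem)
  then show ?thesis using assms m_comm[of t r] unfolding Units_def by auto
qed

lemma one_not_mem: "\<one> \<notin> \<mm>"
  using I_notcarr one_imp_carrier by auto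

lemma one_minus_Units:
  assumes "a \<in> \<mm>"
  shows "\<one> \<ominus> a \<in> Units R"
proof (rule not_mem_maximal_Units)
  have a: "a \<in> carrier R" using assms a_Hcarr by auto
  show "\<one> \<ominus> a \<in> carrier R" using a by simp
  show "\<one> \<ominus> a \<notin> \<mm>"
  proof
    assume "\<one> \<ominus> a \<in> \<mm>"
    then have "(\<one> \<ominus> a) \<oplus> a \<in> \<mm>" using assms by (rule a_closed)
    moreover have "(\<one> \<ominus> a) \<oplus> a = \<one>" using a by algebra
    ultimately show False using one_not_mem by simp
  qed
qed

lemma mem_of_Units_mult:
  assumes "ideal I R" "u \<in> Units R" "z \<in> carrier R" "u \<otimes> z \<in> I"
  shows "z \<in> I"
proof -
  interpret I: ideal I R by fact
  have "inv u \<otimes> (u \<otimes> z) \<in> I" using assms by (auto intro: I.I_l_closed)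
  moreover have "inv u \<otimes> (u \<otimes> z) = z" using assms by (simp add: m_assoc[symmetric] Units_closed)
  ultimately show ?thesis by simp
qed

text \<open>\<open>J / L\<close> is simple. If \<open>a y\<close> with \<open>a \<in> \<mm>\<close>
  were outside \<open>L\<close>, maximality would give \<open>J = L + (a y)\<close>, hence
  \<open>(1 - r a) y \<in> L\<close> for some \<open>r\<close>; as \<open>1 - r a\<close> is a unit,
  \<open>y\<close> and \<open>a y\<close> would lie in \<open>L\<close> after all.\<close>

lemma exists_maximal_subideal:
  assumes "ideal K R" "ideal J R" "K \<subset> J"
  obtains L z where "ideal L R" "K \<subseteq> L" "L \<subset> J" "z \<in> J" "z \<notin> L"
    "J = L <+>\<^bsub>R\<^esub> PIdl z" "\<And>a y. a \<in> \<mm> \<Longrightarrow> y \<in> J \<Longrightarrow> a \<otimes> y \<in> L"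
proof -
  interpret J: ideal J R by fact
  have "\<exists>L. (ideal L R \<and> K \<subseteq> L \<and> L \<subset> J) \<and> (\<forall>N. ideal N R \<and> K \<subseteq> N \<and> N \<subset> J \<longrightarrow> L \<subseteq> N \<longrightarrow> N = L)"
    by (intro exists_maximal_ideal[of "\<lambda>L. ideal L R \<and> K \<subseteq> L \<and> L \<subset> J" K]) (use assms in auto)
  then obtain L where L: "ideal L R" "K \<subseteq> L" "L \<subset> J"
    and max: "\<forall>N. ideal N R \<and> K \<subseteq> N \<and> N \<subset> J \<longrightarrow> L \<subseteq> N \<longrightarrow> N = L"
    by (elim exE conjE)
  interpret L: ideal L R by fact
  have gen: "J = L <+>\<^bsub>R\<^esub> PIdl z" if "z \<in> J" "z \<notin> L" for z
  proof -
    have "z \<in> carrier R" using that J.a_Hcarr by auto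
    note s = set_add_cgenideal[OF L(1) this]
    have "L <+>\<^bsub>R\<^esub> PIdl z \<subseteq> J" using s(5)[OF assms(2)] that L by auto
    then show ?thesis using max[rule_format, of "L <+>\<^bsub>R\<^esub> PIdl z"] L(2) s(1-3) that by blast
  qed
  obtain z where z: "z \<in> J" "z \<notin> L" using L by auto
  have "a \<otimes> y \<in> L" if a: "a \<in> \<mm>" and y: "y \<in> J" for a y
  proof (rule ccontr)
    assume n: "a \<otimes> y \<notin> L"
    have ac: "a \<in> carrier R" "y \<in> carrier R" using a y a_Hcarr J.a_Hcarr by auto
    have "y \<in> L <+>\<^bsub>R\<^esub> PIdl (a \<otimes> y)" using gen[OF _ n] y ac by (simp add: J.I_l_closed)
    then obtain i r where ir: "i \<in> L" "r \<in> carrier R" "y = i \<oplus> r \<otimes> (a \<otimes> y)"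
      using set_add_cgenideal(4)[OF L(1)] ac by blast
    have "(\<one> \<ominus> r \<otimes> a) \<otimes> y = y \<ominus> r \<otimes> (a \<otimes> y)" using ir(2) ac by algebra
    also have "\<dots> = (i \<oplus> r \<otimes> (a \<otimes> y)) \<ominus> r \<otimes> (a \<otimes> y)" by (subst (1) ir(3)) (rule refl)
    also have "\<dots> = i" using ir(2) L.a_Hcarr[OF ir(1)] ac by algebra
    finally have "(\<one> \<ominus> r \<otimes> a) \<otimes> y \<in> L" using ir by simp
    then have "y \<in> L" using mem_of_Units_mult[OF L(1) one_minus_Units] ir a ac I_l_closed by blast
    then show False using n ac L.I_l_closed by auto
  qed
  then show thesis using that L z gen by blast
qed

text \<open>Instead of determinants: if \<open>K + N\<close> were larger than \<open>K\<close>, some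
  \<open>L\<close> would contain \<open>K\<close> and sit maximally below \<open>K + N\<close>. It
  contains \<open>\<mm> N\<close>, hence by assumption \<open>N\<close>, hence all of
  \<open>K + N\<close>.\<close>

lemma nakayama:
  assumes "ideal K R" "ideal N R" "N \<subseteq> K <+>\<^bsub>R\<^esub> (\<mm> \<cdot> N)"
  shows "N \<subseteq> K"
proof (rule ccontr)
  assume n: "\<not> N \<subseteq> K"
  note s = set_add_upper[OF assms(1,2)] add_ideals[OF assms(1,2)]
  have "K \<subset> K <+>\<^bsub>R\<^esub> N" using n s by blast
  then obtain L z where L: "ideal L R" "K \<subseteq> L" "L \<subset> K <+>\<^bsub>R\<^esub> N"
    "\<And>a y. a \<in> \<mm> \<Longrightarrow> y \<in> K <+>\<^bsub>R\<^esub> N \<Longrightarrow> a \<otimes> y \<in> L"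
    using exists_maximal_subideal[OF assms(1) s(3)] by metis
  have "\<mm> \<cdot> N \<subseteq> L" using L(4) s by (intro ideal_prod_least[OF L(1)]) auto
  then have "K <+>\<^bsub>R\<^esub> (\<mm> \<cdot> N) \<subseteq> L" using L by (intro set_add_least)
  then have "K <+>\<^bsub>R\<^esub> N \<subseteq> L" using L assms by (intro set_add_least) auto
  then show False using L by auto
qed

lemma maximal_is_ideal: "ideal \<mm> R" ..

lemma ideal_length_maximal: "ideal_length R \<mm> (carrier R) = 1"
proof (rule antisym)
  show "ideal_length R \<mm> (carrier R) \<le> 1"
  proof (rule enat_le_of_all_nat)
    fix n assume "enat n \<le> ideal_length R \<mm> (carrier R)"
    then have c: "ideal_chain R \<mm> (carrier R) n"
      using ideal_length_ge_iff[OF maximal_is_ideal oneideal] a_subset by blast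
    have "n \<le> 1"
    proof (cases rule: ideal_chain.cases[OF c])
      case (2 J n' K)
      then have "J = \<mm>" using I_maximal[of J] ideal_chain_ideals[OF 2(3)] ideal.Icarr by blast
      then have "ideal_chain R \<mm> \<mm> n'" using 2 by simp
      then have "n' = 0" by (cases rule: ideal_chain.cases) (auto dest: ideal_chain_ideals)
      then show ?thesis using 2 by simp
    qed auto
    then show "enat n \<le> 1" by (simp add: one_enat_def)
  qed
  show "1 \<le> ideal_length R \<mm> (carrier R)"
    using ideal_length_pos[OF maximal_is_ideal oneideal] I_notcarr a_subset by blast
qed

text \<open>\<open>(L + (z)) / L\<close> is a copy of the residue field
  \<open>R / \<mm>\<close>.\<close>

lemma ideal_length_simple:
  assumes "ideal L R" "z \<in> carrier R" "z \<notin> L" "\<And>a. a \<in> \<mm> \<Longrightarrow> a \<otimes> z \<in> L"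
  shows "ideal_length R L (L <+>\<^bsub>R\<^esub> PIdl z) = 1"
proof (rule antisym)
  note s = set_add_cgenideal[OF assms(1,2)]
  show "ideal_length R L (L <+>\<^bsub>R\<^esub> PIdl z) \<le> 1"
    using ideal_length_colon[OF assms(1) s(1) oneideal maximal_is_ideal a_subset s(2) assms(2)] s(4) assms(4)
    by (metis ideal_length_maximal)
  show "1 \<le> ideal_length R L (L <+>\<^bsub>R\<^esub> PIdl z)"
    using ideal_length_pos[OF assms(1) s(1)] s assms by blast
qed

text \<open>A prime properly below \<open>P\<close> would complete a chain of length 2 if
  \<open>P\<close> were not \<open>\<mm>\<close>. It is found disjoint from the multiplicative set
  \<open>S\<close> of all \<open>s^i t\<close> with \<open>t\<close> outside \<open>P\<close>:
  avoiding the \<open>t\<close> keeps it inside \<open>P\<close>, avoiding \<open>s\<close> makes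
  the inclusion proper, and \<open>0\<close> is not in \<open>S\<close> since \<open>s\<close> is a
  nonzerodivisor.\<close>

lemma primeideal_nzd_eq_maximal:
  assumes dim: "krull_dim R = 1" and P: "primeideal P R" and s: "s \<in> P" "s \<in> nonzerodivisors R"
  shows "P = \<mm>"
proof (rule ccontr)
  assume ne: "P \<noteq> \<mm>"
  interpret P: primeideal P R by fact
  have sc: "s \<in> carrier R" using s nzd_closed by auto
  have spow: "s [^] (i::nat) \<in> nonzerodivisors R" for i
    by (induction i) (auto simp: nzd_one nzd_mult s)
  define S where "S = {s [^] (i::nat) \<otimes> t | i t. t \<in> carrier R \<and> t \<notin> P}"
  have one: "\<one> \<notin> P" using P.I_notcarr P.one_imp_carrier by auto
  have "submonoid S R"
  proof
    show "S \<subseteq> carrier R" using sc by (auto simp: S_def)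
    have "\<one> = s [^] (0::nat) \<otimes> \<one>" using sc by simp
    then show "\<one> \<in> S" using one unfolding S_def by blast
    fix a b assume "a \<in> S" "b \<in> S"
    then obtain i t j u where h: "a = s [^] (i::nat) \<otimes> t" "t \<in> carrier R" "t \<notin> P"
      "b = s [^] (j::nat) \<otimes> u" "u \<in> carrier R" "u \<notin> P" unfolding S_def by blast
    then have "a \<otimes> b = s [^] (i + j) \<otimes> (t \<otimes> u)"
      using sc by (simp add: nat_pow_mult[symmetric] m_ac)
    moreover have "t \<otimes> u \<notin> P" using h P.I_prime by blast
    ultimately show "a \<otimes> b \<in> S" using h unfolding S_def by blast
  qed
  moreover have "\<zero> \<notin> S"
  proof
    assume "\<zero> \<in> S"
    then obtain i t where h: "\<zero> = s [^] (i::nat) \<otimes> t" "t \<in> carrier R" "t \<notin> P" unfolding S_def by blast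
    then have "t = \<zero>" using spow[of i] by (auto simp: nonzerodivisors_def)
    then show False using h P.zero_closed by auto
  qed
  ultimately obtain Q where Q: "primeideal Q R" "Q \<inter> S = {}"
    using primeideal_disjoint_submonoid by blast
  interpret Q: primeideal Q R by fact
  have QP: "Q \<subseteq> P"
  proof (rule ccontr)
    assume "\<not> Q \<subseteq> P"
    then obtain q where q: "q \<in> Q" "q \<notin> P" by auto
    then have "q = s [^] (0::nat) \<otimes> q" "q \<in> carrier R" using Q.a_Hcarr by auto
    then have "q \<in> S" using q unfolding S_def by blast
    then show False using q Q by auto
  qed
  have "s = s [^] (1::nat) \<otimes> \<one>" using sc by simp
  then have "s \<in> S" using one unfolding S_def by blast
  then have QP': "Q \<subset> P" using QP s Q by blast
  have PM: "P \<subset> \<mm>" using ne proper_ideal_le_maximal[OF P.ideal_axioms] P.I_notcarr by blast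
  define N where "N = (\<lambda>i::nat. if i = 0 then Q else if i = 1 then P else \<mm>)"
  have "(\<forall>i\<le>2. primeideal (N i) R) \<and> (\<forall>i<2. N i \<subset> N (Suc i))"
    using QP' PM P Q maximalideal_prime[OF local.maximalideal_axioms] by (auto simp: N_def less_2_cases_iff)
  then have "enat 2 \<le> krull_dim R" unfolding krull_dim_def by (intro Sup_upper) blast
  then show False using dim by (simp add: one_enat_def)
qed

text \<open>Noetherian induction: an ideal maximal among those containing \<open>s\<close> with
  infinite colength is prime, hence equal to \<open>\<mm>\<close>, whose colength is 1.\<close>

theorem finite_colength:
  assumes dim: "krull_dim R = 1" and I: "ideal I R" "s \<in> I" and s: "s \<in> nonzerodivisors R"
  shows "ideal_length R I (carrier R) \<noteq> \<infinity>"
proof (rule ccontr)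
  assume "\<not> ?thesis"
  then have "\<exists>P. (ideal P R \<and> s \<in> P \<and> ideal_length R P (carrier R) = \<infinity>) \<and> (\<forall>N. ideal N R \<and> s \<in> N \<and> ideal_length R N (carrier R) = \<infinity> \<longrightarrow> P \<subseteq> N \<longrightarrow> N = P)"
    by (intro exists_maximal_ideal[of "\<lambda>J. ideal J R \<and> s \<in> J \<and> ideal_length R J (carrier R) = \<infinity>" I]) (use I in auto)
  then obtain P where P: "ideal P R" "s \<in> P" "ideal_length R P (carrier R) = \<infinity>"
    and max: "\<forall>N. ideal N R \<and> s \<in> N \<and> ideal_length R N (carrier R) = \<infinity> \<longrightarrow> P \<subseteq> N \<longrightarrow> N = P"
    by (elim exE conjE)
  interpret P: ideal P R by fact
  have "primeideal P R"
  proof (rule primeidealI[OF P(1) is_cring])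
    show "carrier R \<noteq> P" using P(3) ideal_length_self[OF oneideal] by auto
    fix a b assume ab: "a \<in> carrier R" "b \<in> carrier R" "a \<otimes> b \<in> P"
    show "a \<in> P \<or> b \<in> P"
    proof (rule ccontr)
      assume n: "\<not> ?thesis"
      note sa = set_add_cgenideal[OF P(1) ab(1)] and sb = set_add_cgenideal[OF P(1) ab(2)]
      have "ideal_length R (P <+>\<^bsub>R\<^esub> PIdl a) (carrier R) \<noteq> \<infinity>"
      proof
        assume "ideal_length R (P <+>\<^bsub>R\<^esub> PIdl a) (carrier R) = \<infinity>"
        then have "P <+>\<^bsub>R\<^esub> PIdl a = P"
          using sa(1,2) P(2) by (intro max[rule_format]) auto
        then show False using sa(3) n by simp
      qed
      moreover have "ideal_length R (P <+>\<^bsub>R\<^esub> PIdl b) (carrier R) \<noteq> \<infinity>"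
      proof
        assume "ideal_length R (P <+>\<^bsub>R\<^esub> PIdl b) (carrier R) = \<infinity>"
        then have "P <+>\<^bsub>R\<^esub> PIdl b = P"
          using sb(1,2) P(2) by (intro max[rule_format]) auto
        then show False using sb(3) n by simp
      qed
      \<comment> \<open>As \<open>a b \<in> P\<close>, multiplication by \<open>a\<close> maps
        \<open>R / (P + (b))\<close> onto \<open>(P + (a)) / P\<close>. So \<open>R / P\<close>
        would be built from two pieces of finite length.\<close>
      moreover have "ideal_length R P (P <+>\<^bsub>R\<^esub> PIdl a) \<le> ideal_length R (P <+>\<^bsub>R\<^esub> PIdl b) (carrier R)"
      proof (rule ideal_length_colon[OF P(1) sa(1) oneideal sb(1) _ sa(2) ab(1)])
        show "P <+>\<^bsub>R\<^esub> PIdl b \<subseteq> carrier R" using ideal.Icarr[OF sb(1)] by blast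
        show "\<exists>i\<in>P. \<exists>c\<in>carrier R. y = i \<oplus> c \<otimes> a" if "y \<in> P <+>\<^bsub>R\<^esub> PIdl a" for y
          using that sa(4) by blast
        fix k assume "k \<in> P <+>\<^bsub>R\<^esub> PIdl b"
        then obtain i r where h: "i \<in> P" "r \<in> carrier R" "k = i \<oplus> r \<otimes> b" using sb(4) by blast
        have "i \<in> carrier R" using h P.a_Hcarr by blast
        then have "k \<otimes> a = i \<otimes> a \<oplus> r \<otimes> (a \<otimes> b)" using h ab by algebra
        then show "k \<otimes> a \<in> P" using h ab by (auto intro!: P.a_closed simp: P.I_l_closed P.I_r_closed)
      qed
      moreover have "ideal_length R P (carrier R) =
          ideal_length R P (P <+>\<^bsub>R\<^esub> PIdl a) + ideal_length R (P <+>\<^bsub>R\<^esub> PIdl a) (carrier R)"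
        using ideal.Icarr[OF sa(1)] by (intro ideal_length_add[OF P(1) sa(1) oneideal sa(2)]) blast
      ultimately show False 
        using P(3) by (cases "ideal_length R P (P <+>\<^bsub>R\<^esub> PIdl a)") auto
    qed
  qed
  then have "P = \<mm>" using primeideal_nzd_eq_maximal dim P s by blast
  then show False using P(3) ideal_length_maximal by (simp add: one_enat_def)
qed

end

section \<open>Almost integral fractions\<close>

text \<open>All powers of the fraction \<open>b / x\<close> have a common denominator.\<close>

definition almost_integral :: "('a, 'b) ring_scheme \<Rightarrow> 'a \<Rightarrow> 'a \<Rightarrow> bool" where
  "almost_integral R b x \<longleftrightarrow> (\<exists>d\<in>nonzerodivisors R. \<forall>i::nat. \<exists>y\<in>carrier R.
     b [^]\<^bsub>R\<^esub> i \<otimes>\<^bsub>R\<^esub> d = x [^]\<^bsub>R\<^esub> i \<otimes>\<^bsub>R\<^esub> y)"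

primrec ring_prod :: "('a, 'b) ring_scheme \<Rightarrow> (nat \<Rightarrow> 'a) \<Rightarrow> nat \<Rightarrow> 'a" where
  "ring_prod R f 0 = \<one>\<^bsub>R\<^esub>"
| "ring_prod R f (Suc n) = f n \<otimes>\<^bsub>R\<^esub> ring_prod R f n"

context cring begin

lemma ring_prod_closed: "(\<And>k. f k \<in> carrier R) \<Longrightarrow> ring_prod R f n \<in> carrier R"
  by (induction n) auto

lemma almost_integral_refl: "x \<in> carrier R \<Longrightarrow> almost_integral R x x"
  unfolding almost_integral_def using nzd_one by (metis nat_pow_closed nzd_closed)

lemma almost_integral_smult:
  assumes "almost_integral R b x" "b \<in> carrier R" "x \<in> carrier R" "r \<in> carrier R"
  shows "almost_integral R (r \<otimes> b) x"
proof -
  obtain d where d: "d \<in> nonzerodivisors R" "\<And>i::nat. \<exists>y\<in>carrier R. b [^] i \<otimes> d = x [^] i \<otimes> y"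
    using assms by (auto simp: almost_integral_def)
  have "\<exists>y\<in>carrier R. (r \<otimes> b) [^] i \<otimes> d = x [^] i \<otimes> y" for i :: nat
  proof -
    obtain y where y: "y \<in> carrier R" "b [^] i \<otimes> d = x [^] i \<otimes> y" using d by blast
    have "(r \<otimes> b) [^] i \<otimes> d = r [^] i \<otimes> (b [^] i \<otimes> d)"
      using assms nzd_closed[OF d(1)] by (simp add: nat_pow_distrib m_assoc)
    also have "\<dots> = x [^] i \<otimes> (r [^] i \<otimes> y)" unfolding y(2) using assms y(1) by (simp add: m_ac)
    finally show ?thesis using y assms by blast
  qed
  then show ?thesis using d unfolding almost_integral_def by blast
qed

lemma almost_integral_mult:
  assumes "almost_integral R a x" "almost_integral R b t"
    and c: "a \<in> carrier R" "x \<in> carrier R" "b \<in> carrier R" "t \<in> carrier R"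
  shows "almost_integral R (a \<otimes> b) (x \<otimes> t)"
proof -
  obtain d where d: "d \<in> nonzerodivisors R" "\<And>i::nat. \<exists>y\<in>carrier R. a [^] i \<otimes> d = x [^] i \<otimes> y"
    using assms by (auto simp: almost_integral_def)
  obtain e where e: "e \<in> nonzerodivisors R" "\<And>i::nat. \<exists>y\<in>carrier R. b [^] i \<otimes> e = t [^] i \<otimes> y"
    using assms by (auto simp: almost_integral_def)
  have k: "d \<in> carrier R" "e \<in> carrier R" using d e nzd_closed by auto
  have "\<exists>y\<in>carrier R. (a \<otimes> b) [^] i \<otimes> (d \<otimes> e) = (x \<otimes> t) [^] i \<otimes> y" for i :: nat
  proof -
    obtain y z where y: "y \<in> carrier R" "a [^] i \<otimes> d = x [^] i \<otimes> y"
      and z: "z \<in> carrier R" "b [^] i \<otimes> e = t [^] i \<otimes> z" using d e by blast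
    have "(a \<otimes> b) [^] i \<otimes> (d \<otimes> e) = (a [^] i \<otimes> d) \<otimes> (b [^] i \<otimes> e)"
      using c k by (simp add: nat_pow_distrib m_ac)
    also have "\<dots> = (x \<otimes> t) [^] i \<otimes> (y \<otimes> z)"
      unfolding y z using c y(1) z(1) by (simp add: nat_pow_distrib m_ac)
    finally show ?thesis using y(1) z(1) by blast
  qed
  then show ?thesis using nzd_mult[OF d(1) e(1)] unfolding almost_integral_def by blast
qed

text \<open>\<open>b / t\<close> is the product of \<open>b / x\<close> and \<open>x / t\<close>,
  and the common denominators multiply. This is what allows one denominator to be exchanged for
  another later.\<close>

lemma almost_integral_trans:
  assumes "almost_integral R b x" "almost_integral R x t"
    and c: "b \<in> carrier R" "x \<in> carrier R" "t \<in> carrier R"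
  shows "almost_integral R b t"
proof -
  obtain d where d: "d \<in> nonzerodivisors R" "\<And>i::nat. \<exists>y\<in>carrier R. b [^] i \<otimes> d = x [^] i \<otimes> y"
    using assms by (auto simp: almost_integral_def)
  obtain e where e: "e \<in> nonzerodivisors R" "\<And>i::nat. \<exists>y\<in>carrier R. x [^] i \<otimes> e = t [^] i \<otimes> y"
    using assms by (auto simp: almost_integral_def)
  have k: "d \<in> carrier R" "e \<in> carrier R" using d e nzd_closed by auto
  have "\<exists>y\<in>carrier R. b [^] i \<otimes> (d \<otimes> e) = t [^] i \<otimes> y" for i :: nat
  proof -
    obtain y z where y: "y \<in> carrier R" "b [^] i \<otimes> d = x [^] i \<otimes> y"
      and z: "z \<in> carrier R" "x [^] i \<otimes> e = t [^] i \<otimes> z" using d e by blast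
    have "b [^] i \<otimes> (d \<otimes> e) = (b [^] i \<otimes> d) \<otimes> e" using c k by (simp add: m_ac)
    also have "\<dots> = y \<otimes> (x [^] i \<otimes> e)" unfolding y using c k y(1) by (simp add: m_ac)
    also have "\<dots> = t [^] i \<otimes> (y \<otimes> z)" unfolding z using c y(1) z(1) by (simp add: m_ac)
    finally show ?thesis using y(1) z(1) by blast
  qed
  then show ?thesis using nzd_mult[OF d(1) e(1)] unfolding almost_integral_def by blast
qed

lemma almost_integral_add:
  assumes "almost_integral R a x" "almost_integral R b x"
    and c: "a \<in> carrier R" "b \<in> carrier R" "x \<in> carrier R"
  shows "almost_integral R (a \<oplus> b) x"
proof -
  obtain d where d: "d \<in> nonzerodivisors R" "\<And>i::nat. \<exists>y\<in>carrier R. a [^] i \<otimes> d = x [^] i \<otimes> y"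
    using assms by (auto simp: almost_integral_def)
  obtain e where e: "e \<in> nonzerodivisors R" "\<And>i::nat. \<exists>y\<in>carrier R. b [^] i \<otimes> e = x [^] i \<otimes> y"
    using assms by (auto simp: almost_integral_def)
  have k: "d \<in> carrier R" "e \<in> carrier R" using d e nzd_closed by auto
  \<comment> \<open>The extra factor \<open>a^j b^l\<close> lets the induction peel off one
    \<open>a + b\<close> at a time, raising \<open>j\<close> or \<open>l\<close>; it replaces the
    binomial expansion.\<close>
  have *: "\<exists>y\<in>carrier R. a [^] j \<otimes> b [^] l \<otimes> (a \<oplus> b) [^] i \<otimes> (d \<otimes> e) = x [^] (i + j + l) \<otimes> y" for i j l :: nat
  proof (induction i arbitrary: j l)
    case 0
    obtain y z where y: "y \<in> carrier R" "a [^] j \<otimes> d = x [^] j \<otimes> y"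
      and z: "z \<in> carrier R" "b [^] l \<otimes> e = x [^] l \<otimes> z" using d e by blast
    have "a [^] j \<otimes> b [^] l \<otimes> (a \<oplus> b) [^] (0::nat) \<otimes> (d \<otimes> e) = (a [^] j \<otimes> d) \<otimes> (b [^] l \<otimes> e)"
      using c k by (simp add: m_ac)
    also have "\<dots> = x [^] (j + l) \<otimes> (y \<otimes> z)"
      unfolding y z using c y(1) z(1) by (simp add: nat_pow_mult[symmetric] m_ac)
    finally show ?case using y(1) z(1) by auto
  next
    case (Suc i)
    obtain y where y: "y \<in> carrier R"
      "a [^] Suc j \<otimes> b [^] l \<otimes> (a \<oplus> b) [^] i \<otimes> (d \<otimes> e) = x [^] (i + Suc j + l) \<otimes> y" using Suc by blast
    obtain z where z: "z \<in> carrier R"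
      "a [^] j \<otimes> b [^] Suc l \<otimes> (a \<oplus> b) [^] i \<otimes> (d \<otimes> e) = x [^] (i + j + Suc l) \<otimes> z" using Suc by blast
    have "a [^] j \<otimes> b [^] l \<otimes> (a \<oplus> b) [^] Suc i \<otimes> (d \<otimes> e) =
        a [^] Suc j \<otimes> b [^] l \<otimes> (a \<oplus> b) [^] i \<otimes> (d \<otimes> e)
        \<oplus> a [^] j \<otimes> b [^] Suc l \<otimes> (a \<oplus> b) [^] i \<otimes> (d \<otimes> e)"
      using c k by (simp add: r_distr l_distr m_ac)
    also have "\<dots> = x [^] (Suc i + j + l) \<otimes> (y \<oplus> z)"
      unfolding y z using c y(1) z(1) by (simp add: r_distr)
    finally show ?case using y(1) z(1) by blast
  qed
  have "\<exists>y\<in>carrier R. (a \<oplus> b) [^] i \<otimes> (d \<otimes> e) = x [^] i \<otimes> y" for i :: nat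
    using *[of 0 0 i] c by simp
  then show ?thesis using nzd_mult[OF d(1) e(1)] unfolding almost_integral_def by blast
qed

text \<open>Integrality over a fixed denominator can therefore be checked on generators of an
  ideal.\<close>

lemma ideal_almost_integral:
  assumes "x \<in> carrier R"
  shows "ideal {a \<in> carrier R. almost_integral R a x} R"
proof (rule idealI[OF ring_axioms])
  show "subgroup {a \<in> carrier R. almost_integral R a x} (add_monoid R)"
  proof (rule add.subgroupI)
    have "x \<in> {a \<in> carrier R. almost_integral R a x}" using assms almost_integral_refl by auto
    then show "{a \<in> carrier R. almost_integral R a x} \<noteq> {}" by blast
    fix a assume "a \<in> {a \<in> carrier R. almost_integral R a x}"
    then have "almost_integral R (\<ominus> \<one> \<otimes> a) x" "a \<in> carrier R"
      using assms almost_integral_smult by auto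
    then show "\<ominus> a \<in> {a \<in> carrier R. almost_integral R a x}" by (simp add: l_minus)
  qed (use assms almost_integral_add in auto)
qed (use assms almost_integral_smult m_comm in auto)

section \<open>Powers of ideals and products of nonzerodivisors\<close>

lemma ideal_pow_0: "ideal_pow R I 0 = carrier R"
  by (simp add: ideals_set_def)

lemma ideal_pow_Suc: "ideal_pow R I (Suc n) = ideal_pow R I n \<cdot> I"
  by (simp add: ideals_set_def)

lemma ideal_pow_mult_mem:
  assumes "ideal I R" "a \<in> ideal_pow R I i" "b \<in> ideal_pow R I j"
  shows "a \<otimes> b \<in> ideal_pow R I (i + j)"
proof -
  interpret S: comm_monoid "ideals_set R" by (rule ideals_set_is_comm_monoid)
  have "I \<in> carrier (ideals_set R)" using assms by (simp add: ideals_set_def)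
  then have "ideal_pow R I i \<cdot> ideal_pow R I j = ideal_pow R I (i + j)"
    using S.nat_pow_mult[of I i j] by (simp add: ideals_set_def)
  then show ?thesis using assms ideal_prod_mem by blast
qed

lemma ideal_pow_1: "ideal I R \<Longrightarrow> ideal_pow R I 1 = I"
  using ideal_prod_one ideal_prod_commute[OF oneideal] ideal_pow_Suc[of I 0] by (simp add: ideals_set_def)

lemma ideal_pow_mem: "ideal I R \<Longrightarrow> a \<in> I \<Longrightarrow> a [^] n \<in> ideal_pow R I n"
proof (induction n)
  case (Suc n)
  then show ?case using ideal_pow_mult_mem[of I "a [^] n" n a 1] ideal_pow_1 by simp
next
  case 0
  show ?case unfolding ideal_pow_0 by simp
qed

lemma nzd_pow: "s \<in> nonzerodivisors R \<Longrightarrow> s [^] (i::nat) \<in> nonzerodivisors R"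
  by (induction i) (auto simp: nzd_one nzd_mult)

lemma nzd_of_mult:
  assumes "s \<otimes> t \<in> nonzerodivisors R" "s \<in> carrier R" "t \<in> carrier R"
  shows "s \<in> nonzerodivisors R"
  unfolding nonzerodivisors_def
proof (intro CollectI conjI ballI impI)
  fix a assume a: "a \<in> carrier R" "s \<otimes> a = \<zero>"
  have "s \<otimes> t \<otimes> a = t \<otimes> (s \<otimes> a)" using assms a m_comm m_assoc by metis
  then have "s \<otimes> t \<otimes> a = \<zero>" using a assms by simp
  then show "a = \<zero>" using assms a by (auto simp: nonzerodivisors_def)
qed (use assms in auto)

text \<open>The length from \<open>x J\<close> up to \<open>R\<close> is computed through
  \<open>J\<close> and through \<open>x R\<close>. Since \<open>x R / x J\<close> has the length of
  \<open>R / J\<close>, that length occurs on both sides and cancels, being finite.\<close>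

lemma ideal_length_l_coset_self:
  assumes x: "x \<in> nonzerodivisors R" and J: "ideal J R" "ideal_length R J (carrier R) \<noteq> \<infinity>"
  shows "ideal_length R (x <# J) J = ideal_length R (PIdl x) (carrier R)"
proof -
  have xc: "x \<in> carrier R" using x nzd_closed by auto
  interpret J: ideal J R by fact
  have Jc: "J \<subseteq> carrier R" using J.Icarr by blast
  have s: "x <# J \<subseteq> J" using xc J.I_l_closed by (auto simp: l_coset_mem)
  have s': "x <# J \<subseteq> x <# carrier R" using J.Icarr unfolding l_coset_mem subset_iff by blast
  have c: "x <# carrier R \<subseteq> carrier R" using xc by (auto simp: l_coset_mem)
  have "ideal_length R (x <# J) J + ideal_length R J (carrier R) = ideal_length R (x <# J) (carrier R)"
    using ideal_length_add[OF l_coset_ideal[OF xc J(1)] J(1) oneideal s Jc] by simp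
  also have "\<dots> = ideal_length R J (carrier R) + ideal_length R (x <# carrier R) (carrier R)"
    using ideal_length_add[OF l_coset_ideal[OF xc J(1)] l_coset_ideal[OF xc oneideal] oneideal s' c]
      ideal_length_l_coset[OF x J(1) oneideal Jc] by simp
  finally show ?thesis using J(2) l_coset_carrier[OF xc] by (cases "ideal_length R J (carrier R)") (auto simp: add.commute)
qed

end

context noetherian_local_ring begin

section \<open>Reductions of ideals with two generators\<close>

lemma residue_sequence:
  assumes "infinite (carrier (R Quot \<mm>))"
  obtains l :: "nat \<Rightarrow> 'a" where "\<And>i. l i \<in> carrier R" "\<And>i j. i \<noteq> j \<Longrightarrow> l i \<ominus> l j \<notin> \<mm>"
proof -
  obtain f :: "nat \<Rightarrow> 'a set" where f: "inj f" "range f \<subseteq> carrier (R Quot \<mm>)"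
    using infinite_countable_subset[OF assms] by blast
  have "\<forall>i. \<exists>r\<in>carrier R. f i = \<mm> +> r" using f(2) by (auto simp: FactRing_def A_RCOSETS_def')
  then obtain l where l: "\<And>i. l i \<in> carrier R" "\<And>i. f i = \<mm> +> l i" by metis
  have "i = j" if "l i \<ominus> l j \<in> \<mm>" for i j
  proof -
    have "l i = (l i \<ominus> l j) \<oplus> l j" using l(1)[of i] l(1)[of j] by algebra
    then have "l i \<in> \<mm> +> l j" using that by (auto simp: a_r_coset_def')
    then have "f i = f j" using a_repr_independence'[OF _ l(1)] l(2) by metis
    then show ?thesis using f(1) by (simp add: inj_eq)
  qed
  then show thesis using that l(1) by blast
qed

text \<open>With \<open>I = (x, b)\<close> and \<open>w\<^sub>i\<close> the product of the \<open>x - l\<^sub>k b\<close> over \<open>k < i\<close>, the descending chain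
  \<open>J\<^sub>i = \<mm> I\<^sup>N + w\<^sub>i I\<^sup>N\<^sup>-\<^sup>i\<close> has more members than \<open>\<ell>(I\<^sup>N / x I\<^sup>N) = \<ell>(R / x R)\<close> allows, so \<open>J\<^sub>i\<^sub>+\<^sub>1 = J\<^sub>i\<close> for
  some \<open>i\<close>. Modulo \<open>y = x - l\<^sub>i b\<close> the generator \<open>w\<^sub>i b\<^sup>N\<^sup>-\<^sup>i\<close> is a unit times \<open>b\<^sup>N\<close>, hence
  \<open>I\<^sup>N \<subseteq> y I\<^sup>N\<^sup>-\<^sup>1 + \<mm> I\<^sup>N\<close>, and Nakayama's lemma applies.\<close>

lemma exists_reduction_two_generators:
  assumes dim: "krull_dim R = 1" and inf: "infinite (carrier (R Quot \<mm>))"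
    and x: "x \<in> nonzerodivisors R" "x \<in> \<mm>" and b: "b \<in> carrier R"
  obtains r where "r \<in> carrier R" "x \<ominus> r \<otimes> b \<in> nonzerodivisors R"
    "almost_integral R x (x \<ominus> r \<otimes> b)" "almost_integral R b (x \<ominus> r \<otimes> b)"
proof -
  have xc: "x \<in> carrier R" using x nzd_closed by auto
  obtain l :: "nat \<Rightarrow> 'a" where l: "\<And>i. l i \<in> carrier R" "\<And>i j. i \<noteq> j \<Longrightarrow> l i \<ominus> l j \<notin> \<mm>"
    using residue_sequence[OF inf] by blast
  define I where "I = PIdl x <+>\<^bsub>R\<^esub> PIdl b"
  note sI = set_add_cgenideal[OF cgenideal_ideal[OF xc] b]
  have I: "ideal I R" "x \<in> I" "b \<in> I" unfolding I_def using sI cgenideal_self[OF xc] by auto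
  have I_mem: "\<exists>\<alpha>\<in>carrier R. \<exists>\<beta>\<in>carrier R. y = \<alpha> \<otimes> x \<oplus> \<beta> \<otimes> b" if "y \<in> I" for y
    using that[unfolded I_def sI(4) Bex_def cgenideal_mem] by blast
  define P where "P = (\<lambda>n. ideal_pow R I n)"
  have P: "ideal (P n) R" for n unfolding P_def by (rule ideals_pow[OF I(1)])
  have Pc: "y \<in> P n \<Longrightarrow> y \<in> carrier R" for y n using ideal.Icarr[OF P] by blast
  have P0: "P 0 = carrier R" unfolding P_def by (rule ideal_pow_0)
  have PS: "P (Suc n) = P n \<cdot> I" for n unfolding P_def by (rule ideal_pow_Suc)
  have Pm: "a \<otimes> c \<in> P (Suc n)" if "a \<in> P n" "c \<in> I" for a c n
    unfolding PS using that by (rule ideal_prod_mem)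
  have Pm': "c \<otimes> a \<in> P (Suc n)" if "a \<in> P n" "c \<in> I" for a c n
    using Pm[OF that] Pc[OF that(1)] ideal.Icarr[OF I(1) that(2)] by (simp add: m_comm)
  have Padd: "a \<oplus> c \<in> P n" if "a \<in> P n" "c \<in> P n" for a c n
    using ideal.axioms(1)[OF P] that by (meson additive_subgroup.a_closed)
  have Psm: "c \<otimes> a \<in> P n" if "a \<in> P n" "c \<in> carrier R" for a c n
    using ideal.I_l_closed[OF P] that by blast
  have xl: "x \<ominus> r \<otimes> b \<in> I" if "r \<in> carrier R" for r
  proof -
    interpret I: ideal I R by fact
    show ?thesis using that I by (simp add: minus_eq I.I_l_closed)
  qed
  define w where "w = ring_prod R (\<lambda>k. x \<ominus> l k \<otimes> b)"
  have wP: "w i \<in> P i" for i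
    unfolding w_def by (induction i) (auto simp: P0 Pm' xl l)
  have wPP: "w i \<otimes> p \<in> P (i + j)" if "p \<in> P j" for i j p
    using that wP ideal_pow_mult_mem[OF I(1)] unfolding P_def by blast
  have bP: "b [^] n \<in> P n" for n unfolding P_def by (rule ideal_pow_mem[OF I(1,3)])
  have xP: "x [^] n \<in> P n" for n unfolding P_def by (rule ideal_pow_mem[OF I(1,2)])
  have wc: "w i \<in> carrier R" for i using wP Pc by blast
  obtain B where B: "ideal_length R (PIdl x) (carrier R) = enat B"
    using finite_colength[OF dim cgenideal_ideal[OF xc] cgenideal_self[OF xc] x(1)] by auto
  \<comment> \<open>The least number of strict steps that cannot fit into a module of length
    \<open>B\<close>.\<close>
  define N where "N = Suc B"
  have mP: "ideal (\<mm> \<cdot> P N) R" using maximal_is_ideal P by (rule ideal_prod_is_ideal)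
  have mPP: "\<mm> \<cdot> P N \<subseteq> P N" by (rule ideal_prod_least[OF P]) (auto intro: Psm a_Hcarr)
  define J where "J = (\<lambda>i. (\<mm> \<cdot> P N) <+>\<^bsub>R\<^esub> (w i <# P (N - i)))"
  have J: "ideal (J i) R" for i unfolding J_def by (intro add_ideals mP l_coset_ideal wc P)
  have mJ: "\<mm> \<cdot> P N \<subseteq> J i" for i unfolding J_def by (rule set_add_upper(1)[OF mP l_coset_ideal[OF wc P]])
  have wJ: "w i \<otimes> p \<in> J i" if "p \<in> P (N - i)" for i p
    using set_add_upper(2)[OF mP l_coset_ideal[OF wc P], of i "N - i"] that
    unfolding J_def l_coset_mem subset_iff by blast
  have JS: "J (Suc i) \<subseteq> J i" if "i < N" for i
  proof -
    have "w (Suc i) <# P (N - Suc i) \<subseteq> J i"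
    proof
      fix y assume "y \<in> w (Suc i) <# P (N - Suc i)"
      then obtain p where p: "p \<in> P (N - Suc i)" "y = w (Suc i) \<otimes> p" by (auto simp: l_coset_mem)
      have "y = w i \<otimes> ((x \<ominus> l i \<otimes> b) \<otimes> p)"
        using p wc[of i] Pc[OF p(1)] xc b l(1)[of i] by (simp add: w_def m_ac)
      moreover have "(x \<ominus> l i \<otimes> b) \<otimes> p \<in> P (N - i)"
        using Pm'[OF p(1) xl[OF l(1)]] that by (simp add: Suc_diff_Suc)
      ultimately show "y \<in> J i" using wJ by blast
    qed
    then have "(\<mm> \<cdot> P N) <+>\<^bsub>R\<^esub> (w (Suc i) <# P (N - Suc i)) \<subseteq> J i"
      by (intro set_add_least J mJ)
    then show ?thesis by (simp add: J_def)
  qed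
  have "\<exists>i<N. J (Suc i) = J i"
  proof (rule ccontr)
    assume "\<not> ?thesis"
    then have strict: "J (Suc i) \<subset> J i" if "i < N" for i using JS that by blast
    have chain: "ideal_chain R (J k) (J 0) k" if "k \<le> N" for k
      using that
    proof (induction k)
      case 0
      then show ?case using J by (blast intro: ideal_chain.base)
    next
      case (Suc k)
      then have "ideal_chain R (J (Suc k)) (J k) (Suc 0)"
        using strict[of k] J by (meson Suc_le_lessD base order_refl step)
      then show ?case using Suc ideal_chain_trans by fastforce
    qed
    have "enat N \<le> ideal_length R (J N) (J 0)"
      using chain[of N] ideal_chain_ideals[OF chain[of N]] ideal_length_ge_iff by blast
    also have "\<dots> \<le> ideal_length R (x <# P N) (P N)"
    proof (rule ideal_length_mono[where f = "\<lambda>L. L"])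
      \<comment> \<open>Here \<open>x \<in> \<mm>\<close> enters: \<open>x I^N\<close> lies in
        \<open>\<mm> I^N\<close>, the part common to all \<open>J i\<close>.\<close>
      show "x <# P N \<subseteq> J N" using x(2) mJ[of N] ideal_prod_mem[OF x(2)] unfolding l_coset_mem subset_iff by metis
      show "J 0 \<subseteq> P N" unfolding J_def
        by (rule set_add_least[OF P mPP]) (use wPP[of _ N 0] in \<open>auto simp: l_coset_mem\<close>)
      show "J N \<subseteq> J 0" using chain[of N] ideal_chain_ideals by blast
    qed (use J P l_coset_ideal xc in auto)
    also have "\<dots> = enat B"
    proof -
      have "ideal_length R (P N) (carrier R) \<noteq> \<infinity>"
        using finite_colength[OF dim P xP nzd_pow[OF x(1)]] by blast
      then show ?thesis using ideal_length_l_coset_self[OF x(1) P] B by simp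
    qed
    finally show False by (simp add: N_def)
  qed
  then obtain i where i: "i < N" "J (Suc i) = J i" by blast
  define y where "y = x \<ominus> l i \<otimes> b"
  have y: "y \<in> I" "y \<in> carrier R" unfolding y_def using xl[OF l(1)] xc b l(1) by auto
  have xy: "x = y \<oplus> l i \<otimes> b" unfolding y_def using xc b l(1)[of i] by algebra
  have yP: "ideal (y <# P n) R" for n by (rule l_coset_ideal[OF y(2) P])
  \<comment> \<open>Modulo \<open>y\<close> the generator \<open>x\<close> becomes
    \<open>l i\<close> times \<open>b\<close>, so a form of degree \<open>n + 1\<close> in
    \<open>x\<close> and \<open>b\<close> becomes a multiple of \<open>b^(n+1)\<close>. The
    induction also keeps the cofactor of \<open>y\<close> in \<open>I^n\<close>.\<close>
  have mod_y: "P (Suc n) \<subseteq> (y <# P n) <+>\<^bsub>R\<^esub> PIdl (b [^] Suc n)" for n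
  proof (induction n)
    case 0
    note s = set_add_cgenideal[OF yP[of 0] nat_pow_closed[OF b, of "Suc 0"]]
    show ?case unfolding PS
    proof (rule ideal_prod_least[OF s(1)])
      fix p c assume p: "p \<in> P 0" and c: "c \<in> I"
      obtain \<alpha> \<beta> where ab: "\<alpha> \<in> carrier R" "\<beta> \<in> carrier R" "c = \<alpha> \<otimes> x \<oplus> \<beta> \<otimes> b" using I_mem[OF c] by blast
      have "p \<otimes> c = y \<otimes> (\<alpha> \<otimes> p) \<oplus> (p \<otimes> (\<alpha> \<otimes> l i \<oplus> \<beta>)) \<otimes> b"
        unfolding ab(3) xy using ab(1,2) y(2) l(1)[of i] b Pc[OF p] by algebra
      moreover have "y \<otimes> (\<alpha> \<otimes> p) \<in> y <# P 0" using Psm[OF p ab(1)] unfolding l_coset_mem by blast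
      ultimately show "p \<otimes> c \<in> (y <# P 0) <+>\<^bsub>R\<^esub> PIdl (b [^] Suc 0)"
        unfolding s(4) using b ab l(1)[of i] Pc[OF p] by fastforce
    qed
  next
    case (Suc n)
    note s = set_add_cgenideal[OF yP[of "Suc n"] nat_pow_closed[OF b, of "Suc (Suc n)"]]
    show ?case unfolding PS[of "Suc n"]
    proof (rule ideal_prod_least[OF s(1)])
      fix p c assume p: "p \<in> P (Suc n)" and c: "c \<in> I"
      obtain \<alpha> \<beta> where ab: "\<alpha> \<in> carrier R" "\<beta> \<in> carrier R" "c = \<alpha> \<otimes> x \<oplus> \<beta> \<otimes> b" using I_mem[OF c] by blast
      obtain q r where qr: "q \<in> P n" "r \<in> carrier R" "p = y \<otimes> q \<oplus> r \<otimes> b [^] Suc n"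
        using Suc p set_add_cgenideal(4)[OF yP nat_pow_closed[OF b]] by (metis l_coset_mem subset_iff)
      have k: "q \<in> carrier R" "b [^] Suc n \<in> carrier R" "p \<in> carrier R" using Pc qr p b by auto
      define \<gamma> where "\<gamma> = \<alpha> \<otimes> l i \<oplus> \<beta>"
      have \<gamma>: "\<gamma> \<in> carrier R" unfolding \<gamma>_def using ab l(1) by simp
      have "p \<otimes> c = y \<otimes> (\<alpha> \<otimes> p) \<oplus> \<gamma> \<otimes> (p \<otimes> b)"
        unfolding ab(3) xy \<gamma>_def using ab(1,2) y(2) l(1)[of i] b k by algebra
      also have "\<gamma> \<otimes> (p \<otimes> b) = y \<otimes> (\<gamma> \<otimes> (b \<otimes> q)) \<oplus> (\<gamma> \<otimes> r) \<otimes> b [^] Suc (Suc n)"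
        unfolding qr(3) nat_pow_Suc[of b "Suc n"] using \<gamma> y(2) k(1,2) b qr(2) by algebra
      also have "y \<otimes> (\<alpha> \<otimes> p) \<oplus> (y \<otimes> (\<gamma> \<otimes> (b \<otimes> q)) \<oplus> (\<gamma> \<otimes> r) \<otimes> b [^] Suc (Suc n))
          = y \<otimes> (\<alpha> \<otimes> p \<oplus> \<gamma> \<otimes> (b \<otimes> q)) \<oplus> (\<gamma> \<otimes> r) \<otimes> b [^] Suc (Suc n)"
        using ab \<gamma> y(2) k b qr(2) by (simp add: r_distr a_assoc)
      finally have e: "p \<otimes> c = y \<otimes> (\<alpha> \<otimes> p \<oplus> \<gamma> \<otimes> (b \<otimes> q)) \<oplus> (\<gamma> \<otimes> r) \<otimes> b [^] Suc (Suc n)" .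
      have "\<alpha> \<otimes> p \<oplus> \<gamma> \<otimes> (b \<otimes> q) \<in> P (Suc n)"
        by (intro Padd Psm Pm' p qr I ab \<gamma>)
      then have "y \<otimes> (\<alpha> \<otimes> p \<oplus> \<gamma> \<otimes> (b \<otimes> q)) \<in> y <# P (Suc n)" unfolding l_coset_mem by blast
      then show "p \<otimes> c \<in> (y <# P (Suc n)) <+>\<^bsub>R\<^esub> PIdl (b [^] Suc (Suc n))"
        unfolding s(4) using e \<gamma> qr(2) m_closed by blast
    qed
  qed
  \<comment> \<open>Since \<open>x - l k b = y + (l i - l k) b\<close>, the product
    \<open>w j\<close> is congruent to \<open>u j\<close> times \<open>b^j\<close> modulo
    \<open>y\<close>. For \<open>j \<le> i\<close> only indices \<open>k < i\<close> occur in
    \<open>u j\<close>, so its factors are units.\<close>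
  define u where "u = ring_prod R (\<lambda>k. l i \<ominus> l k)"
  have uc: "u j \<in> carrier R" for j unfolding u_def by (rule ring_prod_closed) (simp add: l)
  have w_mod_y: "\<exists>q\<in>P n. w j \<otimes> b [^] k = y \<otimes> q \<oplus> u j \<otimes> b [^] Suc n" if "j + k = Suc n" for j k n
    using that
  proof (induction j arbitrary: k)
    case 0
    have "\<zero> \<in> P n" using P additive_subgroup.zero_closed ideal.axioms(1) by blast
    then show ?case using 0 b y(2) by (intro bexI[of _ \<zero>]) (auto simp: w_def u_def)
  next
    case (Suc j)
    then obtain q where q: "q \<in> P n" "w j \<otimes> b [^] Suc k = y \<otimes> q \<oplus> u j \<otimes> b [^] Suc n" by force
    have "w j \<otimes> b [^] k \<in> P (j + k)" by (rule wPP[OF bP])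
    then have wb: "w j \<otimes> b [^] k \<in> P n" using Suc by simp
    have k: "w j \<in> carrier R" "b [^] k \<in> carrier R" "q \<in> carrier R" "u j \<in> carrier R" "b [^] Suc n \<in> carrier R"
      "l i \<in> carrier R" "l j \<in> carrier R"
      using wc b Pc q uc l by auto
    have "w (Suc j) \<otimes> b [^] k = (y \<oplus> (l i \<ominus> l j) \<otimes> b) \<otimes> w j \<otimes> b [^] k"
    proof -
      have "x \<ominus> l j \<otimes> b = y \<oplus> (l i \<ominus> l j) \<otimes> b" unfolding xy using k y(2) b by algebra
      then show ?thesis by (simp add: w_def)
    qed
    also have "\<dots> = y \<otimes> (w j \<otimes> b [^] k) \<oplus> (l i \<ominus> l j) \<otimes> (w j \<otimes> b [^] Suc k)"
      unfolding nat_pow_Suc using k(1,2,6,7) y(2) b by algebra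
    also have "\<dots> = y \<otimes> (w j \<otimes> b [^] k \<oplus> (l i \<ominus> l j) \<otimes> q) \<oplus> ((l i \<ominus> l j) \<otimes> u j) \<otimes> b [^] Suc n"
      unfolding q(2) using k y(2) by algebra
    finally have "w (Suc j) \<otimes> b [^] k = y \<otimes> (w j \<otimes> b [^] k \<oplus> (l i \<ominus> l j) \<otimes> q) \<oplus> u (Suc j) \<otimes> b [^] Suc n"
      by (simp add: u_def)
    moreover have "w j \<otimes> b [^] k \<oplus> (l i \<ominus> l j) \<otimes> q \<in> P n"
      using k by (intro Padd Psm wb q) auto
    ultimately show ?case by blast
  qed
  have unit: "u j \<in> Units R" if "j \<le> i" for j
    using that
  proof (induction j)
    case (Suc j)
    then have "l i \<ominus> l j \<in> Units R" using l(2)[of i j] l(1) by (intro not_mem_maximal_Units) auto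
    then show ?case using Suc by (simp add: u_def)
  qed (simp add: u_def)
  define n where "n = N - 1"
  have nN: "Suc n = N" by (simp add: n_def N_def)
  define T where "T = (y <# P n) <+>\<^bsub>R\<^esub> (\<mm> \<cdot> P N)"
  have T: "ideal T R" "y <# P n \<subseteq> T" "\<mm> \<cdot> P N \<subseteq> T"
    unfolding T_def using set_add_upper[OF yP mP] add_ideals[OF yP mP] by auto
  interpret T: ideal T R by fact
  have yT: "y \<otimes> q \<in> T" if "q \<in> P n" for q using that T(2) unfolding l_coset_mem subset_iff by blast
  \<comment> \<open>\<open>w (Suc i)\<close> contains the factor \<open>y\<close>. As
    \<open>J i = J (Suc i)\<close>, the element \<open>w i\<close> times \<open>b^(N - i)\<close>
    then falls into \<open>T\<close> too, although \<open>w i\<close> need not contain that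
    factor.\<close>
  have "J (Suc i) \<subseteq> T" unfolding J_def
  proof (rule set_add_least[OF T(1,3)], rule subsetI)
    fix v assume "v \<in> w (Suc i) <# P (N - Suc i)"
    then obtain p where p: "p \<in> P (N - Suc i)" "v = w (Suc i) \<otimes> p" by (auto simp: l_coset_mem)
    have "v = y \<otimes> (w i \<otimes> p)"
      using p wc[of i] Pc[OF p(1)] y(2) by (simp add: w_def y_def[symmetric] m_ac)
    moreover have "w i \<otimes> p \<in> P n" using wPP[OF p(1), of i] i(1) by (simp add: n_def)
    ultimately show "v \<in> T" using yT by blast
  qed
  then have wT: "w i \<otimes> b [^] (N - i) \<in> T" using wJ[OF bP] i(2) by blast
  obtain q where q: "q \<in> P n" "w i \<otimes> b [^] (N - i) = y \<otimes> q \<oplus> u i \<otimes> b [^] N"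
    using w_mod_y[of i "N - i" n] i(1) nN by auto
  have "u i \<otimes> b [^] N = \<ominus> (y \<otimes> q) \<oplus> w i \<otimes> b [^] (N - i)"
    unfolding q(2) using uc[of i] b y(2) Pc[OF q(1)] by (simp add: r_neg2 r_neg1)
  then have "u i \<otimes> b [^] N \<in> T" using yT[OF q(1)] wT by simp
  then have bT: "b [^] N \<in> T" using mem_of_Units_mult[OF T(1) unit] b by blast
  have "P N \<subseteq> (y <# P n) <+>\<^bsub>R\<^esub> PIdl (b [^] N)" using mod_y[of n] nN by simp
  also have "\<dots> \<subseteq> T" using bT by (intro set_add_least T cgenideal_minimal)
  finally have red: "P N \<subseteq> y <# P n" using nakayama[OF yP P] unfolding T_def by blast
  \<comment> \<open>Iterating \<open>I^(n+1) \<subseteq> y I^n\<close> makes \<open>x^n\<close> a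
    common denominator for all powers of \<open>c / y\<close>, for every
    \<open>c \<in> I\<close>.\<close>
  have red': "P (n + j) \<subseteq> y [^] j <# P n" for j
  proof (induction j)
    case 0
    then show ?case using Pc by (auto simp: l_coset_mem)
  next
    case (Suc j)
    have "P (Suc (n + j)) \<subseteq> y [^] Suc j <# P n" unfolding PS
    proof (rule ideal_prod_least)
      show "ideal (y [^] Suc j <# P n) R" using y P by (intro l_coset_ideal) auto
      fix a c assume a: "a \<in> P (n + j)" and c: "c \<in> I"
      obtain q where q: "q \<in> P n" "a = y [^] j \<otimes> q" using subsetD[OF Suc a] by (auto simp: l_coset_mem)
      have "q \<otimes> c \<in> P N" using Pm[OF q(1) c] nN by simp
      then obtain q' where q': "q' \<in> P n" "q \<otimes> c = y \<otimes> q'" using subsetD[OF red] unfolding l_coset_mem by blast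
      have "a \<otimes> c = y [^] j \<otimes> (q \<otimes> c)"
        unfolding q using y q(1) Pc ideal.Icarr[OF I(1) c] by (simp add: m_assoc)
      also have "\<dots> = y [^] Suc j \<otimes> q'" unfolding q' using y q'(1) Pc by (simp add: m_assoc)
      finally show "a \<otimes> c \<in> y [^] Suc j <# P n" using q' unfolding l_coset_mem by blast
    qed
    then show ?case by simp
  qed
  have ai: "almost_integral R c y" if c: "c \<in> I" for c
    unfolding almost_integral_def
  proof (rule bexI[of _ "x [^] n"], rule allI)
    show "x [^] n \<in> nonzerodivisors R" by (rule nzd_pow[OF x(1)])
    fix j :: nat
    have "c [^] j \<otimes> x [^] n \<in> P (j + n)"
      using ideal_pow_mult_mem[OF I(1) ideal_pow_mem[OF I(1) c] xP[unfolded P_def]] unfolding P_def by blast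
    then have "c [^] j \<otimes> x [^] n \<in> y [^] j <# P n" using red'[of j] by (auto simp: add.commute)
    then show "\<exists>z\<in>carrier R. c [^] j \<otimes> x [^] n = y [^] j \<otimes> z" using Pc unfolding l_coset_mem by blast
  qed
  \<comment> \<open>\<open>y\<close> divides the nonzerodivisor \<open>x^N\<close>, which lies in
    \<open>I^N \<subseteq> y I^n\<close>.\<close>
  have "y \<in> nonzerodivisors R"
  proof -
    have "x [^] N \<in> y <# P n" using xP red by blast
    then obtain q where q: "q \<in> P n" "x [^] N = y \<otimes> q" by (auto simp: l_coset_mem)
    then show ?thesis using nzd_of_mult[OF _ y(2) Pc[OF q(1)]] nzd_pow[OF x(1)] by metis
  qed
  then show thesis using that[OF l(1)[of i]] ai[OF I(2)] ai[OF I(3)] unfolding y_def by blast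
qed

end

section \<open>Integral closure and conductor\<close>

context cring begin

lemma eval_mult_in_subring:
  assumes K: "subring K R" and q: "set q \<subseteq> K" and z: "z \<in> carrier R" and v: "v \<in> carrier R"
    and vz: "\<And>j. j < length q \<Longrightarrow> v \<otimes> z [^] j \<in> K"
  shows "v \<otimes> eval q z \<in> K"
  using q vz
proof (induction q)
  case Nil
  then show ?case using v subringE(2)[OF K] by simp
next
  case (Cons a q)
  have c: "a \<in> carrier R" "set q \<subseteq> carrier R" using Cons subringE(1)[OF K] by auto
  have "v \<otimes> eval (a # q) z = a \<otimes> (v \<otimes> z [^] length q) \<oplus> v \<otimes> eval q z"
    using c z v eval_in_carrier[OF c(2) z] by (simp add: r_distr m_ac)
  also have "\<dots> \<in> K"
  proof (rule subringE(7)[OF K])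
    show "a \<otimes> (v \<otimes> z [^] length q) \<in> K" by (rule subringE(6)[OF K]) (use Cons in auto)
    show "v \<otimes> eval q z \<in> K" using Cons by auto
  qed
  finally show ?case .
qed

text \<open>The equation has degree \<open>n = length q\<close>, the leading 1 standing in front.
  Rewriting \<open>z^n\<close> as \<open>- q(z)\<close> lowers exponents, so a multiplier that
  clears the powers below \<open>n\<close> clears all of them.\<close>

lemma monic_root_powers_in_subring:
  assumes K: "subring K R" and q: "set q \<subseteq> K" and z: "z \<in> carrier R" and u: "u \<in> carrier R"
    and root: "eval (\<one> # q) z = \<zero>"
    and uz: "\<And>i. i < length q \<Longrightarrow> u \<otimes> z [^] i \<in> K"
  shows "u \<otimes> z [^] (i::nat) \<in> K"
proof (induction i rule: less_induct)
  case (less i)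
  show ?case
  proof (cases "i < length q")
    case False
    define n where "n = length q"
    have n: "n \<le> i" using False by (simp add: n_def)
    have ec: "eval q z \<in> carrier R" using q z subringE(1)[OF K] by (intro eval_in_carrier) auto
    have "z [^] n \<oplus> eval q z = \<zero>" using root z by (simp add: n_def)
    then have zn: "z [^] n = \<ominus> eval q z" using z ec by (simp add: minus_equality minus_minus)
    have "u \<otimes> z [^] i = (u \<otimes> z [^] (i - n)) \<otimes> z [^] n"
      using u z n by (simp add: m_assoc nat_pow_mult)
    also have "\<dots> = \<ominus> ((u \<otimes> z [^] (i - n)) \<otimes> eval q z)" unfolding zn using u z ec by (simp add: r_minus)
    also have "\<dots> \<in> K"
    proof (intro subringE(5)[OF K] eval_mult_in_subring[OF K q z])
      fix j assume "j < length q"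
      then have "u \<otimes> z [^] (i - n + j) \<in> K" using n by (intro less) (auto simp: n_def)
      then show "u \<otimes> z [^] (i - n) \<otimes> z [^] j \<in> K" using u z by (simp add: m_assoc nat_pow_mult)
    qed (use u z in auto)
    finally show ?thesis .
  qed (use uz in auto)
qed

lemma eval_map_minus:
  assumes "set q \<subseteq> carrier R" "z \<in> carrier R"
  shows "eval (map (\<lambda>a. \<ominus> a) q) z = \<ominus> eval q z"
  using assms
proof (induction q)
  case (Cons a q)
  then show ?case using eval_in_carrier[of q z] by (simp add: l_minus minus_add)
qed simp

section \<open>Fractions, integrality and almost integrality\<close>

lemma frac_embed_closed: "a \<in> carrier R \<Longrightarrow> frac_embed R a \<in> carrier (total_frac_ring R)"
  using frac_embed_hom(1) ring_hom_closed by metis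

lemma ring_hom_cring_frac_embed: "ring_hom_cring R (total_frac_ring R) (frac_embed R)"
  using total_frac_ring_cring frac_embed_hom(1) is_cring
  by (simp add: ring_hom_cring_def ring_hom_cring_axioms_def)

lemma subring_frac_embed: "subring (frac_embed R ` carrier R) (total_frac_ring R)"
proof -
  interpret h: ring_hom_cring R "total_frac_ring R" "frac_embed R" by (rule ring_hom_cring_frac_embed)
  show ?thesis using h.ring.img_is_subring[OF carrier_is_subring] by simp
qed

lemma frac_embed_inject: "a \<in> carrier R \<Longrightarrow> b \<in> carrier R \<Longrightarrow> frac_embed R a = frac_embed R b \<longleftrightarrow> a = b"
  using frac_embed_hom(2) by (auto simp: inj_on_def)

lemma fraction_pow_mult_embed:
  assumes b: "b \<in> carrier R" and x: "x \<in> nonzerodivisors R"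
  shows "fraction R b x [^]\<^bsub>total_frac_ring R\<^esub> (i::nat) \<otimes>\<^bsub>total_frac_ring R\<^esub> frac_embed R (x [^] i) = frac_embed R (b [^] i)"
proof -
  interpret h: ring_hom_cring R "total_frac_ring R" "frac_embed R" by (rule ring_hom_cring_frac_embed)
  have xc: "x \<in> carrier R" using x nzd_closed by auto
  have "fraction R b x \<in> carrier (total_frac_ring R)" using b x frac_in by auto
  then have "fraction R b x [^]\<^bsub>total_frac_ring R\<^esub> i \<otimes>\<^bsub>total_frac_ring R\<^esub> frac_embed R (x [^] i) =
      (fraction R b x \<otimes>\<^bsub>total_frac_ring R\<^esub> frac_embed R x) [^]\<^bsub>total_frac_ring R\<^esub> i"
    using xc by (simp add: h.S.nat_pow_distrib)
  then show ?thesis using nzd_unit(2)[OF x b] b by simp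
qed

lemma frac_embed_cancel:
  assumes "s \<in> nonzerodivisors R" "u \<in> carrier (total_frac_ring R)" "v \<in> carrier (total_frac_ring R)"
    "u \<otimes>\<^bsub>total_frac_ring R\<^esub> frac_embed R s = v \<otimes>\<^bsub>total_frac_ring R\<^esub> frac_embed R s"
  shows "u = v"
proof -
  interpret Q: cring "total_frac_ring R" by (rule total_frac_ring_cring)
  have c: "frac_embed R s \<in> carrier (total_frac_ring R)" using assms frac_embed_closed nzd_closed by auto
  show ?thesis using assms c nzd_unit(1)[OF assms(1)] Q.Units_l_cancel Q.m_comm by metis
qed

text \<open>For a monic equation of degree \<open>n\<close> the element \<open>x^n\<close> clears
  the powers of \<open>b / x\<close> below \<open>n\<close>, hence all powers.\<close>

lemma almost_integral_of_integral:
  assumes b: "b \<in> carrier R" and x: "x \<in> nonzerodivisors R" and int: "fraction R b x \<in> integral_closure R"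
  shows "almost_integral R b x"
proof -
  let ?Q = "total_frac_ring R" and ?e = "frac_embed R"
  interpret h: ring_hom_cring R ?Q ?e by (rule ring_hom_cring_frac_embed)
  have xc: "x \<in> carrier R" using x nzd_closed by auto
  define z where "z = fraction R b x"
  have z: "z \<in> carrier ?Q" unfolding z_def using b x frac_in by auto
  obtain p where p: "polynomial\<^bsub>?Q\<^esub> (?e ` carrier R) p" "p \<noteq> []" "hd p = \<one>\<^bsub>?Q\<^esub>" "h.S.eval p z = \<zero>\<^bsub>?Q\<^esub>"
    using int unfolding integral_closure_def integral_closure_in_def z_def by blast
  then obtain q where q: "p = \<one>\<^bsub>?Q\<^esub> # q" "set q \<subseteq> ?e ` carrier R"
    by (cases p) (auto simp: polynomial_def)
  define n where "n = length q"
  have zx: "z [^]\<^bsub>?Q\<^esub> i \<otimes>\<^bsub>?Q\<^esub> ?e (x [^] i) = ?e (b [^] i)" for i :: nat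
    unfolding z_def by (rule fraction_pow_mult_embed[OF b x])
  have mem: "?e (x [^] n) \<otimes>\<^bsub>?Q\<^esub> z [^]\<^bsub>?Q\<^esub> i \<in> ?e ` carrier R" for i :: nat
  proof (rule h.S.monic_root_powers_in_subring[OF subring_frac_embed q(2) z])
    fix i assume "i < length q"
    then have "x [^] n = x [^] i \<otimes> x [^] (n - i)" using xc by (simp add: nat_pow_mult n_def)
    then have "?e (x [^] n) \<otimes>\<^bsub>?Q\<^esub> z [^]\<^bsub>?Q\<^esub> i = (z [^]\<^bsub>?Q\<^esub> i \<otimes>\<^bsub>?Q\<^esub> ?e (x [^] i)) \<otimes>\<^bsub>?Q\<^esub> ?e (x [^] (n - i))"
      using xc z by (simp add: h.S.m_ac)
    also have "\<dots> = ?e (b [^] i \<otimes> x [^] (n - i))" unfolding zx using b xc by simp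
    finally show "?e (x [^] n) \<otimes>\<^bsub>?Q\<^esub> z [^]\<^bsub>?Q\<^esub> i \<in> ?e ` carrier R"
      using b xc by (intro image_eqI[of _ ?e "b [^] i \<otimes> x [^] (n - i)"]) auto
  qed (use p q xc in auto)
  show ?thesis unfolding almost_integral_def
  proof (rule bexI[of _ "x [^] n"], rule allI)
    fix i :: nat
    obtain y where y: "y \<in> carrier R" "?e (x [^] n) \<otimes>\<^bsub>?Q\<^esub> z [^]\<^bsub>?Q\<^esub> i = ?e y" using mem[of i] by blast
    have "?e (b [^] i \<otimes> x [^] n) = (?e (x [^] n) \<otimes>\<^bsub>?Q\<^esub> z [^]\<^bsub>?Q\<^esub> i) \<otimes>\<^bsub>?Q\<^esub> ?e (x [^] i)"
      using b xc z zx[of i, symmetric] by (simp add: h.S.m_ac)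
    also have "\<dots> = ?e (x [^] i \<otimes> y)" unfolding y using y(1) xc by (simp add: h.S.m_comm)
    finally have "b [^] i \<otimes> x [^] n = x [^] i \<otimes> y" using b xc y(1) by (simp add: frac_embed_inject del: h.hom_mult)
    then show "\<exists>y\<in>carrier R. b [^] i \<otimes> x [^] n = x [^] i \<otimes> y" using y by blast
  qed (rule nzd_pow[OF x])
qed

end

context noetherian_local_ring begin

text \<open>With a common denominator \<open>d\<close>, the elements \<open>y i = d z^i\<close> of
  \<open>R\<close> generate an increasing sequence of ideals. Where it becomes stationary,
  \<open>d z^n\<close> is a combination of the earlier \<open>d z^i\<close>, and cancelling
  \<open>d\<close> leaves a monic equation for \<open>z\<close>.\<close>

lemma integral_of_almost_integral:
  assumes b: "b \<in> carrier R" and x: "x \<in> nonzerodivisors R" and ai: "almost_integral R b x"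
  shows "fraction R b x \<in> integral_closure R"
proof -
  let ?Q = "total_frac_ring R" and ?e = "frac_embed R"
  interpret h: ring_hom_cring R ?Q ?e by (rule ring_hom_cring_frac_embed)
  have K: "subring (?e ` carrier R) ?Q" by (rule subring_frac_embed)
  have xc: "x \<in> carrier R" using x nzd_closed by auto
  define z where "z = fraction R b x"
  have z: "z \<in> carrier ?Q" unfolding z_def using b x frac_in by auto
  obtain d where d: "d \<in> nonzerodivisors R"
    and "\<forall>i::nat. \<exists>y. y \<in> carrier R \<and> b [^] i \<otimes> d = x [^] i \<otimes> y"
    using ai unfolding almost_integral_def Bex_def by (elim exE conjE)
  then obtain y where y: "\<And>i::nat. y i \<in> carrier R" "\<And>i::nat. b [^] i \<otimes> d = x [^] i \<otimes> y i"
    by (auto dest!: choice)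
  have dc: "d \<in> carrier R" using d nzd_closed by auto
  have ez: "?e d \<otimes>\<^bsub>?Q\<^esub> z [^]\<^bsub>?Q\<^esub> i = ?e (y i)" for i :: nat
  proof (rule frac_embed_cancel[OF nzd_pow[OF x, of i]])
    have "?e d \<otimes>\<^bsub>?Q\<^esub> z [^]\<^bsub>?Q\<^esub> i \<otimes>\<^bsub>?Q\<^esub> ?e (x [^] i) = ?e (b [^] i \<otimes> d)"
      using fraction_pow_mult_embed[OF b x, of i] b dc xc z by (simp add: z_def[symmetric] h.S.m_ac)
    also have "\<dots> = ?e (y i) \<otimes>\<^bsub>?Q\<^esub> ?e (x [^] i)" unfolding y(2) using y(1) xc by (simp add: h.S.m_comm)
    finally show "?e d \<otimes>\<^bsub>?Q\<^esub> z [^]\<^bsub>?Q\<^esub> i \<otimes>\<^bsub>?Q\<^esub> ?e (x [^] i) = ?e (y i) \<otimes>\<^bsub>?Q\<^esub> ?e (x [^] i)" .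
  qed (use z dc y(1) in auto)
  define J where "J = rec_nat {\<zero>} (\<lambda>n J. J <+>\<^bsub>R\<^esub> PIdl (y n))"
  have J0: "J 0 = {\<zero>}" and JS: "J (Suc n) = J n <+>\<^bsub>R\<^esub> PIdl (y n)" for n by (auto simp: J_def)
  have J: "ideal (J n) R" for n
    by (induction n) (auto simp: J0 JS zeroideal set_add_cgenideal(1)[OF _ y(1)])
  have Jmono: "J n \<subseteq> J (Suc n)" and yJ: "y n \<in> J (Suc n)" for n
    unfolding JS using set_add_cgenideal(2,3)[OF J y(1)] by auto
  \<comment> \<open>The length of the coefficient list records that the degree in \<open>z\<close>
    stays below \<open>n\<close>; leading zeros are allowed, so the length is exact.\<close>
  have J_eval: "\<exists>q. set q \<subseteq> ?e ` carrier R \<and> length q = n \<and> ?e r = ?e d \<otimes>\<^bsub>?Q\<^esub> h.S.eval q z" if "r \<in> J n" for n r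
    using that
  proof (induction n arbitrary: r)
    case 0
    then show ?case using dc by (auto simp: J0)
  next
    case (Suc n)
    then obtain i t where it: "i \<in> J n" "t \<in> carrier R" "r = i \<oplus> t \<otimes> y n"
      unfolding JS set_add_cgenideal(4)[OF J y(1)] by blast
    obtain q where q: "set q \<subseteq> ?e ` carrier R" "length q = n" "?e i = ?e d \<otimes>\<^bsub>?Q\<^esub> h.S.eval q z"
      using Suc.IH[OF it(1)] by blast
    have qc: "set q \<subseteq> carrier ?Q" using q(1) subringE(1)[OF K] by auto
    have ec: "h.S.eval q z \<in> carrier ?Q" by (rule h.S.eval_in_carrier[OF qc z])
    have ic: "i \<in> carrier R" using it ideal.Icarr[OF J] by blast
    have "?e r = ?e d \<otimes>\<^bsub>?Q\<^esub> h.S.eval q z \<oplus>\<^bsub>?Q\<^esub> ?e t \<otimes>\<^bsub>?Q\<^esub> (?e d \<otimes>\<^bsub>?Q\<^esub> z [^]\<^bsub>?Q\<^esub> n)"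
      unfolding it(3) ez q(3)[symmetric] using ic it(2) y(1) by simp
    also have "\<dots> = ?e d \<otimes>\<^bsub>?Q\<^esub> h.S.eval (?e t # q) z"
      using q(2) it(2) dc z ec by (simp add: h.S.r_distr h.S.m_ac h.S.a_comm)
    finally show ?case using q it(2) by (intro exI[of _ "?e t # q"]) auto
  qed
  have Jle: "J m \<subseteq> J n" if "m \<le> n" for m n
    using that Jmono by (rule lift_Suc_mono_le[rotated])
  have "subset.chain {I. ideal I R} (range J)"
    unfolding subset_chain_def
  proof (intro conjI ballI)
    fix A B assume "A \<in> range J" "B \<in> range J"
    then obtain m n where "A = J m" "B = J n" by blast
    then show "A \<subseteq> B \<or> B \<subseteq> A" using Jle[of m n] Jle[of n m] nat_le_linear[of m n] by blast
  qed (use J in auto)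
  then have "\<Union>(range J) \<in> range J" using ideal_chain_is_trivial by blast
  then obtain n where n: "\<Union>(range J) = J n" by blast
  have "y n \<in> J n" using yJ[of n] n by blast
  then obtain q where q: "set q \<subseteq> ?e ` carrier R" "length q = n" "?e (y n) = ?e d \<otimes>\<^bsub>?Q\<^esub> h.S.eval q z"
    using J_eval by blast
  have qc: "set q \<subseteq> carrier ?Q" using q(1) subringE(1)[OF K] by auto
  have ec: "h.S.eval q z \<in> carrier ?Q" by (rule h.S.eval_in_carrier[OF qc z])
  have zn: "z [^]\<^bsub>?Q\<^esub> n = h.S.eval q z"
  proof (rule frac_embed_cancel[OF d _ ec])
    have "z [^]\<^bsub>?Q\<^esub> n \<otimes>\<^bsub>?Q\<^esub> ?e d = ?e d \<otimes>\<^bsub>?Q\<^esub> z [^]\<^bsub>?Q\<^esub> n"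
      by (rule h.S.m_comm) (use z dc in auto)
    also have "\<dots> = ?e d \<otimes>\<^bsub>?Q\<^esub> h.S.eval q z" unfolding ez q(3) ..
    also have "\<dots> = h.S.eval q z \<otimes>\<^bsub>?Q\<^esub> ?e d" by (rule h.S.m_comm) (use ec dc in auto)
    finally show "z [^]\<^bsub>?Q\<^esub> n \<otimes>\<^bsub>?Q\<^esub> ?e d = h.S.eval q z \<otimes>\<^bsub>?Q\<^esub> ?e d" .
  qed (use z in auto)
  define p where "p = \<one>\<^bsub>?Q\<^esub> # map (\<lambda>a. \<ominus>\<^bsub>?Q\<^esub> a) q"
  \<comment> \<open>\<open>polynomial\<close> demands a nonzero leading coefficient, here the 1 of
    the fraction ring.\<close>
  have "\<one> \<noteq> \<zero>" using one_not_mem zero_closed a_subset additive_subgroup.zero_closed[OF ideal.axioms(1)[OF maximal_is_ideal]] by metis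
  then have one: "\<one>\<^bsub>?Q\<^esub> \<noteq> \<zero>\<^bsub>?Q\<^esub>" using frac_embed_inject[of \<one> \<zero>] by simp
  have "set p \<subseteq> ?e ` carrier R"
    using q(1) subringE(3,5)[OF K] by (auto simp: p_def)
  then have "polynomial\<^bsub>?Q\<^esub> (?e ` carrier R) p" using one by (simp add: polynomial_def p_def)
  moreover have "h.S.eval p z = \<zero>\<^bsub>?Q\<^esub>"
    using h.S.eval_map_minus[OF qc z] q(2) zn z ec by (simp add: p_def h.S.r_neg)
  moreover have "p \<noteq> []" "hd p = \<one>\<^bsub>?Q\<^esub>" by (auto simp: p_def)
  ultimately show ?thesis
    unfolding integral_closure_def integral_closure_in_def z_def[symmetric] using z by blast
qed

text \<open>The integral closure consists of the almost integral fractions \<open>b / x\<close>, so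
  membership in the conductor can be tested inside \<open>R\<close>. From here on the total ring of
  fractions no longer occurs.\<close>

lemma conductor_ideal_iff:
  "r \<in> conductor_ideal R \<longleftrightarrow> r \<in> carrier R \<and> (\<forall>b\<in>carrier R. \<forall>x\<in>nonzerodivisors R.
     almost_integral R b x \<longrightarrow> (\<exists>y\<in>carrier R. r \<otimes> b = x \<otimes> y))"
proof -
  let ?Q = "total_frac_ring R" and ?e = "frac_embed R"
  have *: "?e r \<otimes>\<^bsub>?Q\<^esub> fraction R b x \<in> ?e ` carrier R \<longleftrightarrow> (\<exists>y\<in>carrier R. r \<otimes> b = x \<otimes> y)"
    if r: "r \<in> carrier R" and b: "b \<in> carrier R" and x: "x \<in> nonzerodivisors R" for b x
  proof -
    have xc: "x \<in> carrier R" using x nzd_closed by auto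
    have "?e r \<otimes>\<^bsub>?Q\<^esub> fraction R b x = fraction R (r \<otimes> b) x"
      using r b x xc by (simp add: frac_embed_def mult_frac nzd_one)
    moreover have "fraction R (r \<otimes> b) x = ?e y \<longleftrightarrow> r \<otimes> b = x \<otimes> y" if y: "y \<in> carrier R" for y
    proof
      assume "fraction R (r \<otimes> b) x = ?e y"
      then have "r \<otimes> b \<otimes> \<one> = y \<otimes> x"
        unfolding frac_embed_def using r b x y by (intro fraction_eqD nzd_one) auto
      then show "r \<otimes> b = x \<otimes> y" using r b xc y by (simp add: m_comm)
    next
      assume "r \<otimes> b = x \<otimes> y"
      then show "fraction R (r \<otimes> b) x = ?e y"
        unfolding frac_embed_def using r b x xc y by (intro fraction_eqI nzd_one) (auto simp: m_comm)
    qed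
    ultimately show ?thesis by (simp add: image_iff)
  qed
  have int: "w \<in> integral_closure R \<longleftrightarrow>
      (\<exists>b\<in>carrier R. \<exists>x\<in>nonzerodivisors R. w = fraction R b x \<and> almost_integral R b x)" for w
  proof
    assume w: "w \<in> integral_closure R"
    then have "w \<in> carrier ?Q" by (simp add: integral_closure_def integral_closure_in_def)
    then obtain b x where "b \<in> carrier R" "x \<in> nonzerodivisors R" "w = fraction R b x" by (rule frac_cases)
    then show "\<exists>b\<in>carrier R. \<exists>x\<in>nonzerodivisors R. w = fraction R b x \<and> almost_integral R b x"
      using w almost_integral_of_integral by blast
  qed (use integral_of_almost_integral in blast)
  show ?thesis
  proof (intro iffI conjI ballI impI)
    assume r: "r \<in> conductor_ideal R"
    then show rc: "r \<in> carrier R" by (simp add: conductor_ideal_def)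
    fix b x assume h: "b \<in> carrier R" "x \<in> nonzerodivisors R" "almost_integral R b x"
    then have "fraction R b x \<in> integral_closure R" using int by blast
    then have "?e r \<otimes>\<^bsub>?Q\<^esub> fraction R b x \<in> ?e ` carrier R"
      using r by (simp add: conductor_ideal_def conductor_def)
    then show "\<exists>y\<in>carrier R. r \<otimes> b = x \<otimes> y" using *[OF rc h(1,2)] by simp
  next
    assume r: "r \<in> carrier R \<and> (\<forall>b\<in>carrier R. \<forall>x\<in>nonzerodivisors R.
      almost_integral R b x \<longrightarrow> (\<exists>y\<in>carrier R. r \<otimes> b = x \<otimes> y))"
    have "?e r \<otimes>\<^bsub>?Q\<^esub> w \<in> ?e ` carrier R" if w: "w \<in> integral_closure R" for w
    proof -
      obtain b x where h: "b \<in> carrier R" "x \<in> nonzerodivisors R" "w = fraction R b x" "almost_integral R b x"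
        using w int by blast
      then show ?thesis using *[OF _ h(1,2)] r by simp
    qed
    then show "r \<in> conductor_ideal R"
      using r frac_embed_closed by (simp add: conductor_ideal_def conductor_def)
  qed
qed

text \<open>The conductor is an ideal of the integral closure: \<open>y\<close> is \<open>r\<close> times the integral fraction \<open>b / t\<close>.\<close>

lemma conductor_ideal_closed:
  assumes r: "r \<in> conductor_ideal R" and b: "b \<in> carrier R" and t: "t \<in> nonzerodivisors R"
    and ai: "almost_integral R b t" and y: "y \<in> carrier R" "r \<otimes> b = t \<otimes> y"
  shows "y \<in> conductor_ideal R"
  unfolding conductor_ideal_iff
proof (intro conjI ballI impI y)
  fix b' t' assume h: "b' \<in> carrier R" "t' \<in> nonzerodivisors R" "almost_integral R b' t'"
  have c: "r \<in> carrier R" "t \<in> carrier R" "t' \<in> carrier R"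
    using r t h nzd_closed conductor_ideal_iff by auto
  \<comment> \<open>The product of \<open>b / t\<close> and \<open>b' / t'\<close> is again almost
    integral, so \<open>r\<close> clears it in one stroke; cancelling \<open>t\<close> leaves the
    claim for \<open>y\<close>.\<close>
  have "almost_integral R (b \<otimes> b') (t \<otimes> t')" using ai h b c by (intro almost_integral_mult) auto
  then obtain v where v: "v \<in> carrier R" "r \<otimes> (b \<otimes> b') = t \<otimes> t' \<otimes> v"
    
    using r[unfolded conductor_ideal_iff] nzd_mult[OF t h(2)] m_closed[OF b h(1)] by blast
  have "t \<otimes> (y \<otimes> b') = (r \<otimes> b) \<otimes> b'" unfolding y(2) using y(1) c h by (simp add: m_ac)
  also have "\<dots> = t \<otimes> (t' \<otimes> v)" using v c b h by (simp add: m_ac)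
  finally have "y \<otimes> b' = t' \<otimes> v" using nzd_cancel[OF t] y(1) h c v(1) by simp
  then show "\<exists>z\<in>carrier R. y \<otimes> b' = t' \<otimes> z" using v by blast
qed

section \<open>The square of the conductor\<close>

lemma exists_integral_denominator:
  assumes dim: "krull_dim R = 1" and inf: "infinite (carrier (R Quot \<mm>))"
    and I: "ideal I R" "I \<subseteq> \<mm>" and s: "s \<in> I" "s \<in> nonzerodivisors R"
  obtains x where "x \<in> I" "x \<in> nonzerodivisors R" "\<And>a. a \<in> I \<Longrightarrow> almost_integral R a x"
proof -
  interpret I: ideal I R by fact
  obtain A where A: "A \<subseteq> carrier R" "finite A" "I = Idl A" using finetely_gen[OF I(1)] by blast
  have AI: "A \<subseteq> I" using genideal_self[OF A(1)] A(3) by simp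
  have "\<exists>x\<in>I. x \<in> nonzerodivisors R \<and> (\<forall>a\<in>A. almost_integral R a x)"
    using A(2) AI
  proof (induction)
    case empty
    then show ?case using s by auto
  next
    case (insert b A)
    then obtain x where x: "x \<in> I" "x \<in> nonzerodivisors R" "\<And>a. a \<in> A \<Longrightarrow> almost_integral R a x" by auto
    have bI: "b \<in> I" and bc: "b \<in> carrier R" using insert I.Icarr by auto
    have xm: "x \<in> \<mm>" using x I by auto
    obtain r where r: "r \<in> carrier R" "x \<ominus> r \<otimes> b \<in> nonzerodivisors R"
      "almost_integral R x (x \<ominus> r \<otimes> b)" "almost_integral R b (x \<ominus> r \<otimes> b)"
      by (rule exists_reduction_two_generators[OF dim inf x(2) xm bc])
    have "x \<ominus> r \<otimes> b \<in> I" using r x bI by (simp add: minus_eq I.I_l_closed)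
    \<comment> \<open>Transitivity through \<open>x\<close> keeps the generators treated earlier
      integral over the new denominator \<open>x - r b\<close>.\<close>
    moreover have "almost_integral R a (x \<ominus> r \<otimes> b)" if "a \<in> insert b A" for a
    proof (cases "a = b")
      case False
      then have a: "a \<in> A" "a \<in> carrier R" using that insert I.Icarr by auto
      show ?thesis
        using almost_integral_trans[OF x(3)[OF a(1)] r(3) a(2)] x(2) r(2) nzd_closed by blast
    qed (use r in simp)
    ultimately show ?case using r(2) by blast
  qed
  then obtain x where x: "x \<in> I" "x \<in> nonzerodivisors R" "\<And>a. a \<in> A \<Longrightarrow> almost_integral R a x" by blast
  have "Idl A \<subseteq> {a \<in> carrier R. almost_integral R a x}"
    using x nzd_closed A by (intro genideal_minimal ideal_almost_integral) auto
  then show thesis using that x A(3) by blast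
qed

lemma conductor_square:
  assumes c: "ideal (conductor_ideal R) R" and x: "x \<in> conductor_ideal R" "x \<in> nonzerodivisors R"
    and ai: "\<And>a. a \<in> conductor_ideal R \<Longrightarrow> almost_integral R a x"
  shows "conductor_ideal R \<cdot> conductor_ideal R = x <# conductor_ideal R"
proof
  interpret c: ideal "conductor_ideal R" R by (rule c)
  have xc: "x \<in> carrier R" using x nzd_closed by auto
  show "x <# conductor_ideal R \<subseteq> conductor_ideal R \<cdot> conductor_ideal R"
    using ideal_prod_mem[OF x(1)] unfolding l_coset_mem subset_iff by metis
  show "conductor_ideal R \<cdot> conductor_ideal R \<subseteq> x <# conductor_ideal R"
  proof (rule ideal_prod_least[OF l_coset_ideal[OF xc c]])
    fix r a assume ra: "r \<in> conductor_ideal R" "a \<in> conductor_ideal R"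
    then obtain y where y: "y \<in> carrier R" "r \<otimes> a = x \<otimes> y"
      using ra(1)[unfolded conductor_ideal_iff] ai[OF ra(2)] x(2) c.Icarr[OF ra(2)] by blast
    then have "y \<in> conductor_ideal R"
      using conductor_ideal_closed[OF ra(1) c.Icarr[OF ra(2)] x(2) ai[OF ra(2)]] by blast
    then show "r \<otimes> a \<in> x <# conductor_ideal R" using y unfolding l_coset_mem by blast
  qed
qed

text \<open>The conductor is closed under multiplication by an integral fraction \<open>w\<close>.
  If it is \<open>x R\<close>, then \<open>x w \<in> x R\<close>, hence \<open>w \<in> R\<close>:
  the ring is integrally closed.\<close>

lemma conductor_not_principal:
  assumes x: "x \<in> nonzerodivisors R" and c: "conductor_ideal R = PIdl x"
  shows "\<one> \<in> conductor_ideal R"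
  unfolding conductor_ideal_iff
proof (intro conjI ballI impI one_closed)
  fix b t assume h: "b \<in> carrier R" "t \<in> nonzerodivisors R" "almost_integral R b t"
  have k: "x \<in> carrier R" "t \<in> carrier R" using x h nzd_closed by auto
  have xI: "x \<in> conductor_ideal R" using c cgenideal_self k by simp
  then obtain y where y: "y \<in> carrier R" "x \<otimes> b = t \<otimes> y" using h conductor_ideal_iff by blast
  then have "y \<in> PIdl x" using conductor_ideal_closed[OF xI h y] c by simp
  then obtain v where v: "v \<in> carrier R" "y = v \<otimes> x" by (auto simp: cgenideal_mem)
  have "x \<otimes> b = x \<otimes> (t \<otimes> v)" unfolding y v(2) using v(1) k by (simp add: m_ac)
  then have "b = t \<otimes> v" using nzd_cancel[OF x] h k v by simp
  then show "\<exists>z\<in>carrier R. \<one> \<otimes> b = t \<otimes> z" using v h by auto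
qed

end

section \<open>Numbers of generators and the multiplicity of the conductor\<close>

context noetherian_local_ring begin

lemma maximal_prod: "ideal L R \<Longrightarrow> ideal (\<mm> \<cdot> L) R" "ideal L R \<Longrightarrow> \<mm> \<cdot> L \<subseteq> L"
  using ideal_prod_is_ideal[OF maximal_is_ideal, of L] ideal_prod_inter[OF maximal_is_ideal, of L] by auto

text \<open>\<open>J / K\<close> is generated by \<open>\<ell>(J / (K + \<mm> J))\<close> elements, each annihilated by \<open>C\<close>.\<close>

lemma ideal_length_le_generators:
  assumes C: "ideal C R" "ideal_length R C (carrier R) = enat B"
    and J: "ideal J R" and K: "ideal K R" "K \<subseteq> J"
    and CJ: "\<And>c j. c \<in> C \<Longrightarrow> j \<in> J \<Longrightarrow> c \<otimes> j \<in> K"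
    and n: "ideal_length R (K <+>\<^bsub>R\<^esub> (\<mm> \<cdot> J)) J = enat n"
  shows "ideal_length R K J \<le> enat (n * B)"
  using K CJ n
proof (induction n arbitrary: K rule: less_induct)
  case (less n)
  note K = less.prems(1,2)
  note mJ = maximal_prod[OF J]
  \<comment> \<open>The length of \<open>J / T K\<close> counts the generators of \<open>J\<close>
    still missing modulo \<open>K\<close>.\<close>
  define T where "T = (\<lambda>K. K <+>\<^bsub>R\<^esub> (\<mm> \<cdot> J))"
  have T: "ideal (T K) R" "K \<subseteq> T K" "\<mm> \<cdot> J \<subseteq> T K" if "ideal K R" for K
    unfolding T_def using set_add_upper[OF that mJ(1)] add_ideals[OF that mJ(1)] by auto
  have TJ: "T K \<subseteq> J" if "ideal K R" "K \<subseteq> J" for K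
    unfolding T_def by (rule set_add_least[OF J that(2) mJ(2)])
  show ?case
  proof (cases "T K = J")
    case True
    then have "J \<subseteq> K" using nakayama[OF K(1) J] by (simp add: T_def)
    then have "K = J" using K by auto
    then show ?thesis using ideal_length_self[OF J] by (simp add: zero_enat_def)
  next
    case False
    then obtain z where z: "z \<in> J" "z \<notin> T K" using TJ[OF K] by auto
    have zc: "z \<in> carrier R" using z ideal.Icarr[OF J] by blast
    define K' where "K' = K <+>\<^bsub>R\<^esub> PIdl z"
    note s = set_add_cgenideal[OF K(1) zc, folded K'_def]
    have K': "ideal K' R" "K \<subseteq> K'" "z \<in> K'" "K' \<subseteq> J" using s(1-3) s(5)[OF J K(2) z(1)] by auto
    have "T K \<subseteq> T K'" unfolding T_def[of]
      by (rule set_add_least[OF T(1)[OF K'(1), unfolded T_def]])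
        (use T(2,3)[OF K'(1)] K'(2) in \<open>auto simp: T_def\<close>)
    then have T_less: "T K \<subset> T K'" using T(2)[OF K'(1)] K'(3) z by blast
    have "enat n = ideal_length R (T K) (T K') + ideal_length R (T K') J"
      using ideal_length_add[OF T(1)[OF K(1)] T(1)[OF K'(1)] J] T_less TJ[OF K'(1,4)] less.prems(4)
      by (simp add: T_def)
    moreover have "1 \<le> ideal_length R (T K) (T K')"
      using ideal_length_pos[OF T(1)[OF K(1)] T(1)[OF K'(1)] T_less] .
    ultimately obtain n' where n': "ideal_length R (T K') J = enat n'" "n' < n"
      by (cases "ideal_length R (T K) (T K')"; cases "ideal_length R (T K') J") (auto simp: one_enat_def)
    have "ideal_length R K' J \<le> enat (n' * B)"
      using less.IH[OF n'(2) K'(1,4)] less.prems(3) K'(2) n'(1) by (auto simp: T_def)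
    \<comment> \<open>\<open>K' / K\<close> is cyclic and annihilated by \<open>C\<close>, hence an
      image of \<open>R / C\<close>.\<close>
    moreover have "ideal_length R K K' \<le> enat B"
      unfolding C(2)[symmetric]
    proof (rule ideal_length_colon[OF K(1) K'(1) oneideal C(1) _ K'(2) zc])
      show "C \<subseteq> carrier R" using ideal.Icarr[OF C(1)] by blast
      show "\<exists>i\<in>K. \<exists>a\<in>carrier R. y = i \<oplus> a \<otimes> z" if "y \<in> K'" for y using that s(4) by blast
      show "k \<otimes> z \<in> K" if "k \<in> C" for k by (rule less.prems(3)[OF that z(1)])
    qed
    moreover have "ideal_length R K J = ideal_length R K K' + ideal_length R K' J"
      by (rule ideal_length_add[OF K(1) K'(1) J K'(2,4)])
    ultimately have "ideal_length R K J \<le> enat B + enat (n' * B)" by (metis add_mono)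
    also have "\<dots> \<le> enat (n * B)" using n'(2) mult_le_mono1[of "Suc n'" n B] by simp
    finally show ?thesis .
  qed
qed

text \<open>The length of \<open>L / \<mm> L\<close> is the minimal number of generators of
  \<open>L\<close>. Adding 1, the length of \<open>J / L\<close>, gives the length of
  \<open>J / \<mm> L\<close>, which splits at \<open>\<mm> J\<close>. As
  \<open>\<mm> J = \<mm> L + \<mm> z\<close> and \<open>\<mm> \<mm> z \<subseteq> \<mm> L\<close>,
  the piece \<open>\<mm> J / \<mm> L\<close> is an image of
  \<open>\<mm> / \<mm> \<mm>\<close>.\<close>

lemma generators_subideal:
  assumes L: "ideal L R" and J: "ideal J R" and z: "z \<in> J" "z \<notin> L"
    and gen: "J = L <+>\<^bsub>R\<^esub> PIdl z" and mJ: "\<And>a y. a \<in> \<mm> \<Longrightarrow> y \<in> J \<Longrightarrow> a \<otimes> y \<in> L"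
  shows "ideal_length R (\<mm> \<cdot> L) L + 1 \<le> ideal_length R (\<mm> \<cdot> J) J + ideal_length R (\<mm> \<cdot> \<mm>) \<mm>"
proof -
  interpret L: ideal L R by fact
  have zc: "z \<in> carrier R" using z ideal.Icarr[OF J] by blast
  note s = set_add_cgenideal[OF L zc, folded gen]
  note mL = maximal_prod[OF L] and mJ' = maximal_prod[OF J] and mm = maximal_prod[OF maximal_is_ideal]
  have mLJ: "\<mm> \<cdot> L \<subseteq> \<mm> \<cdot> J" using s(2) by (intro ideal_prod_least[OF mJ'(1)] ideal_prod_mem) auto
  have 1: "ideal_length R L J = 1"
    using ideal_length_simple[OF L zc z(2)] mJ z(1) gen by simp
  have zm: "ideal (z <# \<mm>) R" by (rule l_coset_ideal[OF zc maximal_is_ideal])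
  have "\<mm> \<cdot> J \<subseteq> (\<mm> \<cdot> L) <+>\<^bsub>R\<^esub> (z <# \<mm>)"
  proof (rule ideal_prod_least[OF add_ideals[OF mL(1) zm]])
    fix a y assume a: "a \<in> \<mm>" and "y \<in> J"
    then obtain i r where ir: "i \<in> L" "r \<in> carrier R" "y = i \<oplus> r \<otimes> z" using s(4) by blast
    have k: "a \<in> carrier R" "i \<in> carrier R" using a ir L.Icarr Icarr by auto
    have "a \<otimes> y = a \<otimes> i \<oplus> z \<otimes> (r \<otimes> a)" unfolding ir(3) using k ir(2) zc by algebra
    moreover have "z \<otimes> (r \<otimes> a) \<in> z <# \<mm>" using I_l_closed[OF a ir(2)] unfolding l_coset_mem by blast
    ultimately show "a \<otimes> y \<in> (\<mm> \<cdot> L) <+>\<^bsub>R\<^esub> (z <# \<mm>)"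
      using ideal_prod_mem[OF a ir(1)] unfolding set_add_mem_iff by blast
  qed
  note mJ_gen = this
  have y: "\<exists>i\<in>\<mm> \<cdot> L. \<exists>a\<in>\<mm>. y = i \<oplus> a \<otimes> z" if "y \<in> \<mm> \<cdot> J" for y
  proof -
    have "y \<in> (\<mm> \<cdot> L) <+>\<^bsub>R\<^esub> (z <# \<mm>)" using that mJ_gen by blast
    then obtain i j where i: "i \<in> \<mm> \<cdot> L" "j \<in> z <# \<mm>" "y = i \<oplus> j" unfolding set_add_mem_iff by (elim bexE)
    then obtain a where a: "a \<in> \<mm>" "j = z \<otimes> a" unfolding l_coset_mem by (elim bexE)
    then have "y = i \<oplus> a \<otimes> z" using i zc Icarr by (simp add: m_comm)
    then show ?thesis using i a by (intro bexI)
  qed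
  have mLi: "ideal (\<mm> \<cdot> L) R" by (rule mL)
  have kz: "k \<otimes> z \<in> \<mm> \<cdot> L" if "k \<in> \<mm> \<cdot> \<mm>" for k
    using that
  proof (induction rule: ideal_prod.induct)
    case (prod i j)
    have "i \<otimes> j \<otimes> z = i \<otimes> (j \<otimes> z)" using prod zc Icarr by (simp add: m_assoc)
    then show ?case using ideal_prod_mem[OF prod(1) mJ[OF prod(2) z(1)]] by simp
  next
    case (sum a b)
    have "a \<in> carrier R" "b \<in> carrier R" using sum mm Icarr by blast+
    then show ?case using sum zc additive_subgroup.a_closed[OF ideal.axioms(1)[OF mLi]] by (simp add: l_distr)
  qed
  have 2: "ideal_length R (\<mm> \<cdot> L) (\<mm> \<cdot> J) \<le> ideal_length R (\<mm> \<cdot> \<mm>) \<mm>"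
    by (rule ideal_length_colon[OF mL(1) mJ'(1) maximal_is_ideal mm(1) mm(2) mLJ zc y kz])
  have "ideal_length R (\<mm> \<cdot> L) L + 1 = ideal_length R (\<mm> \<cdot> L) J"
    using ideal_length_add[OF mL(1) L J mL(2) s(2)] 1 by simp
  also have "\<dots> = ideal_length R (\<mm> \<cdot> L) (\<mm> \<cdot> J) + ideal_length R (\<mm> \<cdot> J) J"
    by (rule ideal_length_add[OF mL(1) mJ'(1) J mLJ mJ'(2)])
  also have "\<dots> \<le> ideal_length R (\<mm> \<cdot> J) J + ideal_length R (\<mm> \<cdot> \<mm>) \<mm>"
    using add_mono[OF 2 order_refl] by (simp add: add.commute)
  finally show ?thesis .
qed

text \<open>For \<open>J = \<mm>\<close> the piece \<open>\<mm> \<mm> / \<mm> L\<close> has length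
  at most 1: expanding products along \<open>\<mm> = L + (z)\<close> leaves only multiples of
  \<open>z z\<close> modulo \<open>\<mm> L\<close>, and \<open>\<mm> z \<subseteq> L\<close> gives
  \<open>\<mm> z z \<subseteq> \<mm> L\<close>.\<close>

lemma generators_maximal_subideal:
  assumes L: "ideal L R" and z: "z \<in> \<mm>" "z \<notin> L"
    and gen: "\<mm> = L <+>\<^bsub>R\<^esub> PIdl z" and mJ: "\<And>a y. a \<in> \<mm> \<Longrightarrow> y \<in> \<mm> \<Longrightarrow> a \<otimes> y \<in> L"
  shows "ideal_length R (\<mm> \<cdot> L) L + 1 \<le> ideal_length R (\<mm> \<cdot> \<mm>) \<mm> + 1"
proof -
  interpret L: ideal L R by fact
  have zc: "z \<in> carrier R" using z Icarr by blast
  note s = set_add_cgenideal[OF L zc, folded gen]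
  note mL = maximal_prod[OF L] and mm = maximal_prod[OF maximal_is_ideal]
  interpret mL: ideal "\<mm> \<cdot> L" R by (rule mL)
  have mLJ: "\<mm> \<cdot> L \<subseteq> \<mm> \<cdot> \<mm>" using s(2) by (intro ideal_prod_least[OF mm(1)] ideal_prod_mem) auto
  have 1: "ideal_length R L \<mm> = 1"
    using ideal_length_simple[OF L zc z(2)] mJ z(1) gen by simp
  have zz: "z \<otimes> z \<in> carrier R" using zc by simp
  note t = set_add_cgenideal[OF mL(1) zz]
  have mm_gen: "\<mm> \<cdot> \<mm> \<subseteq> (\<mm> \<cdot> L) <+>\<^bsub>R\<^esub> PIdl (z \<otimes> z)"
  proof (rule ideal_prod_least[OF t(1)])
    fix a y assume a: "a \<in> \<mm>" and y: "y \<in> \<mm>"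
    obtain i r where ir: "i \<in> L" "r \<in> carrier R" "a = i \<oplus> r \<otimes> z" using a s(4) by blast
    obtain j q where jq: "j \<in> L" "q \<in> carrier R" "y = j \<oplus> q \<otimes> z" using y s(4) by blast
    have k: "y \<in> carrier R" "i \<in> carrier R" "j \<in> carrier R" using y ir jq L.Icarr Icarr by auto
    have rz: "r \<otimes> z \<in> \<mm>" by (rule I_l_closed[OF z(1) ir(2)])
    \<comment> \<open>\<open>i y\<close> is already in \<open>\<mm> L\<close>, so \<open>y\<close>
      is expanded only in the second summand.\<close>
    have "a \<otimes> y = i \<otimes> y \<oplus> (r \<otimes> z) \<otimes> y" unfolding ir(3) using k ir(2) zc by algebra
    also have "(r \<otimes> z) \<otimes> y = (r \<otimes> z) \<otimes> j \<oplus> (r \<otimes> q) \<otimes> (z \<otimes> z)"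
      unfolding jq(3) using k(3) ir(2) jq(2) zc by algebra
    finally have "a \<otimes> y = (y \<otimes> i \<oplus> (r \<otimes> z) \<otimes> j) \<oplus> (r \<otimes> q) \<otimes> (z \<otimes> z)"
      using k ir(2) jq(2) zc by (simp add: m_comm a_assoc)
    moreover have "y \<otimes> i \<oplus> (r \<otimes> z) \<otimes> j \<in> \<mm> \<cdot> L"
      by (intro mL.a_closed ideal_prod_mem y ir jq rz)
    ultimately show "a \<otimes> y \<in> (\<mm> \<cdot> L) <+>\<^bsub>R\<^esub> PIdl (z \<otimes> z)"
      unfolding t(4) using ir jq m_closed by blast
  qed
  have "ideal_length R (\<mm> \<cdot> L) (\<mm> \<cdot> \<mm>) \<le> ideal_length R \<mm> (carrier R)"
  proof (rule ideal_length_colon[OF mL(1) mm(1) oneideal maximal_is_ideal a_subset mLJ zz])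
    show "\<exists>i\<in>\<mm> \<cdot> L. \<exists>a\<in>carrier R. y = i \<oplus> a \<otimes> (z \<otimes> z)" if "y \<in> \<mm> \<cdot> \<mm>" for y
      using subsetD[OF mm_gen that] unfolding t(4) .
    fix k assume k: "k \<in> \<mm>"
    have "k \<otimes> (z \<otimes> z) = z \<otimes> (k \<otimes> z)" using zc Icarr[OF k] by (simp add: m_ac)
    then show "k \<otimes> (z \<otimes> z) \<in> \<mm> \<cdot> L" using ideal_prod_mem[OF z(1) mJ[OF k z(1)]] by simp
  qed
  then have 2: "ideal_length R (\<mm> \<cdot> L) (\<mm> \<cdot> \<mm>) \<le> 1" by (simp add: ideal_length_maximal)
  have "ideal_length R (\<mm> \<cdot> L) L + 1 = ideal_length R (\<mm> \<cdot> L) \<mm>"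
    using ideal_length_add[OF mL(1) L maximal_is_ideal mL(2) s(2)] 1 by simp
  also have "\<dots> = ideal_length R (\<mm> \<cdot> L) (\<mm> \<cdot> \<mm>) + ideal_length R (\<mm> \<cdot> \<mm>) \<mm>"
    by (rule ideal_length_add[OF mL(1) mm(1) maximal_is_ideal mLJ mm(2)])
  also have "\<dots> \<le> ideal_length R (\<mm> \<cdot> \<mm>) \<mm> + 1"
    using add_mono[OF 2 order_refl] by (simp add: add.commute)
  finally show ?thesis .
qed

text \<open>Induction along a composition series from \<open>J\<close> down to \<open>c\<close>; the
  bound \<open>M\<close> is generalised because each step passes to a smaller ideal with
  \<open>M\<close> raised by \<open>v - 1\<close>.\<close>

lemma generators_descending:
  assumes v: "ideal_length R (\<mm> \<cdot> \<mm>) \<mm> = enat v" and c: "ideal c R"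
    and J: "ideal J R" "c \<subseteq> J" "ideal_length R c J = enat n" "ideal_length R (\<mm> \<cdot> J) J \<le> enat M"
  shows "ideal_length R (\<mm> \<cdot> c) c \<le> enat (M + n * (v - 1))"
  using J
proof (induction n arbitrary: J M)
  case 0
  then have "c = J" using ideal_length_eq_0[OF c] by (simp add: zero_enat_def)
  then show ?case using 0 by simp
next
  case (Suc n)
  have "c \<noteq> J" using Suc.prems(3) ideal_length_self[OF c] by (auto simp: zero_enat_def)
  then have cJ: "c \<subset> J" using Suc.prems by auto
  obtain L z where L: "ideal L R" "c \<subseteq> L" "L \<subset> J" "z \<in> J" "z \<notin> L"
    "J = L <+>\<^bsub>R\<^esub> PIdl z" "\<And>a y. a \<in> \<mm> \<Longrightarrow> y \<in> J \<Longrightarrow> a \<otimes> y \<in> L"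
    using exists_maximal_subideal[OF c Suc.prems(1) cJ] by metis
  have zc: "z \<in> carrier R" using L ideal.Icarr[OF Suc.prems(1)] by blast
  have "ideal_length R L J = 1" using ideal_length_simple[OF L(1) zc L(5)] L(4,6,7) by simp
  then have "enat (Suc n) = ideal_length R c L + 1"
    using ideal_length_add[OF c L(1) Suc.prems(1) L(2)] L(3) Suc.prems(3) by auto
  then have n: "ideal_length R c L = enat n" by (cases "ideal_length R c L") (auto simp: one_enat_def)
  have "ideal_length R (\<mm> \<cdot> L) L + 1 \<le> enat M + enat v"
    using generators_subideal[OF L(1) Suc.prems(1) L(4-7)] Suc.prems(4) v
    by (metis add_right_mono order_trans)
  \<comment> \<open>Cancelling the 1 is correct for \<open>v = 0\<close> too, where the truncated
    \<open>v - 1\<close> is 0.\<close>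
  then have "ideal_length R (\<mm> \<cdot> L) L \<le> enat (M + (v - 1))"
    by (cases "ideal_length R (\<mm> \<cdot> L) L") (auto simp: one_enat_def)
  from Suc.IH[OF L(1,2) n this] show ?case by (simp add: add.assoc)
qed

text \<open>The steps from \<open>R\<close> to \<open>\<mm>\<close> and from \<open>\<mm>\<close> to
  a maximal subideal \<open>L\<close> above \<open>c\<close> use up length 2, and \<open>L\<close>
  still needs at most \<open>v\<close> generators; \<open>l - 2\<close> steps of the general kind
  remain.\<close>

lemma generators_bound:
  assumes v: "ideal_length R (\<mm> \<cdot> \<mm>) \<mm> = enat v" and c: "ideal c R" "c \<subset> \<mm>"
    and l: "ideal_length R c (carrier R) = enat l"
  shows "ideal_length R (\<mm> \<cdot> c) c \<le> enat (v + (l - 2) * (v - 1))"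
proof -
  obtain L z where L: "ideal L R" "c \<subseteq> L" "L \<subset> \<mm>" "z \<in> \<mm>" "z \<notin> L"
    "\<mm> = L <+>\<^bsub>R\<^esub> PIdl z" "\<And>a y. a \<in> \<mm> \<Longrightarrow> y \<in> \<mm> \<Longrightarrow> a \<otimes> y \<in> L"
    using exists_maximal_subideal[OF c(1) maximal_is_ideal c(2)] by metis
  have zc: "z \<in> carrier R" using L Icarr by blast
  have Lm: "ideal_length R L \<mm> = 1" using ideal_length_simple[OF L(1) zc L(5)] L(4,6,7) by simp
  have "ideal_length R c (carrier R) = ideal_length R c L + (ideal_length R L \<mm> + ideal_length R \<mm> (carrier R))"
    using ideal_length_add[OF c(1) L(1) oneideal L(2)] ideal_length_add[OF L(1) maximal_is_ideal oneideal]
      L(3) a_subset by auto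
  then have "enat l = ideal_length R c L + 2" using l Lm ideal_length_maximal by simp
  then have n: "ideal_length R c L = enat (l - 2)"
    by (cases "ideal_length R c L") (auto simp: numeral_eq_enat)
  have "ideal_length R (\<mm> \<cdot> L) L \<le> enat v"
    using generators_maximal_subideal[OF L(1,4-7)] v
    by (cases "ideal_length R (\<mm> \<cdot> L) L") (auto simp: one_enat_def)
  from generators_descending[OF v c(1) L(1,2) n this] show ?thesis .
qed

text \<open>\<open>e\<close> is taken to be the colength of \<open>x R\<close>. Exponents start at 1
  because \<open>P C = x P\<close> is available for \<open>P = C^n\<close> only when
  \<open>P\<close> has a factor \<open>C\<close> to spare.\<close>

theorem conductor_length_bounds:
  assumes dim: "krull_dim R = 1" and inf: "infinite (carrier (R Quot \<mm>))"
    and c: "ideal (conductor_ideal R) R" "conductor_ideal R \<noteq> carrier R"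
    and s: "s \<in> conductor_ideal R" "s \<in> nonzerodivisors R"
  obtains e l v :: nat
  where "ideal_length R (conductor_ideal R) (carrier R) = enat l"
    and "ideal_length R (\<mm> \<cdot> \<mm>) \<mm> = enat v"
    and "\<And>n. ideal_length R (ideal_pow R (conductor_ideal R) (Suc n)) (carrier R) = enat (l + n * e)"
    and "1 \<le> l" and "l = 1 \<Longrightarrow> e = v" and "2 \<le> l \<Longrightarrow> l < e \<and> e \<le> l + (l - 1) * (v - 1) * l"
proof -
  define C where "C = conductor_ideal R"
  note c = c[folded C_def] and s = s[folded C_def]
  have cm: "C \<subseteq> \<mm>" using proper_ideal_le_maximal c by blast
  have one: "\<one> \<notin> C" using cm one_not_mem by blast
  obtain x where x: "x \<in> C" "x \<in> nonzerodivisors R" "\<And>a. a \<in> C \<Longrightarrow> almost_integral R a x"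
    using exists_integral_denominator[OF dim inf c(1) cm s] by metis
  have xc: "x \<in> carrier R" using x nzd_closed by auto
  have cc: "C \<cdot> C = x <# C" using conductor_square x c unfolding C_def by blast
  define Y where "Y = PIdl x"
  have Y: "ideal Y R" "x \<in> Y" "Y \<subseteq> C"
    unfolding Y_def using cgenideal_ideal[OF xc] cgenideal_self[OF xc] cgenideal_minimal[OF c(1) x(1)] by auto
  have c_car: "C \<subseteq> carrier R" using ideal.Icarr[OF c(1)] by auto
  have fin: "\<exists>k. ideal_length R I (carrier R) = enat k" if "ideal I R" "y \<in> I" "y \<in> nonzerodivisors R" for I y
    using finite_colength[OF dim that] by auto
  obtain e where e: "ideal_length R Y (carrier R) = enat e" using fin Y x by blast
  obtain l where l: "ideal_length R C (carrier R) = enat l" using fin c(1) x by blast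
  note mm = maximal_prod[OF maximal_is_ideal]
  have xm: "x \<in> \<mm>" using x cm by auto
  obtain k where "ideal_length R (\<mm> \<cdot> \<mm>) (carrier R) = enat k"
    using fin[OF mm(1) ideal_prod_mem[OF xm xm] nzd_mult[OF x(2,2)]] by blast
  then obtain v where v: "ideal_length R (\<mm> \<cdot> \<mm>) \<mm> = enat v"
    using ideal_length_add[OF mm(1) maximal_is_ideal oneideal mm(2) a_subset]
    by (cases "ideal_length R (\<mm> \<cdot> \<mm>) \<mm>") auto
  have "ideal_length R C (carrier R) = ideal_length R C \<mm> + 1"
    using ideal_length_add[OF c(1) maximal_is_ideal oneideal cm a_subset] by (simp add: ideal_length_maximal)
  then obtain l' where l': "ideal_length R C \<mm> = enat l'" "l = l' + 1"
    using l by (cases "ideal_length R C \<mm>") (auto simp: one_enat_def)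
  have e_eq: "enat e = ideal_length R Y C + enat l"
    using ideal_length_add[OF Y(1) c(1) oneideal Y(3) c_car] e l by simp
  obtain h where h: "ideal_length R Y C = enat h" using e_eq by (cases "ideal_length R Y C") auto
  have "Y \<noteq> C" using conductor_not_principal[OF x(2)] one unfolding Y_def C_def by metis
  then have "1 \<le> ideal_length R Y C" using ideal_length_pos[OF Y(1) c(1)] Y(3) by auto
  then have le: "l < e" using e_eq h by (simp add: one_enat_def)
  have pow: "ideal_length R (ideal_pow R C (Suc n)) (carrier R) = enat (l + n * e)" for n
  proof (induction n)
    case 0
    then show ?case using l ideal_pow_1[OF c(1)] by simp
  next
    case (Suc n)
    define P where "P = ideal_pow R C (Suc n)"
    have IH: "ideal_length R P (carrier R) = enat (l + n * e)" unfolding P_def by (rule Suc)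
    have P: "ideal P R" unfolding P_def by (rule ideals_pow[OF c(1)])
    have PC: "P \<cdot> C = x <# P"
    proof
      have xP: "ideal (x <# P) R" by (rule l_coset_ideal[OF xc P])
      show "x <# P \<subseteq> P \<cdot> C"
      proof
        fix y assume "y \<in> x <# P"
        then obtain p where p: "p \<in> P" "y = x \<otimes> p" by (auto simp: l_coset_mem)
        then have "y = p \<otimes> x" using xc ideal.Icarr[OF P p(1)] by (simp add: m_comm)
        then show "y \<in> P \<cdot> C" using ideal_prod_mem[OF p(1) x(1)] by simp
      qed
      define Q where "Q = ideal_pow R C n"
      have Q: "ideal Q R" unfolding Q_def by (rule ideals_pow[OF c(1)])
      have PQ: "P = Q \<cdot> C" unfolding P_def Q_def by (rule ideal_pow_Suc)
      \<comment> \<open>A factor \<open>C\<close> is split off from \<open>P\<close> so that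
        \<open>C C = x C\<close> can be applied.\<close>
      have "P \<cdot> C = Q \<cdot> (C \<cdot> C)" unfolding PQ by (rule ideal_prod_assoc[OF Q c(1) c(1)])
      also have "\<dots> \<subseteq> x <# P"
      proof (rule ideal_prod_least[OF xP])
        fix q a assume q: "q \<in> Q" and "a \<in> C \<cdot> C"
        then obtain y where y: "y \<in> C" "a = x \<otimes> y" unfolding cc by (auto simp: l_coset_mem)
        then have "q \<otimes> a = x \<otimes> (q \<otimes> y)" using xc ideal.Icarr[OF Q q] ideal.Icarr[OF c(1)] by (simp add: m_ac)
        then show "q \<otimes> a \<in> x <# P" using ideal_prod_mem[OF q y(1)] unfolding PQ l_coset_mem by blast
      qed
      finally show "P \<cdot> C \<subseteq> x <# P" .
    qed
    have "ideal_length R (x <# P) P = enat e"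
      using ideal_length_l_coset_self[OF x(2) P] IH e unfolding Y_def by simp
    moreover have "ideal_length R (x <# P) (carrier R) = ideal_length R (x <# P) P + ideal_length R P (carrier R)"
      using P l_coset_ideal[OF xc P] ideal.I_l_closed[OF P] ideal.Icarr[OF P] xc
      by (intro ideal_length_add oneideal) (auto simp: l_coset_mem)
    ultimately show ?case
      unfolding ideal_pow_Suc[of C "Suc n"] P_def[symmetric] PC using IH by simp
  qed
  have e_v: "e = v" if "l = 1"
  proof -
    have "ideal_length R C \<mm> = 0" using that l' by (simp add: zero_enat_def)
    then have "C = \<mm>" using ideal_length_eq_0[OF c(1) maximal_is_ideal cm] by simp
    then show ?thesis
      using v cc ideal_length_l_coset_self[OF x(2) maximal_is_ideal] e ideal_length_maximal unfolding Y_def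
      by (simp add: one_enat_def)
  qed
  have e_le: "e \<le> l + (l - 1) * (v - 1) * l" if l2: "2 \<le> l"
  proof -
    have "C \<noteq> \<mm>" using l' l2 ideal_length_self[OF maximal_is_ideal] by (auto simp: zero_enat_def)
    then have cm': "C \<subset> \<mm>" using cm by auto
    note mc = maximal_prod[OF c(1)]
    have mu: "ideal_length R (\<mm> \<cdot> C) C \<le> enat (v + (l - 2) * (v - 1))"
      by (rule generators_bound[OF v c(1) cm' l])
    define T where "T = Y <+>\<^bsub>R\<^esub> (\<mm> \<cdot> C)"
    have T: "ideal T R" "Y \<subseteq> T" "\<mm> \<cdot> C \<subseteq> T" "T \<subseteq> C"
      unfolding T_def using set_add_upper[OF Y(1) mc(1)] add_ideals[OF Y(1) mc(1)]
        set_add_least[OF c(1) Y(3) mc(2)] by auto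
    \<comment> \<open>So \<open>x\<close> belongs to a minimal system of generators of
      \<open>C\<close>. Otherwise \<open>C C = x C\<close> would lie in \<open>\<mm> C C\<close>,
      and Nakayama would give \<open>C C = 0\<close> although \<open>x x \<noteq> 0\<close>.\<close>
    have "x \<notin> \<mm> \<cdot> C"
    proof
      assume xmc: "x \<in> \<mm> \<cdot> C"
      note cc' = ideal_prod_is_ideal[OF c(1) c(1)]
      have "C \<cdot> C \<subseteq> \<mm> \<cdot> (C \<cdot> C)"
        unfolding ideal_prod_assoc[OF maximal_is_ideal c(1) c(1), symmetric]
        unfolding cc using ideal_prod_mem[OF xmc] by (auto simp: l_coset_mem)
      also have "\<dots> \<subseteq> {\<zero>} <+>\<^bsub>R\<^esub> (\<mm> \<cdot> (C \<cdot> C))"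
        by (rule set_add_upper(2)[OF zeroideal maximal_prod(1)[OF cc']])
      finally have "C \<cdot> C \<subseteq> {\<zero>}" by (rule nakayama[OF zeroideal cc'])
      then have "x \<otimes> x = \<zero>" using ideal_prod_mem[OF x(1,1)] by blast
      then have "x = \<zero>" using x(2) xc by (auto simp: nonzerodivisors_def)
      then have "\<one> = \<zero>" using x(2) by (auto simp: nonzerodivisors_def)
      then show False using one_not_mem additive_subgroup.zero_closed[OF ideal.axioms(1)[OF maximal_is_ideal]] by simp
    qed
    then have "\<mm> \<cdot> C \<subset> T" using T Y by blast
    then have T1: "1 \<le> ideal_length R (\<mm> \<cdot> C) T" by (rule ideal_length_pos[OF mc(1) T(1)])
    have "ideal_length R (\<mm> \<cdot> C) T + ideal_length R T C \<le> enat (v + (l - 2) * (v - 1))"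
      using ideal_length_add[OF mc(1) T(1) c(1) T(3,4)] mu by simp
    \<comment> \<open>\<open>n\<close> is the minimal number of generators of
      \<open>C / x R\<close>; the 1 accounts for \<open>x\<close>.\<close>
    with T1 obtain n where n: "ideal_length R T C = enat n" "n + 1 \<le> v + (l - 2) * (v - 1)"
      by (cases "ideal_length R (\<mm> \<cdot> C) T"; cases "ideal_length R T C") (auto simp: one_enat_def)
    have "ideal_length R Y C \<le> enat (n * l)"
    proof (rule ideal_length_le_generators[OF c(1) l c(1) Y(1,3)])
      fix a j assume "a \<in> C" "j \<in> C"
      then have "a \<otimes> j \<in> x <# C" using ideal_prod_mem cc by blast
      then obtain i where i: "i \<in> C" "a \<otimes> j = x \<otimes> i" by (auto simp: l_coset_mem)
      then show "a \<otimes> j \<in> Y" using xc ideal.Icarr[OF c(1) i(1)] m_comm[of x i] unfolding Y_def cgenideal_mem by auto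
    qed (use n in \<open>simp add: T_def\<close>)
    then have "h \<le> n * l" using h by simp
    \<comment> \<open>For \<open>v \<ge> 1\<close> the bound \<open>v + (l - 2) (v - 1)\<close>
      equals \<open>1 + (l - 1) (v - 1)\<close>; for \<open>v = 0\<close> it is 0, which contradicts
      \<open>n + 1\<close> being below it.\<close>
    moreover have "n \<le> (l - 1) * (v - 1)"
    proof (cases v)
      case (Suc w)
      have "(l - 1) * w = w + (l - 2) * w" using l2 by (cases l; cases "l - 1") auto
      then show ?thesis using n(2) Suc by simp
    qed (use n in simp)
    ultimately have "h \<le> (l - 1) * (v - 1) * l" by (meson mult_le_mono1 order_trans)
    then show ?thesis using e_eq h by simp
  qed
  show thesis
    by (rule that[of l v e]) (use l v pow l' e_v e_le le in \<open>auto simp: C_def\<close>)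
qed

end

section \<open>Length, embedding dimension and multiplicity\<close>

text \<open>\<open>module_length\<close> is defined through sequences of submodules, so inductive
  chains have to be unrolled into sequences.\<close>

lemma ideal_chain_sequence:
  assumes "ideal_chain R I J n"
  shows "\<exists>N :: nat \<Rightarrow> 'a set. (\<forall>i\<le>n. ideal (N i) R \<and> I \<subseteq> N i \<and> N i \<subseteq> J) \<and> (\<forall>i<n. N i \<subset> N (Suc i))"
  using assms
proof (induction)
  case (base J)
  then show ?case by (intro exI[of _ "\<lambda>_. I"]) auto
next
  case (step J n K)
  then obtain N :: "nat \<Rightarrow> 'a set" where
    N: "\<forall>i\<le>n. ideal (N i) R \<and> I \<subseteq> N i \<and> N i \<subseteq> J" "\<forall>i<n. N i \<subset> N (Suc i)" by blast
  have IK: "I \<subseteq> K" using ideal_chain_ideals[OF step(1)] step by auto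
  have NK: "N i \<subseteq> K" if "i \<le> n" for i using N(1) step(3) that by blast
  have Nn: "N n \<subset> K" using N(1) step(3) by blast
  let ?N = "\<lambda>i. if i \<le> n then N i else K"
  have "\<forall>i\<le>Suc n. ideal (?N i) R \<and> I \<subseteq> ?N i \<and> ?N i \<subseteq> K"
    using N(1) IK NK step(2) by simp
  moreover have "\<forall>i<Suc n. ?N i \<subset> ?N (Suc i)"
  proof (intro allI impI)
    fix i assume "i < Suc n"
    then show "?N i \<subset> ?N (Suc i)" using N(2) Nn by (cases "i = n") auto
  qed
  ultimately show ?case by (intro exI[of _ ?N] conjI)
qed

context cring begin

section \<open>Ideals above \<open>I\<close> and submodules of \<open>R / I\<close>\<close>

lemma quot_module_simps:
  "carrier (quot_module R I) = {I +> r | r. r \<in> carrier R}"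
  "u \<oplus>\<^bsub>quot_module R I\<^esub> v = u \<oplus>\<^bsub>R Quot I\<^esub> v"
  "\<zero>\<^bsub>quot_module R I\<^esub> = I"
  "r \<odot>\<^bsub>quot_module R I\<^esub> u = (I +> r) \<otimes>\<^bsub>R Quot I\<^esub> u"
  by (auto simp: quot_module_def ring.defs FactRing_def A_RCOSETS_def')

lemma ideal_of_submodule:
  assumes I: "ideal I R" and N: "Module.submodule N R (quot_module R I)"
  shows "ideal {r \<in> carrier R. I +> r \<in> N} R" "I \<subseteq> {r \<in> carrier R. I +> r \<in> N}"
proof -
  interpret I: ideal I R by fact
  interpret V: module R "quot_module R I" by (rule quot_module_module[OF I])
  note E = V.submoduleE[OF N]
  have sum: "(I +> a) \<oplus>\<^bsub>quot_module R I\<^esub> (I +> b) = I +> (a \<oplus> b)" if "a \<in> carrier R" "b \<in> carrier R" for a b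
    using that by (simp add: quot_module_simps FactRing_def I.a_rcos_sum)
  have smult: "r \<odot>\<^bsub>quot_module R I\<^esub> (I +> a) = I +> (r \<otimes> a)" if "a \<in> carrier R" "r \<in> carrier R" for a r
    using that by (simp add: quot_module_simps FactRing_def I.rcoset_mult_add)
  have zero: "I \<in> N"
  proof -
    obtain n where n: "n \<in> N" using E(2) by auto
    then have "n \<oplus>\<^bsub>quot_module R I\<^esub> \<ominus>\<^bsub>quot_module R I\<^esub> n = \<zero>\<^bsub>quot_module R I\<^esub>" using E(1) by (intro V.r_neg) auto
    then have "\<zero>\<^bsub>quot_module R I\<^esub> \<in> N" using E(3,5) n by metis
    then show ?thesis by (simp add: quot_module_simps)
  qed
  show "ideal {r \<in> carrier R. I +> r \<in> N} R"
  proof (rule idealI[OF ring_axioms])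
    have smul: "r \<otimes> a \<in> {r \<in> carrier R. I +> r \<in> N}" if "a \<in> {r \<in> carrier R. I +> r \<in> N}" "r \<in> carrier R" for a r
      using that E(4)[of r "I +> a"] smult[of a r] by simp
    show "subgroup {r \<in> carrier R. I +> r \<in> N} (add_monoid R)"
    proof (rule add.subgroupI)
      show "{r \<in> carrier R. I +> r \<in> N} \<noteq> {}"
        using zero a_rcos_zero[OF I I.zero_closed] by (auto intro!: exI[of _ \<zero>])
      show "\<ominus> a \<in> {r \<in> carrier R. I +> r \<in> N}" if "a \<in> {r \<in> carrier R. I +> r \<in> N}" for a
        using smul[OF that, of "\<ominus> \<one>"] that by (simp add: l_minus)
      show "a \<oplus> b \<in> {r \<in> carrier R. I +> r \<in> N}"
        if "a \<in> {r \<in> carrier R. I +> r \<in> N}" "b \<in> {r \<in> carrier R. I +> r \<in> N}" for a b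
        using that E(5)[of "I +> a" "I +> b"] sum[of a b] by simp
    qed auto
    show "r \<otimes> a \<in> {r \<in> carrier R. I +> r \<in> N}" "a \<otimes> r \<in> {r \<in> carrier R. I +> r \<in> N}"
      if "a \<in> {r \<in> carrier R. I +> r \<in> N}" "r \<in> carrier R" for a r
      using smul[OF that] that m_comm by auto
  qed
  show "I \<subseteq> {r \<in> carrier R. I +> r \<in> N}" using zero a_rcos_zero[OF I] I.a_Hcarr by auto
qed

lemma submodule_of_ideal:
  assumes I: "ideal I R" and J: "ideal J R" "I \<subseteq> J"
  shows "Module.submodule ((+>) I ` J) R (quot_module R I)"
proof -
  interpret I: ideal I R by fact
  interpret J: ideal J R by fact
  interpret V: module R "quot_module R I" by (rule quot_module_module[OF I])
  have sum: "(I +> a) \<oplus>\<^bsub>quot_module R I\<^esub> (I +> b) = I +> (a \<oplus> b)" if "a \<in> carrier R" "b \<in> carrier R" for a b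
    using that by (simp add: quot_module_simps FactRing_def I.a_rcos_sum)
  have smult: "r \<odot>\<^bsub>quot_module R I\<^esub> (I +> a) = I +> (r \<otimes> a)" if "a \<in> carrier R" "r \<in> carrier R" for a r
    using that by (simp add: quot_module_simps FactRing_def I.rcoset_mult_add)
  have car: "a \<in> J \<Longrightarrow> I +> a \<in> carrier (quot_module R I)" for a
    using J.a_Hcarr by (auto simp: quot_module_simps)
  have smul: "r \<odot>\<^bsub>quot_module R I\<^esub> x \<in> (+>) I ` J" if "r \<in> carrier R" "x \<in> (+>) I ` J" for r x
    using that smult J.a_Hcarr J.I_l_closed by auto
  show ?thesis
  proof (rule V.submoduleI[OF _ _ _ _ smul])
    show "(+>) I ` J \<subseteq> carrier (quot_module R I)" using car by auto
    show "\<zero>\<^bsub>quot_module R I\<^esub> \<in> (+>) I ` J"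
      using a_rcos_zero[OF I I.zero_closed] J.zero_closed by (auto simp: quot_module_simps intro!: image_eqI[of _ _ \<zero>])
    show "a \<oplus>\<^bsub>quot_module R I\<^esub> b \<in> (+>) I ` J" if "a \<in> (+>) I ` J" "b \<in> (+>) I ` J" for a b
      using that sum J.a_Hcarr J.a_closed by auto
    show "\<ominus>\<^bsub>quot_module R I\<^esub> x \<in> (+>) I ` J" if x: "x \<in> (+>) I ` J" for x
    proof -
      have "x \<in> carrier (quot_module R I)" using x car by auto
      then have "\<ominus>\<^bsub>quot_module R I\<^esub> x = (\<ominus> \<one>) \<odot>\<^bsub>quot_module R I\<^esub> x"
        using V.smult_l_minus[of \<one> x] by (simp add: V.smult_one)
      then show ?thesis using smul[OF _ x, of "\<ominus> \<one>"] by simp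
    qed
  qed auto
qed

text \<open>Preimages under the projection turn chains of submodules into chains of ideals, and
  images turn them back. Images stay strict because every ideal of the chain contains
  \<open>I\<close>.\<close>

lemma module_length_quot_module:
  assumes I: "ideal I R"
  shows "module_length R (quot_module R I) = ideal_length R I (carrier R)"
proof (rule antisym)
  interpret I: ideal I R by fact
  interpret V: module R "quot_module R I" by (rule quot_module_module[OF I])
  have Ic: "I \<subseteq> carrier R" using I.Icarr by auto
  show "module_length R (quot_module R I) \<le> ideal_length R I (carrier R)"
    unfolding module_length_def
  proof (rule Sup_least, clarify)
    fix n and N :: "nat \<Rightarrow> 'a set set"
    assume N: "\<forall>i\<le>n. Module.submodule (N i) R (quot_module R I)" "\<forall>i<n. N i \<subset> N (Suc i)"
    define F where "F = (\<lambda>N. {r \<in> carrier R. I +> r \<in> N})"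
    have F: "ideal (F (N i)) R" "I \<subseteq> F (N i)" if "i \<le> n" for i
      unfolding F_def using ideal_of_submodule[OF I] N that by auto
    have "ideal_chain R I (F (N k)) k" if "k \<le> n" for k
      using that
    proof (induction k)
      case 0
      then show ?case using F[of 0] I by (auto intro: ideal_chain.base)
    next
      case (Suc k)
      have Nk: "N k \<subset> N (Suc k)" using N(2) Suc.prems by simp
      then obtain u where u: "u \<in> N (Suc k)" "u \<notin> N k" by blast
      have "N (Suc k) \<subseteq> carrier (quot_module R I)" using V.submoduleE(1) N(1) Suc by blast
      then obtain r where r: "r \<in> carrier R" "u = I +> r" using u by (auto simp: quot_module_simps)
      have "r \<in> F (N (Suc k))" "r \<notin> F (N k)" using u r by (auto simp: F_def)
      moreover have "F (N k) \<subseteq> F (N (Suc k))" using Nk by (auto simp: F_def)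
      ultimately have "F (N k) \<subset> F (N (Suc k))" by auto
      then show ?case using Suc F(1)[of "Suc k"] by (intro ideal_chain.step[of R I "F (N k)"]) auto
    qed
    then have "ideal_chain R I (carrier R) n"
      using ideal_chain_mono[OF _ oneideal] by (force simp: F_def)
    then show "enat n \<le> ideal_length R I (carrier R)"
      using ideal_length_ge_iff[OF I oneideal Ic] by simp
  qed
  show "ideal_length R I (carrier R) \<le> module_length R (quot_module R I)"
  proof (rule enat_le_of_all_nat)
    fix n assume "enat n \<le> ideal_length R I (carrier R)"
    then have "ideal_chain R I (carrier R) n" using ideal_length_ge_iff[OF I oneideal Ic] by simp
    from ideal_chain_sequence[OF this] obtain N :: "nat \<Rightarrow> 'a set" where
      N: "\<forall>i\<le>n. ideal (N i) R \<and> I \<subseteq> N i \<and> N i \<subseteq> carrier R" "\<forall>i<n. N i \<subset> N (Suc i)" by blast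
    have "(+>) I ` N i \<subset> (+>) I ` N (Suc i)" if i: "i < n" for i
    proof -
      interpret Ni: ideal "N i" R using N(1) i by auto
      have Ni: "N i \<subset> N (Suc i)" using N(2) i by simp
      then obtain r where r: "r \<in> N (Suc i)" "r \<notin> N i" by blast
      have rc: "r \<in> carrier R" using r(1) N(1)[rule_format, of "Suc i"] i by auto
      have "I +> r \<notin> (+>) I ` N i"
      proof
        assume "I +> r \<in> (+>) I ` N i"
        then obtain r' where r': "r' \<in> N i" "I +> r = I +> r'" by auto
        have "r' \<in> carrier R" using r' Ni.Icarr by blast
        then have "r \<ominus> r' \<in> I" using quotient_eq_iff_same_a_r_cos[OF I rc] r' by simp
        then have "r \<ominus> r' \<in> N i" using N(1)[rule_format, of i] i by auto
        then have "(r \<ominus> r') \<oplus> r' \<in> N i" using r' by (intro Ni.a_closed)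
        moreover have "(r \<ominus> r') \<oplus> r' = r" using rc \<open>r' \<in> carrier R\<close> by algebra
        ultimately show False using r by simp
      qed
      then show ?thesis using r Ni by blast
    qed
    moreover have "\<forall>i\<le>n. Module.submodule ((+>) I ` N i) R (quot_module R I)"
      using submodule_of_ideal[OF I] N(1) by auto
    ultimately show "enat n \<le> module_length R (quot_module R I)"
      unfolding module_length_def by (intro Sup_upper CollectI exI[of _ n] conjI exI[of _ "\<lambda>i. (+>) I ` N i"]) auto
  qed
qed

text \<open>Each element chosen outside the current ideal shortens the rest by at least 1.
  Generation modulo \<open>K\<close> is expressed through all ideals \<open>L\<close> containing
  \<open>K\<close> and \<open>A\<close>, so that \<open>L\<close> can later be the preimage of a
  linear span.\<close>

lemma exists_generators_le_length:
  assumes K: "ideal K R" and M: "ideal M R" and "K \<subseteq> M" and "ideal_length R K M = enat n"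
  shows "\<exists>A. finite A \<and> card A \<le> n \<and> A \<subseteq> M \<and> (\<forall>L. ideal L R \<longrightarrow> K \<subseteq> L \<longrightarrow> A \<subseteq> L \<longrightarrow> M \<subseteq> L)"
  using assms
proof (induction n arbitrary: K rule: less_induct)
  case (less n)
  show ?case
  proof (cases "K = M")
    case True
    then show ?thesis by (intro exI[of _ "{}"]) auto
  next
    case False
    then obtain z where z: "z \<in> M" "z \<notin> K" using less.prems by auto
    have zc: "z \<in> carrier R" using z ideal.Icarr[OF M] by blast
    define K' where "K' = K <+>\<^bsub>R\<^esub> PIdl z"
    note s = set_add_cgenideal[OF less.prems(1) zc, folded K'_def]
    have K'M: "K' \<subseteq> M" using s(5)[OF M less.prems(3) z(1)] .
    have "1 \<le> ideal_length R K K'" using ideal_length_pos[OF less.prems(1) s(1)] s(2,3) z by blast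
    moreover have "enat n = ideal_length R K K' + ideal_length R K' M"
      using ideal_length_add[OF less.prems(1) s(1) M s(2) K'M] less.prems by simp
    ultimately obtain n' where n': "ideal_length R K' M = enat n'" "n' < n"
      by (cases "ideal_length R K K'"; cases "ideal_length R K' M") (auto simp: one_enat_def)
    obtain A where A: "finite A" "card A \<le> n'" "A \<subseteq> M"
      "\<forall>L. ideal L R \<longrightarrow> K' \<subseteq> L \<longrightarrow> A \<subseteq> L \<longrightarrow> M \<subseteq> L"
      using less.IH[OF n'(2) s(1) M K'M n'(1)] by blast
    have "card (insert z A) \<le> n" using A(1,2) n'(2) card_insert_le_m1[of n A z] by (simp add: card_insert_if)
    moreover have "M \<subseteq> L" if "ideal L R" "K \<subseteq> L" "insert z A \<subseteq> L" for L
      using A(4) that s(5)[OF that(1,2)] by simp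
    ultimately show ?thesis using A z by (intro exI[of _ "insert z A"]) auto
  qed
qed

end

context noetherian_local_ring begin

text \<open>Adding one generator raises the length by at most 1, since \<open>\<mm>\<close>
  annihilates it modulo \<open>K\<close>.\<close>

lemma length_le_card_generators:
  assumes K: "ideal K R" and M: "ideal M R" "K \<subseteq> M" and KM: "\<And>a y. a \<in> \<mm> \<Longrightarrow> y \<in> M \<Longrightarrow> a \<otimes> y \<in> K"
    and A: "finite A" "A \<subseteq> M"
  shows "\<exists>L. ideal L R \<and> K \<subseteq> L \<and> L \<subseteq> M \<and> A \<subseteq> L \<and> ideal_length R K L \<le> enat (card A)"
  using A
proof (induction)
  case empty
  then show ?case using K M ideal_length_self[OF K] by (auto simp: zero_enat_def)
next
  case (insert a A)
  then obtain L where L: "ideal L R" "K \<subseteq> L" "L \<subseteq> M" "A \<subseteq> L" "ideal_length R K L \<le> enat (card A)" by auto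
  have ac: "a \<in> carrier R" "a \<in> M" using insert ideal.Icarr[OF M(1)] by auto
  note s = set_add_cgenideal[OF L(1) ac(1)]
  have "ideal_length R L (L <+>\<^bsub>R\<^esub> PIdl a) \<le> ideal_length R \<mm> (carrier R)"
  proof (rule ideal_length_colon[OF L(1) s(1) oneideal maximal_is_ideal a_subset s(2) ac(1)])
    show "\<exists>i\<in>L. \<exists>r\<in>carrier R. y = i \<oplus> r \<otimes> a" if "y \<in> L <+>\<^bsub>R\<^esub> PIdl a" for y
      using that unfolding s(4) .
    show "k \<otimes> a \<in> L" if "k \<in> \<mm>" for k using KM[OF that ac(2)] L(2) by blast
  qed
  then have "ideal_length R K (L <+>\<^bsub>R\<^esub> PIdl a) \<le> enat (card A) + 1"
    using ideal_length_add[OF K L(1) s(1) L(2) s(2)] L(5) by (simp add: ideal_length_maximal add_mono)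
  then have "ideal_length R K (L <+>\<^bsub>R\<^esub> PIdl a) \<le> enat (card (insert a A))"
    using insert by (simp add: one_enat_def)
  moreover have "K \<subseteq> L <+>\<^bsub>R\<^esub> PIdl a" "insert a A \<subseteq> L <+>\<^bsub>R\<^esub> PIdl a" using L s by auto
  ultimately show ?case using s(1) s(5)[OF M(1) L(3) ac(2)] by (intro exI[of _ "L <+>\<^bsub>R\<^esub> PIdl a"]) simp
qed

lemma ideal_pow_2: "ideal I R \<Longrightarrow> ideal_pow R I 2 = I \<cdot> I"
  using ideal_pow_Suc[of I 1] ideal_pow_1 by (simp add: numeral_2_eq_2)

text \<open>\<open>dim\<close> is the least size of a finite generating set. Hence two facts
  suffice: every such set has at least \<open>v\<close> elements, and some set has at most
  \<open>v\<close>.\<close>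

theorem embedding_dim_eq_length:
  assumes v: "ideal_length R (\<mm> \<cdot> \<mm>) \<mm> = enat v"
  shows "embedding_dim R \<mm> = v"
proof -
  define J where "J = \<mm> \<cdot> \<mm>"
  note mm = maximal_prod[OF maximal_is_ideal, folded J_def]
  interpret J: ideal J R by (rule mm(1))
  define V where "V = cotangent_space R \<mm>"
  interpret v: vectorspace "R Quot \<mm>" V
    unfolding V_def by (rule cotangent_vectorspace) (rule maximalideal_axioms)
  have Vc: "carrier V = {J +> x | x. x \<in> \<mm>}" and Va: "\<And>u v. u \<oplus>\<^bsub>V\<^esub> v = u \<oplus>\<^bsub>R Quot J\<^esub> v"
    and Vz: "\<zero>\<^bsub>V\<^esub> = J" and Vs: "\<And>u v. u \<odot>\<^bsub>V\<^esub> v = rcoset_mult R J u v"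
    unfolding V_def cotangent_space_def Let_def ideal_pow_2[OF maximal_is_ideal] J_def[symmetric]
    by (simp_all add: ring.defs FactRing_def)
  have sum: "(J +> a) \<oplus>\<^bsub>V\<^esub> (J +> b) = J +> (a \<oplus> b)" if "a \<in> carrier R" "b \<in> carrier R" for a b
    using that by (simp add: Va FactRing_def J.a_rcos_sum)
  have smult: "(\<mm> +> r) \<odot>\<^bsub>V\<^esub> (J +> x) = J +> (r \<otimes> x)" if r: "r \<in> carrier R" and x: "x \<in> \<mm>" for r x
  proof -
    have xc: "x \<in> carrier R" using x Icarr by auto
    \<comment> \<open>\<open>rcoset_mult\<close> is a union over all pairs of representatives; each
      pair has to give the same coset.\<close>
    have "J +> (a \<otimes> b) = J +> (r \<otimes> x)" if ab: "a \<in> \<mm> +> r" "b \<in> J +> x" for a b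
    proof -
      obtain p q where pq: "p \<in> \<mm>" "q \<in> J" "a = p \<oplus> r" "b = q \<oplus> x" using ab by (auto simp: a_r_coset_def')
      have c: "p \<in> carrier R" "q \<in> carrier R" using pq Icarr J.Icarr by auto
      have "a \<otimes> b \<ominus> r \<otimes> x = p \<otimes> q \<oplus> p \<otimes> x \<oplus> r \<otimes> q" unfolding pq using c r xc by algebra
      moreover have "p \<otimes> x \<in> J" unfolding J_def using pq(1) x by (rule ideal_prod_mem)
      ultimately have "a \<otimes> b \<ominus> r \<otimes> x \<in> J" using pq c r by (simp add: J.a_closed J.I_l_closed)
      then show ?thesis using quotient_eq_iff_same_a_r_cos[OF J.ideal_axioms, of "a \<otimes> b" "r \<otimes> x"] pq c r xc by simp
    qed
    moreover have "r \<in> \<mm> +> r" "x \<in> J +> x" using a_rcos_self r J.a_rcos_self xc by auto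
    ultimately show ?thesis unfolding Vs rcoset_mult_def by blast
  qed
  have rm: "\<mm> +> r \<in> carrier (R Quot \<mm>)" if "r \<in> carrier R" for r
    using that by (auto simp: FactRing_def A_RCOSETS_def')
  have rm': "\<exists>r\<in>carrier R. c = \<mm> +> r" if "c \<in> carrier (R Quot \<mm>)" for c
    using that by (auto simp: FactRing_def A_RCOSETS_def')
  have lower: "v \<le> card B" if B: "finite B" "B \<subseteq> carrier V" "v.gen_set B" for B
  proof -
    \<comment> \<open>One representative for each coset, so that lifting preserves the
      cardinality.\<close>
    obtain A where A: "A \<subseteq> \<mm>" "B = (+>) J ` A" "inj_on ((+>) J) A"
      using B(2) subset_image_inj[of B "(+>) J" \<mm>] by (auto simp: Vc image_def)
    have fA: "finite A" "card A = card B"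
      using finite_imageD[OF _ A(3)] card_image[OF A(3)] B(1) A(2) by simp_all
    obtain L where L: "ideal L R" "J \<subseteq> L" "L \<subseteq> \<mm>" "A \<subseteq> L" "ideal_length R J L \<le> enat (card A)"
      using length_le_card_generators[OF mm(1) maximal_is_ideal mm(2) _ fA(1) A(1)] ideal_prod_mem unfolding J_def by metis
    interpret L: ideal L R by fact
    \<comment> \<open>The image of \<open>L\<close> is a subspace containing \<open>B\<close>, hence
      all of \<open>V\<close>; as \<open>J \<subseteq> L\<close>, this forces
      \<open>L = \<mm>\<close>.\<close>
    have "LinearCombinations.submodule (R Quot \<mm>) ((+>) J ` L) V"
    proof
      show "(+>) J ` L \<subseteq> carrier V" using L(3) by (auto simp: Vc)
      show "\<zero>\<^bsub>V\<^esub> \<in> (+>) J ` L" unfolding Vz using a_rcos_zero[OF mm(1) J.zero_closed] L.zero_closed by (metis imageI)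
      show "x \<oplus>\<^bsub>V\<^esub> y \<in> (+>) J ` L" if "x \<in> (+>) J ` L" "y \<in> (+>) J ` L" for x y
        using that sum L.Icarr L.a_closed by auto
      show "c \<odot>\<^bsub>V\<^esub> x \<in> (+>) J ` L" if c: "c \<in> carrier (R Quot \<mm>)" and x: "x \<in> (+>) J ` L" for c x
      proof -
        obtain r y where "r \<in> carrier R" "c = \<mm> +> r" "y \<in> L" "x = J +> y" using rm'[OF c] x by auto
        then show ?thesis using smult L(3) L.I_l_closed by (metis imageI subsetD)
      qed
    qed
    then have "v.span B \<subseteq> (+>) J ` L" using A(2) L(4) by (intro v.span_is_subset) auto
    then have VL: "carrier V \<subseteq> (+>) J ` L" using B(3) by simp
    have "\<mm> \<subseteq> L"
    proof
      fix y assume y: "y \<in> \<mm>"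
      then have "J +> y \<in> (+>) J ` L" using VL by (auto simp: Vc)
      then obtain w where w: "w \<in> L" "J +> y = J +> w" by auto
      have c: "y \<in> carrier R" "w \<in> carrier R" using y w Icarr L.Icarr by auto
      then have "y \<ominus> w \<in> L" using quotient_eq_iff_same_a_r_cos[OF mm(1), of y w] w L(2) by auto
      then have "(y \<ominus> w) \<oplus> w \<in> L" using w by (intro L.a_closed)
      moreover have "(y \<ominus> w) \<oplus> w = y" using c by algebra
      ultimately show "y \<in> L" by simp
    qed
    then have "L = \<mm>" using L(3) by auto
    then show ?thesis using L(5) v fA(2) by (simp add: J_def)
  qed
  obtain A where A: "finite A" "card A \<le> v" "A \<subseteq> \<mm>"
    "\<forall>L. ideal L R \<longrightarrow> J \<subseteq> L \<longrightarrow> A \<subseteq> L \<longrightarrow> \<mm> \<subseteq> L"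
    using exists_generators_le_length[OF mm(1) maximal_is_ideal mm(2) v[folded J_def]] by (elim exE conjE)
  define B where "B = (+>) J ` A"
  have Bc: "B \<subseteq> carrier V" using A(3) by (auto simp: B_def Vc)
  interpret S: LinearCombinations.submodule "R Quot \<mm>" "v.span B" V by (rule v.span_is_submodule[OF Bc])
  have gen: "v.gen_set B"
  proof
    show "v.span B \<subseteq> carrier V" by (rule S.subset)
    \<comment> \<open>The preimage of the span is an ideal containing \<open>J\<close> and
      \<open>A\<close>, so the choice of \<open>A\<close> makes it all of
      \<open>\<mm>\<close>.\<close>
    define L where "L = {a \<in> \<mm>. J +> a \<in> v.span B}"
    have "ideal L R"
    proof (rule idealI[OF ring_axioms])
      have smul: "r \<otimes> a \<in> L" if "a \<in> L" "r \<in> carrier R" for a r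
        using that smult[of r a] rm[of r] S.smult_closed[of "\<mm> +> r" "J +> a"] I_l_closed by (simp add: L_def)
      show "subgroup L (add_monoid R)"
      proof (rule add.subgroupI)
        show "L \<subseteq> carrier R" using Icarr by (auto simp: L_def)
        have "\<zero> \<in> L" using S.zero_closed a_rcos_zero[OF mm(1) J.zero_closed] mm(2) J.zero_closed unfolding Vz L_def by auto
        then show "L \<noteq> {}" by auto
        show "\<ominus> a \<in> L" if "a \<in> L" for a
          using smul[OF that, of "\<ominus> \<one>"] that Icarr by (simp add: l_minus L_def)
        show "a \<oplus> b \<in> L" if "a \<in> L" "b \<in> L" for a b
          using that sum[of a b] S.m_closed[of "J +> a" "J +> b"] Icarr by (simp add: L_def)
      qed
      show "r \<otimes> a \<in> L" "a \<otimes> r \<in> L" if "a \<in> L" "r \<in> carrier R" for a r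
        using smul[OF that] that m_comm[of a r] Icarr by (auto simp: L_def)
    qed
    moreover have "J \<subseteq> L" using a_rcos_zero[OF mm(1)] S.zero_closed mm(2) unfolding L_def Vz by auto
    moreover have "A \<subseteq> L" using v.in_own_span[OF Bc] A(3) by (auto simp: L_def B_def)
    ultimately have "\<mm> \<subseteq> L" using A(4) by blast
    then show "carrier V \<subseteq> v.span B" by (auto simp: Vc L_def)
  qed
  have fB: "finite B" "card B \<le> v" using A(1,2) card_image_le[OF A(1), of "(+>) J"] by (auto simp: B_def)
  have "card B = v" using lower[OF fB(1) Bc gen] fB(2) by simp
  then have "v.dim = v"
    unfolding v.dim_def using fB Bc gen lower by (intro Least_equality) blast+
  then show ?thesis by (simp add: embedding_dim_def V_def)
qed

text \<open>Positive depth provides a nonempty regular sequence, whose first member is a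
  nonzerodivisor modulo \<open>Idl {}\<close>, the zero ideal.\<close>

lemma exists_nzd_in_maximal:
  assumes "depth R \<mm> = 1"
  obtains x where "x \<in> \<mm>" "x \<in> nonzerodivisors R"
proof -
  have "0 < depth R \<mm>" using assms by simp
  then obtain xs where xs: "set xs \<subseteq> \<mm>" "regular_sequence R xs" "0 < length xs"
    unfolding depth_def less_Sup_iff by (auto simp: zero_enat_def)
  define x where "x = xs ! 0"
  have x: "x \<in> \<mm>" using xs by (auto simp: x_def)
  then have xc: "x \<in> carrier R" using Icarr by blast
  have "Idl {} \<subseteq> {\<zero>}" by (rule genideal_minimal[OF zeroideal]) simp
  then have Idl0: "Idl {} = {\<zero>}"
    using additive_subgroup.zero_closed[OF ideal.axioms(1)[OF genideal_ideal[of "{}"]]] by auto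
  interpret Z: ideal "{\<zero>}" R by (rule zeroideal)
  have nz: "{\<zero>} +> x \<in> nonzerodivisors (R Quot {\<zero>})"
    using xs(2,3) Idl0 by (auto simp: regular_sequence_def Let_def x_def)
  have "a = \<zero>" if a: "a \<in> carrier R" "x \<otimes> a = \<zero>" for a
  proof -
    have "({\<zero>} +> x) \<otimes>\<^bsub>R Quot {\<zero>}\<^esub> ({\<zero>} +> a) = {\<zero>} +> (x \<otimes> a)"
      using a xc by (simp add: FactRing_def Z.rcoset_mult_add)
    also have "\<dots> = \<zero>\<^bsub>R Quot {\<zero>}\<^esub>" using a a_rcos_zero[OF zeroideal] by (simp add: FactRing_def)
    finally have "{\<zero>} +> a = \<zero>\<^bsub>R Quot {\<zero>}\<^esub>"
      using nz a(1) by (auto simp: nonzerodivisors_def FactRing_def A_RCOSETS_def')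
    then have "{\<zero>} +> a = {\<zero>}" by (simp add: FactRing_def)
    then show ?thesis using Z.a_rcos_self[OF a(1)] by auto
  qed
  then have "x \<in> nonzerodivisors R" using xc unfolding nonzerodivisors_def by blast
  with x show thesis by (rule that)
qed

end

theorem corollary3:
  fixes R :: "('a, 'b) ring_scheme" and \<mm> :: "'a set"
  assumes "noetherian_ring R"
    and "local_ring R \<mm>"
    and "krull_dim R = 1"
    and "cohen_macaulay R \<mm>"
    and "analytically_unramified R \<mm>"
    and "infinite (carrier (R Quot \<mm>))"
    and "primary_to R \<mm> (conductor_ideal R)"
  shows "let \<cc> = conductor_ideal R;
             \<nu> = real (embedding_dim R \<mm>);
             l = real (the_enat (module_length R (quot_module R \<cc>)));
             e = hs_multiplicity R \<cc>
         in e \<le> (\<nu> - 1) * l\<^sup>2 + l \<and>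
            e \<le> \<nu> * l\<^sup>2 \<and>
            (e = (\<nu> - 1) * l\<^sup>2 + l \<longleftrightarrow> l = 1) \<and>
            (e = \<nu> * l\<^sup>2 \<longleftrightarrow> l = 1)"
proof -
  interpret noetherian_local_ring R \<mm>
    using assms(1,2) by (simp add: noetherian_local_ring_def)
  define C where "C = conductor_ideal R"
  have C: "ideal C R" "C \<noteq> carrier R" and rad: "radical R C = \<mm>"
    using assms(7) unfolding primary_to_def primary_ideal_def C_def by blast+
  have "depth R \<mm> = 1" using assms(3,4) by (simp add: cohen_macaulay_def)
  then obtain s where s: "s \<in> \<mm>" "s \<in> nonzerodivisors R" by (rule exists_nzd_in_maximal)
  \<comment> \<open>The radical of the conductor is \<open>\<mm>\<close>, so a power of
    \<open>s\<close> is a nonzerodivisor in the conductor.\<close>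
  then obtain k :: nat where "s [^]\<^bsub>R\<^esub> k \<in> C" using rad by (auto simp: radical_def)
  then obtain e l v :: nat where l: "ideal_length R C (carrier R) = enat l"
    and v: "ideal_length R (\<mm> \<cdot>\<^bsub>R\<^esub> \<mm>) \<mm> = enat v"
    and pow: "\<And>n. ideal_length R (ideal_pow R C (Suc n)) (carrier R) = enat (l + n * e)"
    and bounds: "1 \<le> l" "l = 1 \<Longrightarrow> e = v" "2 \<le> l \<Longrightarrow> l < e \<and> e \<le> l + (l - 1) * (v - 1) * l"
    using conductor_length_bounds[OF assms(3,6) _ _ _ nzd_pow[OF s(2)]] C unfolding C_def by metis
  \<comment> \<open>The colength at exponent \<open>n + 1\<close> is linear in \<open>n\<close>, so
    the normalised limit is its slope \<open>e\<close>.\<close>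
  have "(\<lambda>n. (real l + real n * real e) / real (Suc n)) \<longlonglongrightarrow> real e"
  proof -
    have "(\<lambda>n. real e + (real l - real e) * inverse (real (Suc n))) \<longlonglongrightarrow> real e + (real l - real e) * 0"
      by (intro tendsto_intros LIMSEQ_inverse_real_of_nat)
    moreover have "real e + (real l - real e) * inverse (real (Suc n)) = (real l + real n * real e) / real (Suc n)" for n
      by (simp add: field_simps)
    ultimately show ?thesis by simp
  qed
  moreover have "real (the_enat (module_length R (quot_module R (ideal_pow R C (Suc n))))) = real l + real n * real e" for n
    unfolding module_length_quot_module[OF ideals_pow[OF C(1)]] pow by simp
  ultimately have "(\<lambda>n. real (the_enat (module_length R (quot_module R (ideal_pow R C (Suc n))))) / real (Suc n)) \<longlonglongrightarrow> real e"
    by (simp only:)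
  then have "(\<lambda>n. real (the_enat (module_length R (quot_module R (ideal_pow R C n)))) / real n) \<longlonglongrightarrow> real e"
    by (rule LIMSEQ_imp_Suc)
  then have e: "hs_multiplicity R C = real e"
    unfolding hs_multiplicity_def assms(3) by (simp add: limI one_enat_def)
  have ml: "module_length R (quot_module R C) = enat l"
    using module_length_quot_module[OF C(1)] l by simp
  have main: "real e \<le> (real v - 1) * (real l)\<^sup>2 + real l \<and> real e \<le> real v * (real l)\<^sup>2 \<and>
    (real e = (real v - 1) * (real l)\<^sup>2 + real l \<longleftrightarrow> real l = 1) \<and>
    (real e = real v * (real l)\<^sup>2 \<longleftrightarrow> real l = 1)"
  proof (cases "l = 1")
    case True
    then show ?thesis using bounds(2) by simp
  next
    case False
    then have l2: "2 \<le> l" using bounds(1) by simp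
    have le: "l < e" "e \<le> l + (l - 1) * (v - 1) * l" using bounds(3)[OF l2] by auto
    \<comment> \<open>Otherwise the truncated \<open>v - 1\<close> is 0 and the upper bound reads
      \<open>e \<le> l\<close>, against \<open>l < e\<close>.\<close>
    have v2: "2 \<le> v"
    proof (rule ccontr)
      assume "\<not> 2 \<le> v"
      then have "v - 1 = 0" by simp
      then show False using le by simp
    qed
    have "real e \<le> real (l + (l - 1) * (v - 1) * l)" using le(2) by (rule of_nat_mono)
    also have "\<dots> = real l + (real l - 1) * (real v - 1) * real l" using l2 v2 by (simp add: of_nat_diff)
    also have "\<dots> < (real v - 1) * (real l)\<^sup>2 + real l"
    proof -
      \<comment> \<open>The gap to the asserted bound: \<open>v - 1\<close> generators saved in the
        first step below \<open>\<mm>\<close>, each counted with length \<open>l\<close>.\<close>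
      have "0 < (real v - 1) * real l" using v2 l2 by simp
      then show ?thesis by (simp add: power2_eq_square algebra_simps)
    qed
    finally have 1: "real e < (real v - 1) * (real l)\<^sup>2 + real l" .
    have "real l < (real l)\<^sup>2" using l2 by (simp add: power2_eq_square)
    then have 2: "(real v - 1) * (real l)\<^sup>2 + real l < real v * (real l)\<^sup>2" by (simp add: algebra_simps)
    show ?thesis using 1 2 False by auto
  qed
  show ?thesis
    using main unfolding Let_def C_def[symmetric] e ml embedding_dim_eq_length[OF v] by simp
qed

end
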